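(* Let $\mathcal{E}$ be a topos satisfying NS and WDQO, with $\mathcal{I}:\mathrm{Dec}(\mathcal{E})\to\mathcal{E}$ the inclusion, $\Pi\dashv\mathcal{I}$ and unit $p$. Then the unit $p:1_{\mathcal{E}}\Rightarrow\mathcal{I}\Pi$ is a homotopy theory on $\mathcal{E}$, and there is an adjunction $q_{!}\dashv q^{\ast}$ with $q_{!}:\mathcal{E}_p\to\mathrm{Dec}(\mathcal{E})$ and $q^{\ast}:\mathrm{Dec}(\mathcal{E})\to\mathcal{E}_p$ such that $q_{!}H_p=\Pi$ and $q^{\ast}=H_p\mathcal{I}$. In other words, $\mathrm{Dec}(\mathcal{E})$ is an exponential ideal of $\mathcal{E}_p$.
   Context: A point of $X$ is an arrow $1\to X$. An object $X$ of a topos is decidable if its diagonal $X\to X\times X$ is a complemented subobject; $\mathrm{Dec}(\mathcal{E})$ is the full subcategory of decidable objects and $\mathcal{I}$ its inclusion. NS (Nullstellensatz): every non-initial object has a point. WDQO: for every object $X$ there is a minimal decidable object, $p_X:X\to\Pi(X)$ with $\Pi(X)$ decidable, such that every arrow $X\to 1+1$ factors uniquely through $p_X$. It is known that for a topos satisfying NS and WDQO, $\Pi$ is a functor left adjoint to $\mathcal{I}$, with unit $p$, and that $\Pi$ preserves finite products ($\mathrm{Dec}(\mathcal{E})$ is an exponential ideal of $\mathcal{E}$). A homotopy theory on a cartesian closed category $\mathcal{E}$ is a natural transformation $p:1_{\mathcal{E}}\Rightarrow\Pi_0:\mathcal{E}\to\mathcal{E}$ with $\Pi_0$ preserving finite products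 and $\mathcal{E}(1,p_X):\mathcal{E}(1,X)\to\mathcal{E}(1,\Pi_0(X))$ surjective for every $X$. The name $\ulcorner f\urcorner:1\to Y^X$ of $f:X\to Y$ is the transpose of $f\circ\pi_X:1\times X\to Y$. Arrows $f,g:X\to Y$ are $p$-homotopic, $f\sim_p g$, if $p_{Y^X}\circ\ulcorner f\urcorner=p_{Y^X}\circ\ulcorner g\urcorner$. The category $\mathcal{E}_p$ has the objects of $\mathcal{E}$, hom-sets $\mathcal{E}_p(X,Y)=\mathcal{E}(X,Y)/{\sim_p}$, and composition induced from $\mathcal{E}$; $H_p:\mathcal{E}\to\mathcal{E}_p$ is the identity-on-objects quotient functor. *)

theory Defs
  imports Main
begin

section \<open>Categories\<close>

record ('o, 'a) category =
  Obj :: "'o set"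
  Arr :: "'a set"
  Dom :: "'a \<Rightarrow> 'o"
  Cod :: "'a \<Rightarrow> 'o"
  Ide :: "'o \<Rightarrow> 'a"
  Comp :: "'a \<Rightarrow> 'a \<Rightarrow> 'a"  (infixl "\<cdot>\<index>" 70)

text \<open>Composition is written in applicative order: \<open>g \<cdot> f\<close> is \<open>f\<close> followed by \<open>g\<close>.\<close>

definition Hom :: "('o, 'a) category \<Rightarrow> 'o \<Rightarrow> 'o \<Rightarrow> 'a set" where
  "Hom C X Y = {f \<in> Arr C. Dom C f = X \<and> Cod C f = Y}"

locale category =
  fixes C :: "('o, 'a) category" (structure)
  assumes Dom_closed: "f \<in> Arr C \<Longrightarrow> Dom C f \<in> Obj C"
    and Cod_closed: "f \<in> Arr C \<Longrightarrow> Cod C f \<in> Obj C"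
    and Ide_in_Hom: "X \<in> Obj C \<Longrightarrow> Ide C X \<in> Hom C X X"
    and Comp_in_Hom: "f \<in> Hom C X Y \<Longrightarrow> g \<in> Hom C Y Z \<Longrightarrow> g \<cdot> f \<in> Hom C X Z"
    and Comp_Ide_right: "f \<in> Hom C X Y \<Longrightarrow> f \<cdot> Ide C X = f"
    and Comp_Ide_left: "f \<in> Hom C X Y \<Longrightarrow> Ide C Y \<cdot> f = f"
    and Comp_assoc: "f \<in> Hom C W X \<Longrightarrow> g \<in> Hom C X Y \<Longrightarrow> h \<in> Hom C Y Z \<Longrightarrow>
      h \<cdot> (g \<cdot> f) = (h \<cdot> g) \<cdot> f"

definition is_mono :: "('o, 'a) category \<Rightarrow> 'a \<Rightarrow> bool" where
  "is_mono C m \<longleftrightarrow> m \<in> Arr C \<and>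
     (\<forall>Z\<in>Obj C. \<forall>u\<in>Hom C Z (Dom C m). \<forall>v\<in>Hom C Z (Dom C m).
        m \<cdot>\<^bsub>C\<^esub> u = m \<cdot>\<^bsub>C\<^esub> v \<longrightarrow> u = v)"

definition is_iso :: "('o, 'a) category \<Rightarrow> 'a \<Rightarrow> bool" where
  "is_iso C f \<longleftrightarrow> f \<in> Arr C \<and>
     (\<exists>g\<in>Hom C (Cod C f) (Dom C f).
        g \<cdot>\<^bsub>C\<^esub> f = Ide C (Dom C f) \<and> f \<cdot>\<^bsub>C\<^esub> g = Ide C (Cod C f))"

definition isomorphic :: "('o, 'a) category \<Rightarrow> 'o \<Rightarrow> 'o \<Rightarrow> bool" where
  "isomorphic C X Y \<longleftrightarrow> (\<exists>f\<in>Hom C X Y. is_iso C f)"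

definition full_subcategory :: "('o, 'a) category \<Rightarrow> 'o set \<Rightarrow> ('o, 'a) category" where
  "full_subcategory C S = C\<lparr>Obj := S, Arr := {f \<in> Arr C. Dom C f \<in> S \<and> Cod C f \<in> S}\<rparr>"


section \<open>Limits, colimits and exponentials\<close>

definition is_terminal :: "('o, 'a) category \<Rightarrow> 'o \<Rightarrow> bool" where
  "is_terminal C T \<longleftrightarrow> T \<in> Obj C \<and> (\<forall>X\<in>Obj C. \<exists>!f. f \<in> Hom C X T)"

definition is_initial :: "('o, 'a) category \<Rightarrow> 'o \<Rightarrow> bool" where
  "is_initial C I \<longleftrightarrow> I \<in> Obj C \<and> (\<forall>X\<in>Obj C. \<exists>!f. f \<in> Hom C I X)"

definition is_product :: "('o, 'a) category \<Rightarrow> 'o \<Rightarrow> 'o \<Rightarrow> 'o \<Rightarrow> 'a \<Rightarrow> 'a \<Rightarrow> bool" where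
  "is_product C A B P p q \<longleftrightarrow> P \<in> Obj C \<and> p \<in> Hom C P A \<and> q \<in> Hom C P B \<and>
     (\<forall>Z\<in>Obj C. \<forall>f\<in>Hom C Z A. \<forall>g\<in>Hom C Z B.
        \<exists>!h. h \<in> Hom C Z P \<and> p \<cdot>\<^bsub>C\<^esub> h = f \<and> q \<cdot>\<^bsub>C\<^esub> h = g)"

definition is_coproduct :: "('o, 'a) category \<Rightarrow> 'o \<Rightarrow> 'o \<Rightarrow> 'o \<Rightarrow> 'a \<Rightarrow> 'a \<Rightarrow> bool" where
  "is_coproduct C A B S i j \<longleftrightarrow> S \<in> Obj C \<and> i \<in> Hom C A S \<and> j \<in> Hom C B S \<and>
     (\<forall>Z\<in>Obj C. \<forall>f\<in>Hom C A Z. \<forall>g\<in>Hom C B Z.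
        \<exists>!h. h \<in> Hom C S Z \<and> h \<cdot>\<^bsub>C\<^esub> i = f \<and> h \<cdot>\<^bsub>C\<^esub> j = g)"

definition is_equalizer :: "('o, 'a) category \<Rightarrow> 'a \<Rightarrow> 'a \<Rightarrow> 'o \<Rightarrow> 'a \<Rightarrow> bool" where
  "is_equalizer C f g K k \<longleftrightarrow> K \<in> Obj C \<and> k \<in> Hom C K (Dom C f) \<and> f \<cdot>\<^bsub>C\<^esub> k = g \<cdot>\<^bsub>C\<^esub> k \<and>
     (\<forall>Z\<in>Obj C. \<forall>u\<in>Hom C Z (Dom C f). f \<cdot>\<^bsub>C\<^esub> u = g \<cdot>\<^bsub>C\<^esub> u \<longrightarrow>
        (\<exists>!h. h \<in> Hom C Z K \<and> k \<cdot>\<^bsub>C\<^esub> h = u))"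

text \<open>\<open>is_pullback C f g P u v\<close>: \<open>u\<close> and \<open>v\<close> are the projections of \<open>P\<close> to the domains of
  \<open>f\<close> and \<open>g\<close>.\<close>

definition is_pullback :: "('o, 'a) category \<Rightarrow> 'a \<Rightarrow> 'a \<Rightarrow> 'o \<Rightarrow> 'a \<Rightarrow> 'a \<Rightarrow> bool" where
  "is_pullback C f g P u v \<longleftrightarrow> f \<in> Arr C \<and> g \<in> Arr C \<and> Cod C f = Cod C g \<and>
     P \<in> Obj C \<and> u \<in> Hom C P (Dom C f) \<and> v \<in> Hom C P (Dom C g) \<and> f \<cdot>\<^bsub>C\<^esub> u = g \<cdot>\<^bsub>C\<^esub> v \<and>
     (\<forall>Z\<in>Obj C. \<forall>a\<in>Hom C Z (Dom C f). \<forall>b\<in>Hom C Z (Dom C g).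
        f \<cdot>\<^bsub>C\<^esub> a = g \<cdot>\<^bsub>C\<^esub> b \<longrightarrow> (\<exists>!h. h \<in> Hom C Z P \<and> u \<cdot>\<^bsub>C\<^esub> h = a \<and> v \<cdot>\<^bsub>C\<^esub> h = b))"

text \<open>The operations \<open>one\<close>, \<open>prod\<close>, \<open>coprod\<close>, \<open>expo\<close> below are arbitrary choices of objects (with
  their structure arrows) that have the respective universal property; they are meaningful
  only where such objects exist.\<close>

definition one :: "('o, 'a) category \<Rightarrow> 'o" where
  "one C = (SOME T. is_terminal C T)"

definition the_product :: "('o, 'a) category \<Rightarrow> 'o \<Rightarrow> 'o \<Rightarrow> 'o \<times> 'a \<times> 'a" where
  "the_product C A B = (SOME (P, p, q). is_product C A B P p q)"

definition prod :: "('o, 'a) category \<Rightarrow> 'o \<Rightarrow> 'o \<Rightarrow> 'o" where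
  "prod C A B = fst (the_product C A B)"

definition pr1 :: "('o, 'a) category \<Rightarrow> 'o \<Rightarrow> 'o \<Rightarrow> 'a" where
  "pr1 C A B = fst (snd (the_product C A B))"

definition pr2 :: "('o, 'a) category \<Rightarrow> 'o \<Rightarrow> 'o \<Rightarrow> 'a" where
  "pr2 C A B = snd (snd (the_product C A B))"

definition pairing :: "('o, 'a) category \<Rightarrow> 'a \<Rightarrow> 'a \<Rightarrow> 'a" where
  "pairing C f g = (THE h. h \<in> Hom C (Dom C f) (prod C (Cod C f) (Cod C g)) \<and>
     pr1 C (Cod C f) (Cod C g) \<cdot>\<^bsub>C\<^esub> h = f \<and> pr2 C (Cod C f) (Cod C g) \<cdot>\<^bsub>C\<^esub> h = g)"

definition prod_map :: "('o, 'a) category \<Rightarrow> 'a \<Rightarrow> 'a \<Rightarrow> 'a" where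
  "prod_map C f g = pairing C (f \<cdot>\<^bsub>C\<^esub> pr1 C (Dom C f) (Dom C g)) (g \<cdot>\<^bsub>C\<^esub> pr2 C (Dom C f) (Dom C g))"

definition coprod :: "('o, 'a) category \<Rightarrow> 'o \<Rightarrow> 'o \<Rightarrow> 'o" where
  "coprod C A B = (SOME S. \<exists>i j. is_coproduct C A B S i j)"

text \<open>\<open>is_exponential C X Y Z e\<close>: the object \<open>Z\<close> with evaluation \<open>e : Z \<times> X \<rightarrow> Y\<close> is an
  exponential \<open>Y\<^sup>X\<close>.\<close>

definition is_exponential :: "('o, 'a) category \<Rightarrow> 'o \<Rightarrow> 'o \<Rightarrow> 'o \<Rightarrow> 'a \<Rightarrow> bool" where
  "is_exponential C X Y Z e \<longleftrightarrow> Z \<in> Obj C \<and> e \<in> Hom C (prod C Z X) Y \<and>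
     (\<forall>A\<in>Obj C. \<forall>h\<in>Hom C (prod C A X) Y.
        \<exists>!k. k \<in> Hom C A Z \<and> e \<cdot>\<^bsub>C\<^esub> prod_map C k (Ide C X) = h)"

definition the_exponential :: "('o, 'a) category \<Rightarrow> 'o \<Rightarrow> 'o \<Rightarrow> 'o \<times> 'a" where
  "the_exponential C X Y = (SOME (Z, e). is_exponential C X Y Z e)"

definition expo :: "('o, 'a) category \<Rightarrow> 'o \<Rightarrow> 'o \<Rightarrow> 'o" where
  "expo C X Y = fst (the_exponential C X Y)"

definition eval :: "('o, 'a) category \<Rightarrow> 'o \<Rightarrow> 'o \<Rightarrow> 'a" where
  "eval C X Y = snd (the_exponential C X Y)"

definition transpose :: "('o, 'a) category \<Rightarrow> 'o \<Rightarrow> 'o \<Rightarrow> 'o \<Rightarrow> 'a \<Rightarrow> 'a" where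
  "transpose C A X Y h =
     (THE k. k \<in> Hom C A (expo C X Y) \<and> eval C X Y \<cdot>\<^bsub>C\<^esub> prod_map C k (Ide C X) = h)"

definition has_finite_products :: "('o, 'a) category \<Rightarrow> bool" where
  "has_finite_products C \<longleftrightarrow> (\<exists>T. is_terminal C T) \<and>
     (\<forall>A\<in>Obj C. \<forall>B\<in>Obj C. \<exists>P p q. is_product C A B P p q)"

definition has_finite_limits :: "('o, 'a) category \<Rightarrow> bool" where
  "has_finite_limits C \<longleftrightarrow> has_finite_products C \<and>
     (\<forall>X\<in>Obj C. \<forall>Y\<in>Obj C. \<forall>f\<in>Hom C X Y. \<forall>g\<in>Hom C X Y. \<exists>K k. is_equalizer C f g K k)"

definition cartesian_closed :: "('o, 'a) category \<Rightarrow> bool" where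
  "cartesian_closed C \<longleftrightarrow> category C \<and> has_finite_products C \<and>
     (\<forall>X\<in>Obj C. \<forall>Y\<in>Obj C. \<exists>Z e. is_exponential C X Y Z e)"


section \<open>Toposes and decidable objects\<close>

definition is_subobject_classifier :: "('o, 'a) category \<Rightarrow> 'o \<Rightarrow> 'a \<Rightarrow> bool" where
  "is_subobject_classifier C Om t \<longleftrightarrow> Om \<in> Obj C \<and> t \<in> Hom C (one C) Om \<and>
     (\<forall>m. is_mono C m \<longrightarrow>
        (\<exists>!chi. chi \<in> Hom C (Cod C m) Om \<and>
           (\<exists>b. is_pullback C chi t (Dom C m) m b)))"

definition topos :: "('o, 'a) category \<Rightarrow> bool" where
  "topos C \<longleftrightarrow> cartesian_closed C \<and> has_finite_limits C \<and> (\<exists>Om t. is_subobject_classifier C Om t)"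

text \<open>A subobject is complemented if it has a complement in the poset of subobjects of its
  codomain: the intersection is the least subobject and only the whole object contains both.\<close>

definition factors_through :: "('o, 'a) category \<Rightarrow> 'a \<Rightarrow> 'a \<Rightarrow> bool" where
  "factors_through C m s \<longleftrightarrow> (\<exists>k\<in>Hom C (Dom C m) (Dom C s). s \<cdot>\<^bsub>C\<^esub> k = m)"

definition is_complement :: "('o, 'a) category \<Rightarrow> 'a \<Rightarrow> 'a \<Rightarrow> bool" where
  "is_complement C m n \<longleftrightarrow> is_mono C m \<and> is_mono C n \<and> Cod C m = Cod C n \<and>
     (\<exists>P u v. is_pullback C m n P u v \<and> is_initial C P) \<and>
     (\<forall>s. is_mono C s \<and> Cod C s = Cod C m \<and> factors_through C m s \<and> factors_through C n s \<longrightarrow>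
        is_iso C s)"

definition complemented :: "('o, 'a) category \<Rightarrow> 'a \<Rightarrow> bool" where
  "complemented C m \<longleftrightarrow> (\<exists>n. is_complement C m n)"

definition diagonal :: "('o, 'a) category \<Rightarrow> 'o \<Rightarrow> 'a" where
  "diagonal C X = pairing C (Ide C X) (Ide C X)"

definition decidable :: "('o, 'a) category \<Rightarrow> 'o \<Rightarrow> bool" where
  "decidable C X \<longleftrightarrow> X \<in> Obj C \<and> complemented C (diagonal C X)"

definition Dec :: "('o, 'a) category \<Rightarrow> ('o, 'a) category" where
  "Dec C = full_subcategory C {X. decidable C X}"

definition NS :: "('o, 'a) category \<Rightarrow> bool" where
  "NS C \<longleftrightarrow> (\<forall>X\<in>Obj C. \<not> is_initial C X \<longrightarrow> (\<exists>x. x \<in> Hom C (one C) X))"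

definition WDQO :: "('o, 'a) category \<Rightarrow> bool" where
  "WDQO C \<longleftrightarrow> (\<forall>X\<in>Obj C. \<exists>D q. decidable C D \<and> q \<in> Hom C X D \<and>
     (\<forall>f\<in>Hom C X (coprod C (one C) (one C)).
        \<exists>!g. g \<in> Hom C D (coprod C (one C) (one C)) \<and> g \<cdot>\<^bsub>C\<^esub> q = f))"


section \<open>Functors and adjunctions\<close>

record ('o, 'a, 'p, 'b) cfunctor =
  OMap :: "'o \<Rightarrow> 'p"
  AMap :: "'a \<Rightarrow> 'b"

definition is_functor ::
  "('o, 'a) category \<Rightarrow> ('p, 'b) category \<Rightarrow> ('o, 'a, 'p, 'b) cfunctor \<Rightarrow> bool" where
  "is_functor C D F \<longleftrightarrow> category C \<and> category D \<and>
     (\<forall>X\<in>Obj C. OMap F X \<in> Obj D \<and> AMap F (Ide C X) = Ide D (OMap F X)) \<and>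
     (\<forall>X Y. \<forall>f\<in>Hom C X Y. AMap F f \<in> Hom D (OMap F X) (OMap F Y)) \<and>
     (\<forall>X Y Z. \<forall>f\<in>Hom C X Y. \<forall>g\<in>Hom C Y Z. AMap F (g \<cdot>\<^bsub>C\<^esub> f) = AMap F g \<cdot>\<^bsub>D\<^esub> AMap F f)"

definition functor_eq ::
  "('o, 'a) category \<Rightarrow> ('o, 'a, 'p, 'b) cfunctor \<Rightarrow> ('o, 'a, 'p, 'b) cfunctor \<Rightarrow> bool" where
  "functor_eq C F G \<longleftrightarrow>
     (\<forall>X\<in>Obj C. OMap F X = OMap G X) \<and> (\<forall>f\<in>Arr C. AMap F f = AMap G f)"

definition id_functor :: "('o, 'a, 'o, 'a) cfunctor" where
  "id_functor = \<lparr>OMap = (\<lambda>X. X), AMap = (\<lambda>f. f)\<rparr>"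

definition comp_functor :: "('p, 'b, 'q, 'c) cfunctor \<Rightarrow> ('o, 'a, 'p, 'b) cfunctor \<Rightarrow>
    ('o, 'a, 'q, 'c) cfunctor"  (infixl "\<circ>\<^sub>F" 55) where
  "G \<circ>\<^sub>F F = \<lparr>OMap = OMap G \<circ> OMap F, AMap = AMap G \<circ> AMap F\<rparr>"

text \<open>The inclusion of any (full) subcategory, in particular of \<open>Dec C\<close> into \<open>C\<close>.\<close>

abbreviation inclusion :: "('o, 'a, 'o, 'a) cfunctor" where
  "inclusion \<equiv> id_functor"

definition natural_transformation :: "('o, 'a) category \<Rightarrow> ('p, 'b) category \<Rightarrow>
    ('o, 'a, 'p, 'b) cfunctor \<Rightarrow> ('o, 'a, 'p, 'b) cfunctor \<Rightarrow> ('o \<Rightarrow> 'b) \<Rightarrow> bool" where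
  "natural_transformation C D F G t \<longleftrightarrow> is_functor C D F \<and> is_functor C D G \<and>
     (\<forall>X\<in>Obj C. t X \<in> Hom D (OMap F X) (OMap G X)) \<and>
     (\<forall>X Y. \<forall>f\<in>Hom C X Y. AMap G f \<cdot>\<^bsub>D\<^esub> t X = t Y \<cdot>\<^bsub>D\<^esub> AMap F f)"

text \<open>\<open>adjunction C D F G u\<close>: the functor \<open>F : C \<rightarrow> D\<close> is left adjoint to \<open>G : D \<rightarrow> C\<close> with
  unit \<open>u\<close>.\<close>

definition adjunction :: "('o, 'a) category \<Rightarrow> ('p, 'b) category \<Rightarrow>
    ('o, 'a, 'p, 'b) cfunctor \<Rightarrow> ('p, 'b, 'o, 'a) cfunctor \<Rightarrow> ('o \<Rightarrow> 'a) \<Rightarrow> bool" where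
  "adjunction C D F G u \<longleftrightarrow> is_functor C D F \<and> is_functor D C G \<and>
     natural_transformation C C id_functor (G \<circ>\<^sub>F F) u \<and>
     (\<forall>X\<in>Obj C. \<forall>Y\<in>Obj D. \<forall>f\<in>Hom C X (OMap G Y).
        \<exists>!g. g \<in> Hom D (OMap F X) Y \<and> AMap G g \<cdot>\<^bsub>C\<^esub> u X = f)"

definition preserves_finite_products :: "('o, 'a) category \<Rightarrow> ('p, 'b) category \<Rightarrow>
    ('o, 'a, 'p, 'b) cfunctor \<Rightarrow> bool" where
  "preserves_finite_products C D F \<longleftrightarrow>
     (\<forall>T. is_terminal C T \<longrightarrow> is_terminal D (OMap F T)) \<and>
     (\<forall>A\<in>Obj C. \<forall>B\<in>Obj C. \<forall>P p q. is_product C A B P p q \<longrightarrow>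
        is_product D (OMap F A) (OMap F B) (OMap F P) (AMap F p) (AMap F q))"

definition fully_faithful ::
  "('o, 'a) category \<Rightarrow> ('p, 'b) category \<Rightarrow> ('o, 'a, 'p, 'b) cfunctor \<Rightarrow> bool" where
  "fully_faithful C D F \<longleftrightarrow> is_functor C D F \<and>
     (\<forall>X\<in>Obj C. \<forall>Y\<in>Obj C. bij_betw (AMap F) (Hom C X Y) (Hom D (OMap F X) (OMap F Y)))"

text \<open>The category \<open>D\<close>, regarded as a full subcategory of the cartesian closed category \<open>C\<close> via
  the embedding \<open>G\<close>, contains (up to isomorphism) every exponential \<open>Y\<^sup>X\<close> with \<open>Y\<close> in \<open>D\<close>.\<close>

definition exponential_ideal ::
  "('p, 'b) category \<Rightarrow> ('o, 'a) category \<Rightarrow> ('p, 'b, 'o, 'a) cfunctor \<Rightarrow> bool" where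
  "exponential_ideal D C G \<longleftrightarrow> cartesian_closed C \<and> fully_faithful D C G \<and>
     (\<forall>X\<in>Obj C. \<forall>Y\<in>Obj D. \<exists>W\<in>Obj D. isomorphic C (expo C X (OMap G Y)) (OMap G W))"


section \<open>Homotopy theories\<close>

definition homotopy_theory ::
  "('o, 'a) category \<Rightarrow> ('o, 'a, 'o, 'a) cfunctor \<Rightarrow> ('o \<Rightarrow> 'a) \<Rightarrow> bool" where
  "homotopy_theory E P p \<longleftrightarrow> cartesian_closed E \<and>
     natural_transformation E E id_functor P p \<and>
     preserves_finite_products E E P \<and>
     (\<forall>X\<in>Obj E. \<forall>y\<in>Hom E (one E) (OMap P X). \<exists>x\<in>Hom E (one E) X. p X \<cdot>\<^bsub>E\<^esub> x = y)"

definition name_of :: "('o, 'a) category \<Rightarrow> 'a \<Rightarrow> 'a" where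
  "name_of E f =
     transpose E (one E) (Dom E f) (Cod E f) (f \<cdot>\<^bsub>E\<^esub> pr2 E (one E) (Dom E f))"

definition homotopic :: "('o, 'a) category \<Rightarrow> ('o \<Rightarrow> 'a) \<Rightarrow> 'a \<Rightarrow> 'a \<Rightarrow> bool" where
  "homotopic E p f g \<longleftrightarrow> f \<in> Arr E \<and> g \<in> Arr E \<and> Dom E f = Dom E g \<and> Cod E f = Cod E g \<and>
     p (expo E (Dom E f) (Cod E f)) \<cdot>\<^bsub>E\<^esub> name_of E f =
     p (expo E (Dom E f) (Cod E f)) \<cdot>\<^bsub>E\<^esub> name_of E g"

definition hclass :: "('o, 'a) category \<Rightarrow> ('o \<Rightarrow> 'a) \<Rightarrow> 'a \<Rightarrow> 'a set" where
  "hclass E p f = {g. homotopic E p f g}"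

text \<open>The arrows of \<open>E\<^sub>p\<close> are homotopy classes; since all members of a class are parallel, its
  domain and codomain can be read off from any of them.\<close>

definition homotopy_category :: "('o, 'a) category \<Rightarrow> ('o \<Rightarrow> 'a) \<Rightarrow> ('o, 'a set) category" where
  "homotopy_category E p =
     \<lparr>Obj = Obj E,
      Arr = hclass E p ` Arr E,
      Dom = (\<lambda>F. Dom E (SOME f. f \<in> F)),
      Cod = (\<lambda>F. Cod E (SOME f. f \<in> F)),
      Ide = (\<lambda>X. hclass E p (Ide E X)),
      Comp = (\<lambda>G F. \<Union>g\<in>G. \<Union>f\<in>F. hclass E p (g \<cdot>\<^bsub>E\<^esub> f))\<rparr>"

definition quotient_functor ::
  "('o, 'a) category \<Rightarrow> ('o \<Rightarrow> 'a) \<Rightarrow> ('o, 'a, 'o, 'a set) cfunctor" where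
  "quotient_functor E p = \<lparr>OMap = (\<lambda>X. X), AMap = hclass E p\<rparr>"

end

theory Submission
  imports Defs
begin

text \<open>
  Three consequences of NS drive the proof: arrows into a decidable object are equal as soon as they
  agree on points; the units \<open>p\<close> are covers (they factor through no proper subobject, since a
  subobject of a decidable object is decidable); and the units are surjective on points.

  The key step is that \<open>D\<^sup>X\<close> is decidable for decidable \<open>D\<close>. Any arrow \<open>t : Y \<rightarrow> D\<^sup>X\<close> identifies
  whatever \<open>p\<close> identifies, because its transpose can be tested on points, where it is an arrow
  \<open>Y \<rightarrow> D\<close> and hence factors through \<open>p\<close>. As \<open>p\<close> is a cover, \<open>t\<close> factors through \<open>p\<close>; for
  \<open>t = id\<close> this exhibits \<open>D\<^sup>X\<close> as a retract of \<open>\<Pi> (D\<^sup>X)\<close>. So decidable objects form an exponential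
  ideal and \<open>\<Pi>\<close> preserves products.

  Homotopy is a congruence because composition acts on names by arrows between exponentials and \<open>p\<close>
  is natural; it is compatible with pairing because \<open>\<Pi>\<close> preserves the product
  \<open>(A \<times> B)\<^sup>X = A\<^sup>X \<times> B\<^sup>X\<close>. Hence products and exponentials pass to the homotopy category. Since
  \<open>f = ev (name f, id)\<close>, homotopic arrows have equal images under \<open>\<Pi>\<close>, so \<open>\<Pi>\<close> descends to it, and
  homotopic arrows into a decidable object are equal.
\<close>

section \<open>Cartesian closed categories\<close>

text \<open>Subobjects are handled through their membership predicate: a generalized element
  \<open>a\<close> belongs to \<open>s\<close> when \<open>factors_through C a s\<close>.
  Complements live in the poset of subobjects, so their join condition tests only subobjects of the
  ambient object itself; an argument by cases about arrows into that object needs the condition to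
  survive pullback. This obstacle shapes the topos part. It is overcome by universal quantification
  along an arrow, built from the classifier, which also takes the place of an image factorization
  when an arrow is factored through the unit. A second obstacle is that \<open>one\<close>,
  \<open>prod\<close> and \<open>expo\<close> are arbitrary choices, and those made in the homotopy
  category bear no relation to those made in the base. Universal properties are therefore also
  established for arbitrary cones and transported along isomorphisms. The arguments with points
  include the degenerate topos, in which \<open>1\<close> is initial.\<close>

context category
begin

lemma Hom_iff: "f \<in> Hom C X Y \<longleftrightarrow> f \<in> Arr C \<and> Dom C f = X \<and> Cod C f = Y"
  by (auto simp: Hom_def)

lemma Ide_simps [simp]:
  assumes "X \<in> Obj C"
  shows "Ide C X \<in> Arr C" "Dom C (Ide C X) = X" "Cod C (Ide C X) = X"
  using Ide_in_Hom[OF assms] by (auto simp: Hom_iff)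

lemma Comp_simps [simp]:
  assumes "f \<in> Arr C" "g \<in> Arr C" "Dom C g = Cod C f"
  shows "g \<cdot> f \<in> Arr C" "Dom C (g \<cdot> f) = Dom C f" "Cod C (g \<cdot> f) = Cod C g"
  using Comp_in_Hom[of f "Dom C f" "Cod C f" g "Cod C g"] assms by (auto simp: Hom_iff)

lemma Comp_Ide [simp]:
  "f \<in> Arr C \<Longrightarrow> Dom C f = X \<Longrightarrow> f \<cdot> Ide C X = f"
  "f \<in> Arr C \<Longrightarrow> Cod C f = Y \<Longrightarrow> Ide C Y \<cdot> f = f"
  using Comp_Ide_left Comp_Ide_right by (auto simp: Hom_iff)

lemma Comp_assoc_simp [simp]:
  assumes "f \<in> Arr C" "g \<in> Arr C" "h \<in> Arr C" "Dom C g = Cod C f" "Dom C h = Cod C g"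
  shows "(h \<cdot> g) \<cdot> f = h \<cdot> (g \<cdot> f)"
  using Comp_assoc[of f "Dom C f" "Cod C f" g "Cod C g" h "Cod C h"] assms by (auto simp: Hom_iff)

text \<open>Simplification associates composites to the right, which hides
  \<open>a \<cdot> b\<close> inside \<open>a \<cdot> (b \<cdot> z)\<close>; an equation for the
  composite is therefore extended by \<open>z\<close> before it is used.\<close>

lemma Comp_eq_extend:
  assumes "a \<cdot> b = c" "a \<in> Arr C" "b \<in> Arr C" "Dom C a = Cod C b"
    "z \<in> Arr C" "Cod C z = Dom C b"
  shows "a \<cdot> (b \<cdot> z) = c \<cdot> z"
  using assms by auto

lemma Arr_closed [simp]: "f \<in> Arr C \<Longrightarrow> Dom C f \<in> Obj C" "f \<in> Arr C \<Longrightarrow> Cod C f \<in> Obj C"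
  by (auto intro: Dom_closed Cod_closed)

section \<open>Monomorphisms, and subobjects through their generalized elements\<close>

lemma mono_Arr: "is_mono C m \<Longrightarrow> m \<in> Arr C"
  by (simp add: is_mono_def)

lemma mono_cancel:
  assumes "is_mono C m" "m \<cdot> u = m \<cdot> v" "u \<in> Arr C" "v \<in> Arr C"
    "Cod C u = Dom C m" "Cod C v = Dom C m" "Dom C u = Dom C v"
  shows "u = v"
proof -
  have "\<forall>Z\<in>Obj C. \<forall>u\<in>Hom C Z (Dom C m). \<forall>v\<in>Hom C Z (Dom C m). m \<cdot> u = m \<cdot> v \<longrightarrow> u = v"
    using assms(1) unfolding is_mono_def by blast
  moreover have "Dom C u \<in> Obj C" "u \<in> Hom C (Dom C u) (Dom C m)" "v \<in> Hom C (Dom C u) (Dom C m)"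
    using assms by (auto simp: Hom_iff)
  ultimately show ?thesis using assms(2) by blast
qed

lemma monoI:
  assumes "m \<in> Arr C"
    and "\<And>u v. u \<in> Arr C \<Longrightarrow> v \<in> Arr C \<Longrightarrow> Cod C u = Dom C m \<Longrightarrow> Cod C v = Dom C m \<Longrightarrow>
      Dom C u = Dom C v \<Longrightarrow> m \<cdot> u = m \<cdot> v \<Longrightarrow> u = v"
  shows "is_mono C m"
  unfolding is_mono_def using assms by (auto simp: Hom_iff)

lemma split_mono:
  assumes "m \<in> Arr C" "r \<in> Arr C" "Dom C r = Cod C m" "r \<cdot> m = Ide C (Dom C m)"
  shows "is_mono C m"
proof (rule monoI)
  fix u v assume uv: "u \<in> Arr C" "v \<in> Arr C" "Cod C u = Dom C m" "Cod C v = Dom C m"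
    "m \<cdot> u = m \<cdot> v"
  have "(r \<cdot> m) \<cdot> u = (r \<cdot> m) \<cdot> v" using uv assms(1-3) by simp
  then show "u = v" using uv assms by simp
qed fact

lemma mono_comp:
  assumes "is_mono C m" "is_mono C n" "Dom C n = Cod C m"
  shows "is_mono C (n \<cdot> m)"
proof (rule monoI)
  note [simp] = assms(1,2)[THEN mono_Arr]
  show "n \<cdot> m \<in> Arr C" using assms(3) by simp
  fix u v assume uv: "u \<in> Arr C" "v \<in> Arr C" "Cod C u = Dom C (n \<cdot> m)" "Cod C v = Dom C (n \<cdot> m)"
    "Dom C u = Dom C v" "(n \<cdot> m) \<cdot> u = (n \<cdot> m) \<cdot> v"
  then have "n \<cdot> (m \<cdot> u) = n \<cdot> (m \<cdot> v)" using assms(3) by simp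
  from mono_cancel[OF assms(2) this] have "m \<cdot> u = m \<cdot> v" using uv assms(3) by simp
  from mono_cancel[OF assms(1) this] show "u = v" using uv assms(3) by simp
qed

lemma factors_through_iff:
  "factors_through C a s \<longleftrightarrow> (\<exists>k\<in>Arr C. Dom C k = Dom C a \<and> Cod C k = Dom C s \<and> s \<cdot> k = a)"
  by (auto simp: factors_through_def Hom_iff)

lemma factors_throughI:
  "k \<in> Arr C \<Longrightarrow> Dom C k = Dom C a \<Longrightarrow> Cod C k = Dom C s \<Longrightarrow> s \<cdot> k = a \<Longrightarrow> factors_through C a s"
  by (auto simp: factors_through_iff)

lemma factors_throughE:
  assumes "factors_through C a s"
  obtains k where "k \<in> Arr C" "Dom C k = Dom C a" "Cod C k = Dom C s" "s \<cdot> k = a"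
  using assms unfolding factors_through_iff by blast

lemma factors_through_comp:
  assumes "factors_through C a s" "s \<in> Arr C" "a \<in> Arr C" "z \<in> Arr C" "Cod C z = Dom C a"
  shows "factors_through C (a \<cdot> z) s"
proof -
  obtain k where k: "k \<in> Arr C" "Dom C k = Dom C a" "Cod C k = Dom C s" "s \<cdot> k = a"
    using assms(1) by (rule factors_throughE)
  show ?thesis
    using k assms by (intro factors_throughI[of "k \<cdot> z"]) auto
qed

lemma factors_through_trans:
  assumes "factors_through C a m" "factors_through C m s" "m \<in> Arr C" "s \<in> Arr C"
  shows "factors_through C a s"
proof -
  from assms(1) obtain k where k: "k \<in> Arr C" "Dom C k = Dom C a" "Cod C k = Dom C m" "m \<cdot> k = a"
    by (rule factors_throughE)
  then show ?thesis using factors_through_comp[OF assms(2,4,3) k(1,3)] by simp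
qed

lemma factors_through_refl: "s \<in> Arr C \<Longrightarrow> factors_through C s s"
  by (rule factors_throughI[of "Ide C (Dom C s)"]) auto

text \<open>The factorization gives a right inverse \<open>k\<close>; cancelling the mono in
  \<open>s \<cdot> (k \<cdot> s) = s\<close> makes it a left inverse too.\<close>

lemma iso_if_Ide_factors:
  assumes "is_mono C s" "factors_through C (Ide C (Cod C s)) s"
  shows "is_iso C s"
proof -
  have [simp]: "s \<in> Arr C" by (simp add: mono_Arr assms)
  obtain k where k: "k \<in> Arr C" "Dom C k = Cod C s" "Cod C k = Dom C s" "s \<cdot> k = Ide C (Cod C s)"
    using assms(2) by (rule factors_throughE) (auto simp: \<open>s \<in> Arr C\<close>)
  have "s \<cdot> (k \<cdot> s) = s \<cdot> Ide C (Dom C s)" using k Comp_eq_extend[OF k(4), of s] by simp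
  from mono_cancel[OF assms(1) this] have "k \<cdot> s = Ide C (Dom C s)" using k by simp
  then show ?thesis using k unfolding is_iso_def by (auto simp: Hom_iff)
qed

lemma factors_through_iso:
  assumes "is_iso C s" "a \<in> Arr C" "Cod C a = Cod C s"
  shows "factors_through C a s"
proof -
  obtain g where g: "g \<in> Arr C" "Dom C g = Cod C s" "Cod C g = Dom C s" "s \<cdot> g = Ide C (Cod C s)"
    and [simp]: "s \<in> Arr C"
    using assms(1) unfolding is_iso_def by (auto simp: Hom_iff)
  show ?thesis using g assms(2,3) Comp_eq_extend[OF g(4), of a]
    by (intro factors_throughI[of "g \<cdot> a"]) auto
qed

lemma isomorphicI:
  assumes "f \<in> Hom C X Y" "g \<in> Hom C Y X" "g \<cdot> f = Ide C X" "f \<cdot> g = Ide C Y"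
  shows "isomorphic C X Y"
  unfolding isomorphic_def is_iso_def
  by (rule bexI[of _ f]) (use assms in \<open>auto simp: Hom_iff intro!: bexI[of _ g]\<close>)

section \<open>Universal properties of initial objects, products and terminal objects\<close>

lemma initial_arrow:
  assumes "is_initial C I" "X \<in> Obj C"
  obtains f where "f \<in> Arr C" "Dom C f = I" "Cod C f = X"
  using assms by (auto simp: is_initial_def Hom_iff)

lemma initial_unique:
  assumes "is_initial C I" "f \<in> Arr C" "g \<in> Arr C" "Dom C f = I" "Dom C g = I" "Cod C f = Cod C g"
  shows "f = g"
proof -
  have "\<exists>!h. h \<in> Hom C I (Cod C f)" using assms by (auto simp: is_initial_def)
  then show ?thesis using assms by (auto simp: Hom_iff)
qed

lemma product_unique:
  assumes "is_product C A B P p q" "h \<in> Arr C" "h' \<in> Arr C" "Cod C h = P" "Cod C h' = P"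
    "Dom C h = Dom C h'" "p \<cdot> h = p \<cdot> h'" "q \<cdot> h = q \<cdot> h'"
  shows "h = h'"
proof -
  have pq: "p \<in> Arr C" "q \<in> Arr C" "Dom C p = P" "Dom C q = P" "Cod C p = A" "Cod C q = B"
    using assms(1) by (auto simp: is_product_def Hom_iff)
  have "\<exists>!k. k \<in> Hom C (Dom C h) P \<and> p \<cdot> k = p \<cdot> h \<and> q \<cdot> k = q \<cdot> h"
    using assms pq unfolding is_product_def by (simp add: Hom_iff)
  then show ?thesis using assms by (auto simp: Hom_iff)
qed

lemma product_exists:
  assumes "is_product C A B P p q" "f \<in> Arr C" "g \<in> Arr C" "Cod C f = A" "Cod C g = B"
    "Dom C f = Dom C g"
  obtains h where "h \<in> Arr C" "Dom C h = Dom C f" "Cod C h = P" "p \<cdot> h = f" "q \<cdot> h = g"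
proof -
  have "\<exists>!k. k \<in> Hom C (Dom C f) P \<and> p \<cdot> k = f \<and> q \<cdot> k = g"
    using assms unfolding is_product_def by (simp add: Hom_iff)
  then show ?thesis using that by (auto simp: Hom_iff)
qed

lemma product_simps:
  assumes "is_product C A B P p q"
  shows "p \<in> Arr C" "q \<in> Arr C" "Dom C p = P" "Dom C q = P" "Cod C p = A" "Cod C q = B" "P \<in> Obj C"
  using assms by (auto simp: is_product_def Hom_iff)

lemma productI:
  assumes "P \<in> Obj C" "p \<in> Hom C P A" "q \<in> Hom C P B"
    and "\<And>f g. f \<in> Arr C \<Longrightarrow> g \<in> Arr C \<Longrightarrow> Cod C f = A \<Longrightarrow> Cod C g = B \<Longrightarrow> Dom C f = Dom C g \<Longrightarrow>
       \<exists>h\<in>Arr C. Dom C h = Dom C f \<and> Cod C h = P \<and> p \<cdot> h = f \<and> q \<cdot> h = g"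
    and "\<And>h h'. h \<in> Arr C \<Longrightarrow> h' \<in> Arr C \<Longrightarrow> Cod C h = P \<Longrightarrow> Cod C h' = P \<Longrightarrow>
      Dom C h = Dom C h' \<Longrightarrow> p \<cdot> h = p \<cdot> h' \<Longrightarrow> q \<cdot> h = q \<cdot> h' \<Longrightarrow> h = h'"
  shows "is_product C A B P p q"
  unfolding is_product_def
proof (intro conjI ballI)
  fix Z f g assume "Z \<in> Obj C" and fg: "f \<in> Hom C Z A" "g \<in> Hom C Z B"
  obtain h where "h \<in> Arr C" "Dom C h = Dom C f" "Cod C h = P" "p \<cdot> h = f" "q \<cdot> h = g"
    using assms(4)[of f g] fg by (auto simp: Hom_iff)
  then show "\<exists>!h. h \<in> Hom C Z P \<and> p \<cdot> h = f \<and> q \<cdot> h = g"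
    using fg assms(5) by (intro ex1I[of _ h]) (auto simp: Hom_iff)
qed (use assms in auto)

text \<open>Serves to recognize the image under \<Pi> of an arbitrary product of the homotopy
  category, which is only homotopy equivalent to the chosen product of the base.\<close>

lemma product_transport:
  assumes P: "is_product C A B P a b" and t: "t \<in> Hom C Q P" and s: "s \<in> Hom C P Q"
    and st: "s \<cdot> t = Ide C Q" and ts: "t \<cdot> s = Ide C P"
  shows "is_product C A B Q (a \<cdot> t) (b \<cdot> t)"
proof -
  note [simp] = product_simps[OF P]
  have [simp]: "t \<in> Arr C" "s \<in> Arr C" "Dom C t = Q" "Dom C s = P" "Cod C t = P" "Cod C s = Q"
    using t s by (auto simp: Hom_iff)
  have ts': "t \<cdot> (s \<cdot> h) = h" if "h \<in> Arr C" "Cod C h = P" for h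
    using Comp_eq_extend[OF ts, of h] that by simp
  have st': "s \<cdot> (t \<cdot> h) = h" if "h \<in> Arr C" "Cod C h = Q" for h
    using Comp_eq_extend[OF st, of h] that by simp
  show ?thesis
  proof (rule productI)
    show "Q \<in> Obj C" using Arr_closed(1)[of t] by simp
    fix f g assume fg: "f \<in> Arr C" "g \<in> Arr C" "Cod C f = A" "Cod C g = B" "Dom C f = Dom C g"
    obtain h where "h \<in> Arr C" "Dom C h = Dom C f" "Cod C h = P" "a \<cdot> h = f" "b \<cdot> h = g"
      using product_exists[OF P fg] .
    then show "\<exists>h\<in>Arr C. Dom C h = Dom C f \<and> Cod C h = Q \<and> (a \<cdot> t) \<cdot> h = f \<and> (b \<cdot> t) \<cdot> h = g"
      using ts' by (intro bexI[of _ "s \<cdot> h"]) auto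
  next
    fix h h' assume h: "h \<in> Arr C" "h' \<in> Arr C" "Cod C h = Q" "Cod C h' = Q" "Dom C h = Dom C h'"
      "(a \<cdot> t) \<cdot> h = (a \<cdot> t) \<cdot> h'" "(b \<cdot> t) \<cdot> h = (b \<cdot> t) \<cdot> h'"
    have "t \<cdot> h = t \<cdot> h'" by (rule product_unique[OF P]) (use h in auto)
    then have "s \<cdot> (t \<cdot> h) = s \<cdot> (t \<cdot> h')" by simp
    then show "h = h'" using st' h by simp
  qed (auto simp: Hom_iff)
qed

lemma terminal_unique:
  assumes "is_terminal C T" "u \<in> Arr C" "v \<in> Arr C" "Dom C u = Dom C v" "Cod C u = T" "Cod C v = T"
  shows "u = v"
proof -
  have "\<exists>!h. h \<in> Hom C (Dom C u) T" using assms by (auto simp: is_terminal_def)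
  then show ?thesis using assms by (auto simp: Hom_iff)
qed

end

section \<open>Chosen finite products and their comparison with arbitrary product cones\<close>

locale finite_product_category = category +
  assumes finite_products: "has_finite_products C"
begin

lemma one_terminal: "is_terminal C (one C)"
  unfolding one_def using finite_products by (auto simp: has_finite_products_def intro: someI_ex)

lemma one_Obj [simp]: "one C \<in> Obj C"
  using one_terminal by (simp add: is_terminal_def)

definition bang where "bang X = (THE f. f \<in> Hom C X (one C))"

lemma bang_simps [simp]:
  assumes "X \<in> Obj C"
  shows "bang X \<in> Arr C" "Dom C (bang X) = X" "Cod C (bang X) = one C"
proof -
  have "\<exists>!f. f \<in> Hom C X (one C)" using one_terminal assms by (auto simp: is_terminal_def)
  from theI'[OF this] show "bang X \<in> Arr C" "Dom C (bang X) = X" "Cod C (bang X) = one C"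
    by (auto simp: bang_def Hom_iff)
qed

lemma one_unique:
  assumes "f \<in> Arr C" "g \<in> Arr C" "Cod C f = one C" "Cod C g = one C" "Dom C f = Dom C g"
  shows "f = g"
  using terminal_unique[OF one_terminal] assms by blast

lemma bang_eq: "f \<in> Arr C \<Longrightarrow> Cod C f = one C \<Longrightarrow> f = bang (Dom C f)"
  by (rule one_unique) auto

lemma bang_comp [simp]: "f \<in> Arr C \<Longrightarrow> Cod C f = X \<Longrightarrow> bang X \<cdot> f = bang (Dom C f)"
  by (rule one_unique) auto

lemma prod_is_product:
  assumes "A \<in> Obj C" "B \<in> Obj C"
  shows "is_product C A B (prod C A B) (pr1 C A B) (pr2 C A B)"
proof -
  have "\<exists>x. (case x of (P, p, q) \<Rightarrow> is_product C A B P p q)"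
    using finite_products assms by (auto simp: has_finite_products_def)
  from someI_ex[OF this] show ?thesis
    unfolding prod_def pr1_def pr2_def the_product_def by (auto split: prod.splits)
qed

lemma prod_simps [simp]:
  assumes "A \<in> Obj C" "B \<in> Obj C"
  shows "prod C A B \<in> Obj C"
    "pr1 C A B \<in> Arr C" "Dom C (pr1 C A B) = prod C A B" "Cod C (pr1 C A B) = A"
    "pr2 C A B \<in> Arr C" "Dom C (pr2 C A B) = prod C A B" "Cod C (pr2 C A B) = B"
  using product_simps[OF prod_is_product[OF assms]] by auto

lemma pairing_props:
  assumes "f \<in> Arr C" "g \<in> Arr C" "Dom C f = Dom C g"
  shows "pairing C f g \<in> Hom C (Dom C f) (prod C (Cod C f) (Cod C g)) \<and>
     pr1 C (Cod C f) (Cod C g) \<cdot> pairing C f g = f \<and> pr2 C (Cod C f) (Cod C g) \<cdot> pairing C f g = g"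
proof -
  have "\<exists>!h. h \<in> Hom C (Dom C f) (prod C (Cod C f) (Cod C g)) \<and>
     pr1 C (Cod C f) (Cod C g) \<cdot> h = f \<and> pr2 C (Cod C f) (Cod C g) \<cdot> h = g"
    using prod_is_product[of "Cod C f" "Cod C g"] assms unfolding is_product_def
    by (simp add: Hom_iff)
  from theI'[OF this] show ?thesis unfolding pairing_def .
qed

lemma pairing_simps [simp]:
  assumes "f \<in> Arr C" "g \<in> Arr C" "Dom C f = Dom C g"
  shows "pairing C f g \<in> Arr C" "Dom C (pairing C f g) = Dom C g"
    "Cod C (pairing C f g) = prod C (Cod C f) (Cod C g)"
    "Cod C f = A \<Longrightarrow> Cod C g = B \<Longrightarrow> pr1 C A B \<cdot> pairing C f g = f"
    "Cod C f = A \<Longrightarrow> Cod C g = B \<Longrightarrow> pr2 C A B \<cdot> pairing C f g = g"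
  using pairing_props[OF assms] assms by (auto simp: Hom_iff)

lemma prod_ext:
  assumes "h \<in> Arr C" "h' \<in> Arr C" "A \<in> Obj C" "B \<in> Obj C" "Cod C h = prod C A B" "Cod C h' = prod C A B"
    "Dom C h = Dom C h'" "pr1 C A B \<cdot> h = pr1 C A B \<cdot> h'" "pr2 C A B \<cdot> h = pr2 C A B \<cdot> h'"
  shows "h = h'"
  using product_unique[OF prod_is_product] assms by blast

text \<open>As a rewrite rule this pushes composition into pairings, so that arrows into products
  reach a normal form; a few later steps switch it off to keep a factor intact.\<close>

lemma pairing_comp [simp]:
  assumes "f \<in> Arr C" "g \<in> Arr C" "Dom C f = Dom C g" "h \<in> Arr C" "Cod C h = Dom C g"
  shows "pairing C f g \<cdot> h = pairing C (f \<cdot> h) (g \<cdot> h)"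
proof -
  have "pr1 C (Cod C f) (Cod C g) \<cdot> (pairing C f g \<cdot> h) = f \<cdot> h"
    "pr2 C (Cod C f) (Cod C g) \<cdot> (pairing C f g \<cdot> h) = g \<cdot> h"
    by (rule Comp_eq_extend; use assms in simp)+
  then show ?thesis
    by (intro prod_ext[of "pairing C f g \<cdot> h" "pairing C (f \<cdot> h) (g \<cdot> h)" "Cod C f" "Cod C g"])
      (use assms in auto)
qed

lemma pairing_pr [simp]:
  assumes "h \<in> Arr C" "A \<in> Obj C" "B \<in> Obj C" "Cod C h = prod C A B"
  shows "pairing C (pr1 C A B \<cdot> h) (pr2 C A B \<cdot> h) = h"
  by (rule prod_ext[of _ _ A B]) (use assms in auto)

lemma pairing_pr_Ide [simp]:
  assumes "A \<in> Obj C" "B \<in> Obj C"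
  shows "pairing C (pr1 C A B) (pr2 C A B) = Ide C (prod C A B)"
  by (rule prod_ext[of _ _ A B]) (use assms in auto)

lemma pairing_eq_iff:
  assumes "f \<in> Arr C" "g \<in> Arr C" "Dom C f = Dom C g" "f' \<in> Arr C" "g' \<in> Arr C" "Dom C f' = Dom C g'"
    "Cod C f = Cod C f'" "Cod C g = Cod C g'"
  shows "pairing C f g = pairing C f' g' \<longleftrightarrow> f = f' \<and> g = g'"
  using assms pairing_simps(4,5) by metis

lemma prod_map_eq:
  "prod_map C f g = pairing C (f \<cdot> pr1 C (Dom C f) (Dom C g)) (g \<cdot> pr2 C (Dom C f) (Dom C g))"
  by (simp add: prod_map_def)

text \<open>\<open>is_exponential\<close> speaks of the products picked by \<open>prod\<close>. In
  the homotopy category nothing is known about that pick, so the universal property is accepted here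
  relative to any product cones; \<open>m\<close> plays the part of \<open>k \<times> id\<close>
  between them.\<close>

lemma exponential_from_product:
  assumes P: "is_product C Z X P a b" and e: "e \<in> Hom C P Y" and X: "X \<in> Obj C" and Z: "Z \<in> Obj C"
    and U: "\<And>A. A \<in> Obj C \<Longrightarrow> \<exists>Q c d. is_product C A X Q c d \<and> (\<forall>h\<in>Hom C Q Y.
      \<exists>!k. k \<in> Hom C A Z \<and> (\<exists>m\<in>Hom C Q P. a \<cdot> m = k \<cdot> c \<and> b \<cdot> m = d \<and> e \<cdot> m = h))"
  shows "\<exists>e. is_exponential C X Y Z e"
proof -
  note [simp] = product_simps[OF P] X Z
  have [simp]: "e \<in> Arr C" "Dom C e = P" "Cod C e = Y" using e by (auto simp: Hom_iff)
  \<comment> \<open>Comparison of the chosen product with \<open>P\<close>; the new evaluation will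
    be \<open>e \<cdot> i\<close>.\<close>
  obtain i where i: "i \<in> Arr C" "Dom C i = prod C Z X" "Cod C i = P" "a \<cdot> i = pr1 C Z X" "b \<cdot> i = pr2 C Z X"
    using product_exists[OF P, of "pr1 C Z X" "pr2 C Z X"] by auto
  note [simp] = i(1-3)
  have i': "a \<cdot> (i \<cdot> z) = pr1 C Z X \<cdot> z" "b \<cdot> (i \<cdot> z) = pr2 C Z X \<cdot> z" if "z \<in> Arr C" "Cod C z = prod C Z X" for z
    using Comp_eq_extend[OF i(4), of z] Comp_eq_extend[OF i(5), of z] that by auto
  have "\<exists>!k. k \<in> Hom C A Z \<and> (e \<cdot> i) \<cdot> prod_map C k (Ide C X) = h"
    if A: "A \<in> Obj C" and h: "h \<in> Hom C (prod C A X) Y" for A h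
  proof -
    note [simp] = A
    have [simp]: "h \<in> Arr C" "Dom C h = prod C A X" "Cod C h = Y" using h by (auto simp: Hom_iff)
    obtain Q c d where Q: "is_product C A X Q c d" and UQ: "\<forall>h\<in>Hom C Q Y.
      \<exists>!k. k \<in> Hom C A Z \<and> (\<exists>m\<in>Hom C Q P. a \<cdot> m = k \<cdot> c \<and> b \<cdot> m = d \<and> e \<cdot> m = h)"
      using U[OF A] by (elim exE conjE)
    note [simp] = product_simps[OF Q]
    let ?j = "pairing C c d"
    \<comment> \<open>\<open>j\<close> is a section of \<open>?j : Q -> prod C A X\<close>, so that
      \<open>?j\<close> can be cancelled on the right.\<close>
    obtain j where j: "j \<in> Arr C" "Dom C j = prod C A X" "Cod C j = Q" "c \<cdot> j = pr1 C A X" "d \<cdot> j = pr2 C A X"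
      using product_exists[OF Q, of "pr1 C A X" "pr2 C A X"] by auto
    have jj: "?j \<cdot> j = Ide C (prod C A X)" using j by simp
    \<comment> \<open>The condition on \<open>k\<close> relative to \<open>Q\<close> and
      \<open>h \<cdot> ?j\<close> is the one relative to the chosen product and \<open>h\<close>;
      the arrow \<open>m\<close> is forced by its projections, hence equal to
      \<open>?m \<cdot> ?j\<close>.\<close>
    have "(\<exists>m\<in>Hom C Q P. a \<cdot> m = k \<cdot> c \<and> b \<cdot> m = d \<and> e \<cdot> m = h \<cdot> ?j)
      \<longleftrightarrow> (e \<cdot> i) \<cdot> prod_map C k (Ide C X) = h" if k: "k \<in> Hom C A Z" for k
    proof -
      have [simp]: "k \<in> Arr C" "Dom C k = A" "Cod C k = Z" using k by (auto simp: Hom_iff)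
      let ?m = "i \<cdot> pairing C (k \<cdot> pr1 C A X) (pr2 C A X)"
      have m: "?m \<cdot> ?j \<in> Hom C Q P \<and> a \<cdot> (?m \<cdot> ?j) = k \<cdot> c \<and> b \<cdot> (?m \<cdot> ?j) = d"
        by (simp add: Hom_iff i')
      have "(\<exists>m\<in>Hom C Q P. a \<cdot> m = k \<cdot> c \<and> b \<cdot> m = d \<and> e \<cdot> m = h \<cdot> ?j) \<longleftrightarrow> e \<cdot> (?m \<cdot> ?j) = h \<cdot> ?j"
      proof
        assume "\<exists>m\<in>Hom C Q P. a \<cdot> m = k \<cdot> c \<and> b \<cdot> m = d \<and> e \<cdot> m = h \<cdot> ?j"
        then obtain m' where m': "m' \<in> Hom C Q P" "a \<cdot> m' = k \<cdot> c" "b \<cdot> m' = d" "e \<cdot> m' = h \<cdot> ?j" by blast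
        have "m' = ?m \<cdot> ?j"
          by (rule product_unique[OF P]) (use m m' in \<open>simp_all add: Hom_iff\<close>)
        then show "e \<cdot> (?m \<cdot> ?j) = h \<cdot> ?j" using m'(4) by simp
      qed (use m in blast)
      also have "\<dots> \<longleftrightarrow> e \<cdot> ?m = h"
      proof
        assume "e \<cdot> (?m \<cdot> ?j) = h \<cdot> ?j"
        then have "(e \<cdot> (?m \<cdot> ?j)) \<cdot> j = (h \<cdot> ?j) \<cdot> j" by simp
        then have "(e \<cdot> ?m) \<cdot> (?j \<cdot> j) = h \<cdot> (?j \<cdot> j)" using j(1-3) by (simp del: pairing_comp)
        then show "e \<cdot> ?m = h" unfolding jj by simp
      next
        assume *: "e \<cdot> ?m = h"
        have "(e \<cdot> ?m) \<cdot> ?j = e \<cdot> (?m \<cdot> ?j)" by simp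
        then show "e \<cdot> (?m \<cdot> ?j) = h \<cdot> ?j" unfolding * by simp
      qed
      finally show ?thesis by (simp add: prod_map_eq)
    qed
    moreover have "h \<cdot> ?j \<in> Hom C Q Y" by (simp add: Hom_iff)
    from UQ[rule_format, OF this] have "\<exists>!k. k \<in> Hom C A Z \<and> (\<exists>m\<in>Hom C Q P. a \<cdot> m = k \<cdot> c \<and> b \<cdot> m = d \<and> e \<cdot> m = h \<cdot> ?j)" .
    ultimately show ?thesis by (simp cong: conj_cong)
  qed
  then have "is_exponential C X Y Z (e \<cdot> i)" by (auto simp: is_exponential_def Hom_iff)
  then show ?thesis by blast
qed

text \<open>Each universal property yields one comparison arrow, and the uniqueness clauses make
  both round trips identities. This later relates the exponential chosen in the homotopy category to
  that of the base.\<close>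

lemma exponential_unique:
  assumes Z: "is_exponential C X Y Z e" and W: "is_exponential C X Y W e'" and [simp]: "X \<in> Obj C"
  shows "isomorphic C Z W"
proof -
  have [simp]: "Z \<in> Obj C" "e \<in> Arr C" "Dom C e = prod C Z X" "Cod C e = Y"
    "W \<in> Obj C" "e' \<in> Arr C" "Dom C e' = prod C W X" "Cod C e' = Y"
    using Z W by (auto simp: is_exponential_def Hom_iff)
  have ZU: "\<And>A h. A \<in> Obj C \<Longrightarrow> h \<in> Hom C (prod C A X) Y \<Longrightarrow>
      \<exists>!k. k \<in> Hom C A Z \<and> e \<cdot> prod_map C k (Ide C X) = h"
    and WU: "\<And>A h. A \<in> Obj C \<Longrightarrow> h \<in> Hom C (prod C A X) Y \<Longrightarrow>
      \<exists>!k. k \<in> Hom C A W \<and> e' \<cdot> prod_map C k (Ide C X) = h"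
    using Z W unfolding is_exponential_def by blast+
  have e: "e \<in> Hom C (prod C Z X) Y" "e' \<in> Hom C (prod C W X) Y" by (simp_all add: Hom_iff)
  obtain k where k: "k \<in> Hom C Z W" "e' \<cdot> prod_map C k (Ide C X) = e" using WU[of Z e] e by auto
  obtain l where l: "l \<in> Hom C W Z" "e \<cdot> prod_map C l (Ide C X) = e'" using ZU[of W e'] e by auto
  have [simp]: "k \<in> Arr C" "Dom C k = Z" "Cod C k = W" "l \<in> Arr C" "Dom C l = W" "Cod C l = Z"
    using k(1) l(1) by (auto simp: Hom_iff)
  have comp: "prod_map C g (Ide C X) \<cdot> prod_map C f (Ide C X) = prod_map C (g \<cdot> f) (Ide C X)"
    if "f \<in> Arr C" "g \<in> Arr C" "Dom C g = Cod C f" for f g using that by (simp add: prod_map_eq)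
  have pm [simp]: "prod_map C f (Ide C X) \<in> Arr C" "Dom C (prod_map C f (Ide C X)) = prod C (Dom C f) X"
    "Cod C (prod_map C f (Ide C X)) = prod C (Cod C f) X" if "f \<in> Arr C" for f
    using that by (simp_all add: prod_map_eq)
  have Ide: "e \<cdot> prod_map C (Ide C Z) (Ide C X) = e" "e' \<cdot> prod_map C (Ide C W) (Ide C X) = e'"
    by (simp_all add: prod_map_eq)
  have "e \<cdot> (prod_map C l (Ide C X) \<cdot> prod_map C k (Ide C X)) = e"
    using Comp_eq_extend[OF l(2), of "prod_map C k (Ide C X)"] k(2) by simp
  then have "e \<cdot> prod_map C (l \<cdot> k) (Ide C X) = e" by (simp add: comp)
  moreover have "l \<cdot> k \<in> Hom C Z Z" "Ide C Z \<in> Hom C Z Z" by (simp_all add: Hom_iff)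
  ultimately have lk: "l \<cdot> k = Ide C Z" using ZU[OF \<open>Z \<in> Obj C\<close> e(1)] Ide(1) by blast
  have "e' \<cdot> (prod_map C k (Ide C X) \<cdot> prod_map C l (Ide C X)) = e'"
    using Comp_eq_extend[OF k(2), of "prod_map C l (Ide C X)"] l(2) by simp
  then have "e' \<cdot> prod_map C (k \<cdot> l) (Ide C X) = e'" by (simp add: comp)
  moreover have "k \<cdot> l \<in> Hom C W W" "Ide C W \<in> Hom C W W" by (simp_all add: Hom_iff)
  ultimately have "k \<cdot> l = Ide C W" using WU[OF \<open>W \<in> Obj C\<close> e(2)] Ide(2) by blast
  then show ?thesis using isomorphicI k(1) l(1) lk by blast
qed

end

section \<open>Exponentials as a calculus of generalized elements\<close>

locale cartesian_closed_category = finite_product_category +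
  assumes exponentials: "X \<in> Obj C \<Longrightarrow> Y \<in> Obj C \<Longrightarrow> \<exists>Z e. is_exponential C X Y Z e"
begin

lemma expo_is_exponential:
  assumes "X \<in> Obj C" "Y \<in> Obj C"
  shows "is_exponential C X Y (expo C X Y) (eval C X Y)"
proof -
  have "\<exists>x. (case x of (Z, e) \<Rightarrow> is_exponential C X Y Z e)"
    using exponentials[OF assms] by auto
  from someI_ex[OF this] show ?thesis
    unfolding expo_def eval_def the_exponential_def by (auto split: prod.splits)
qed

lemma expo_simps [simp]:
  assumes "X \<in> Obj C" "Y \<in> Obj C"
  shows "expo C X Y \<in> Obj C" "eval C X Y \<in> Arr C"
    "Dom C (eval C X Y) = prod C (expo C X Y) X" "Cod C (eval C X Y) = Y"
  using expo_is_exponential[OF assms] by (auto simp: is_exponential_def Hom_iff)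

lemma transpose_props:
  assumes "A \<in> Obj C" "X \<in> Obj C" "h \<in> Arr C" "Dom C h = prod C A X" "Cod C h = Y"
  shows "transpose C A X Y h \<in> Hom C A (expo C X Y) \<and>
    eval C X Y \<cdot> prod_map C (transpose C A X Y h) (Ide C X) = h"
proof -
  have "Y \<in> Obj C" using assms(3,5) by auto
  then have "\<exists>!k. k \<in> Hom C A (expo C X Y) \<and> eval C X Y \<cdot> prod_map C k (Ide C X) = h"
    using expo_is_exponential[of X Y] assms unfolding is_exponential_def by (simp add: Hom_iff)
  from theI'[OF this] show ?thesis unfolding transpose_def .
qed

lemma transpose_simps [simp]:
  assumes "h \<in> Arr C" "A \<in> Obj C" "X \<in> Obj C" "Dom C h = prod C A X" "Cod C h = Y"
  shows "transpose C A X Y h \<in> Arr C" "Dom C (transpose C A X Y h) = A"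
    "Cod C (transpose C A X Y h) = expo C X Y"
  using transpose_props assms by (auto simp: Hom_iff)

text \<open>The beta rule at generalized elements \<open>a\<close> and \<open>x\<close>; together
  with \<open>pairing_comp\<close> it lets simplification compute with exponentials as in a lambda
  calculus.\<close>

lemma eval_transpose [simp]:
  assumes "h \<in> Arr C" "A \<in> Obj C" "X \<in> Obj C" "Dom C h = prod C A X" "Cod C h = Y"
    "a \<in> Arr C" "x \<in> Arr C" "Cod C a = A" "Cod C x = X" "Dom C a = Dom C x"
  shows "eval C X Y \<cdot> pairing C (transpose C A X Y h \<cdot> a) x = h \<cdot> pairing C a x"
proof -
  have Y: "Y \<in> Obj C" using assms(1,5) by auto
  have "eval C X Y \<cdot> prod_map C (transpose C A X Y h) (Ide C X) = h"
    using transpose_props assms by blast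
  then have "eval C X Y \<cdot> prod_map C (transpose C A X Y h) (Ide C X) \<cdot> pairing C a x = h \<cdot> pairing C a x"
    by simp
  moreover have "prod_map C (transpose C A X Y h) (Ide C X) \<cdot> pairing C a x
      = pairing C (transpose C A X Y h \<cdot> a) x"
    using assms Y by (simp add: prod_map_eq)
  ultimately show ?thesis using assms Y by (simp add: prod_map_eq)
qed

text \<open>The case \<open>a = Ide C A\<close> is kept apart because simplification erases that
  identity, after which the general rule no longer matches.\<close>

lemma eval_transpose_Ide [simp]:
  assumes "h \<in> Arr C" "A \<in> Obj C" "X \<in> Obj C" "Dom C h = prod C A X" "Cod C h = Y"
    "x \<in> Arr C" "Cod C x = X" "A = Dom C x"
  shows "eval C X Y \<cdot> pairing C (transpose C A X Y h) x = h \<cdot> pairing C (Ide C A) x"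
  using eval_transpose[of h A X Y "Ide C A" x] assms by simp

text \<open>The eta principle: uniqueness of transposes, with both uncurried arrows written as
  pairings so that the beta rules apply to them.\<close>

lemma expo_ext:
  assumes "k \<in> Arr C" "k' \<in> Arr C" "Dom C k = A" "Dom C k' = A" "X \<in> Obj C" "Y \<in> Obj C"
    "Cod C k = expo C X Y" "Cod C k' = expo C X Y"
    "eval C X Y \<cdot> pairing C (k \<cdot> pr1 C A X) (pr2 C A X) = eval C X Y \<cdot> pairing C (k' \<cdot> pr1 C A X) (pr2 C A X)"
  shows "k = k'"
proof -
  have A: "A \<in> Obj C" using assms by auto
  let ?h = "eval C X Y \<cdot> prod_map C k (Ide C X)"
  have "\<exists>!k. k \<in> Hom C A (expo C X Y) \<and> eval C X Y \<cdot> prod_map C k (Ide C X) = ?h"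
    using expo_is_exponential[of X Y] assms A unfolding is_exponential_def
    by (simp add: Hom_iff prod_map_eq)
  moreover have "eval C X Y \<cdot> prod_map C k' (Ide C X) = ?h"
    using assms A by (simp add: prod_map_eq)
  ultimately show ?thesis using assms by (auto simp: Hom_iff)
qed

text \<open>Two arrows \<open>u, v : V -> Z\<close> out of an object \<open>V\<close> that maps to
  \<open>I\<close> are transposed into arrows \<open>I -> Z^V\<close>. These agree because
  \<open>I\<close> is initial, and evaluating them at \<open>(f, id)\<close> recovers
  \<open>u\<close> and \<open>v\<close>.\<close>

lemma strict_initial:
  assumes "is_initial C I" "f \<in> Arr C" "Cod C f = I"
  shows "is_initial C (Dom C f)"
proof -
  let ?V = "Dom C f"
  have [simp]: "I \<in> Obj C" using assms by auto
  have "\<exists>!k. k \<in> Hom C ?V Z" if [simp]: "Z \<in> Obj C" for Z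
  proof -
    obtain i where "i \<in> Arr C" "Dom C i = I" "Cod C i = Z"
      using initial_arrow[OF assms(1), of Z] by auto
    then have "i \<cdot> f \<in> Hom C ?V Z" using assms by (simp add: Hom_iff)
    moreover have "u = v" if "u \<in> Hom C ?V Z" "v \<in> Hom C ?V Z" for u v
    proof -
      have uv: "u \<in> Arr C" "v \<in> Arr C" "Dom C u = ?V" "Dom C v = ?V" "Cod C u = Z" "Cod C v = Z"
        using that by (auto simp: Hom_iff)
      let ?t = "\<lambda>u. transpose C I ?V Z (u \<cdot> pr2 C I ?V)"
      have "?t u = ?t v" by (rule initial_unique[OF assms(1)]) (use uv assms(2) in auto)
      then have "eval C ?V Z \<cdot> pairing C (?t u \<cdot> f) (Ide C ?V) = eval C ?V Z \<cdot> pairing C (?t v \<cdot> f) (Ide C ?V)"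
        by simp
      then show "u = v" using uv assms by (simp del: eval_transpose_Ide)
    qed
    ultimately show ?thesis by blast
  qed
  then show ?thesis using assms(2) by (auto simp: is_initial_def)
qed

end

section \<open>Toposes and decidable objects\<close>

locale elementary_topos = cartesian_closed_category +
  assumes equalizers: "X \<in> Obj C \<Longrightarrow> Y \<in> Obj C \<Longrightarrow> f \<in> Hom C X Y \<Longrightarrow> g \<in> Hom C X Y \<Longrightarrow>
      \<exists>K k. is_equalizer C f g K k"
    and classifier: "\<exists>Om t. is_subobject_classifier C Om t"
begin

section \<open>Subobjects defined by conditions on generalized elements\<close>

text \<open>Comprehension \<open>{x. f x = g x}\<close>: equalizers enter the later arguments only
  through this membership rule.\<close>

lemma equalizer_subobject:
  assumes "f \<in> Arr C" "g \<in> Arr C" "Dom C f = Dom C g" "Cod C f = Cod C g"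
  obtains k where "is_mono C k" "Cod C k = Dom C f"
    and "\<And>a. a \<in> Arr C \<Longrightarrow> Cod C a = Dom C f \<Longrightarrow> factors_through C a k \<longleftrightarrow> f \<cdot> a = g \<cdot> a"
proof -
  obtain K k where E: "is_equalizer C f g K k"
    using equalizers[of "Dom C f" "Cod C f" f g] assms by (auto simp: Hom_iff)
  then have k: "k \<in> Arr C" "Dom C k = K" "Cod C k = Dom C f" "f \<cdot> k = g \<cdot> k"
    and U: "\<And>u. u \<in> Arr C \<Longrightarrow> Cod C u = Dom C f \<Longrightarrow> f \<cdot> u = g \<cdot> u \<Longrightarrow>
      \<exists>!h. h \<in> Hom C (Dom C u) K \<and> k \<cdot> h = u"
    by (auto simp: is_equalizer_def Hom_iff)
  have ka: "f \<cdot> (k \<cdot> a) = g \<cdot> (k \<cdot> a)" if "a \<in> Arr C" "Cod C a = K" for a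
    using Comp_eq_extend[OF k(4), of a] that k assms by simp
  have "is_mono C k"
  proof (rule monoI)
    fix u v assume uv: "u \<in> Arr C" "v \<in> Arr C" "Cod C u = Dom C k" "Cod C v = Dom C k"
      "Dom C u = Dom C v" "k \<cdot> u = k \<cdot> v"
    have "\<exists>!h. h \<in> Hom C (Dom C (k \<cdot> u)) K \<and> k \<cdot> h = k \<cdot> u"
      by (rule U) (use uv k ka in auto)
    then show "u = v" using uv k by (auto simp: Hom_iff)
  qed fact
  moreover have "factors_through C a k \<longleftrightarrow> f \<cdot> a = g \<cdot> a" if a: "a \<in> Arr C" "Cod C a = Dom C f" for a
    using U[OF a] ka k a unfolding factors_through_iff by (auto simp: Hom_iff)
  ultimately show ?thesis using that k by blast
qed

text \<open>The pullback of \<open>m\<close> along \<open>f\<close> is carved out of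
  \<open>A \<times> M\<close> as the equalizer of \<open>f \<cdot> pr1\<close> and
  \<open>m \<cdot> pr2\<close>; its first projection is monic because \<open>m\<close> is.\<close>

lemma preimage_subobject:
  assumes "f \<in> Arr C" "is_mono C m" "Cod C m = Cod C f"
  obtains k where "is_mono C k" "Cod C k = Dom C f"
    and "\<And>a. a \<in> Arr C \<Longrightarrow> Cod C a = Dom C f \<Longrightarrow> factors_through C a k \<longleftrightarrow> factors_through C (f \<cdot> a) m"
proof -
  let ?A = "Dom C f" and ?M = "Dom C m"
  have [simp]: "m \<in> Arr C" using assms by (simp add: mono_Arr)
  note [simp] = assms(1,3)
  obtain e where e: "is_mono C e" "Cod C e = prod C ?A ?M" and e': "\<And>a. a \<in> Arr C \<Longrightarrow>
      Cod C a = prod C ?A ?M \<Longrightarrow> factors_through C a e \<longleftrightarrow> (f \<cdot> pr1 C ?A ?M) \<cdot> a = (m \<cdot> pr2 C ?A ?M) \<cdot> a"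
    using equalizer_subobject[of "f \<cdot> pr1 C ?A ?M" "m \<cdot> pr2 C ?A ?M"] by auto
  note [simp] = mono_Arr[OF e(1)] e(2)
  have fe: "f \<cdot> (pr1 C ?A ?M \<cdot> e) = m \<cdot> (pr2 C ?A ?M \<cdot> e)"
    using e'[of e] factors_through_refl[of e] by simp
  let ?k = "pr1 C ?A ?M \<cdot> e"
  have "is_mono C ?k"
  proof (rule monoI)
    fix u v assume uv: "u \<in> Arr C" "v \<in> Arr C" "Cod C u = Dom C ?k" "Cod C v = Dom C ?k"
      "Dom C u = Dom C v" "?k \<cdot> u = ?k \<cdot> v"
    have "f \<cdot> (?k \<cdot> u) = m \<cdot> (pr2 C ?A ?M \<cdot> (e \<cdot> u))" "f \<cdot> (?k \<cdot> v) = m \<cdot> (pr2 C ?A ?M \<cdot> (e \<cdot> v))"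
      using Comp_eq_extend[OF fe, of u] Comp_eq_extend[OF fe, of v] uv by auto
    then have "m \<cdot> (pr2 C ?A ?M \<cdot> (e \<cdot> u)) = m \<cdot> (pr2 C ?A ?M \<cdot> (e \<cdot> v))" using uv(6) by simp
    from mono_cancel[OF assms(2) this] have "pr2 C ?A ?M \<cdot> (e \<cdot> u) = pr2 C ?A ?M \<cdot> (e \<cdot> v)"
      using uv by simp
    then have "e \<cdot> u = e \<cdot> v" using uv by (intro prod_ext[of "e \<cdot> u" "e \<cdot> v" ?A ?M]) auto
    from mono_cancel[OF e(1) this] show "u = v" using uv by simp
  qed simp
  moreover have "factors_through C a ?k \<longleftrightarrow> factors_through C (f \<cdot> a) m"
    if [simp]: "a \<in> Arr C" "Cod C a = ?A" for a
  proof
    assume "factors_through C a ?k"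
    then obtain h where h: "h \<in> Arr C" "Dom C h = Dom C a" "Cod C h = Dom C ?k" "?k \<cdot> h = a"
      by (rule factors_throughE)
    have "f \<cdot> (?k \<cdot> h) = m \<cdot> (pr2 C ?A ?M \<cdot> (e \<cdot> h))" using Comp_eq_extend[OF fe, of h] h(1,3) by simp
    then have "f \<cdot> a = m \<cdot> (pr2 C ?A ?M \<cdot> (e \<cdot> h))" unfolding h(4) .
    then show "factors_through C (f \<cdot> a) m"
      using h by (intro factors_throughI[of "pr2 C ?A ?M \<cdot> (e \<cdot> h)"]) auto
  next
    assume "factors_through C (f \<cdot> a) m"
    then obtain h where h: "h \<in> Arr C" "Dom C h = Dom C (f \<cdot> a)" "Cod C h = ?M" "m \<cdot> h = f \<cdot> a"
      by (rule factors_throughE)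
    then have "factors_through C (pairing C a h) e" by (subst e') auto
    then obtain k where k: "k \<in> Arr C" "Dom C k = Dom C (pairing C a h)" "Cod C k = Dom C e"
      "e \<cdot> k = pairing C a h"
      by (rule factors_throughE)
    then show "factors_through C a ?k" using h by (intro factors_throughI[of k]) auto
  qed
  ultimately show ?thesis using that[of ?k] by simp
qed

section \<open>The subobject classifier and universal quantification along an arrow\<close>

definition Om_true where
  "Om_true = (SOME (U, t). is_subobject_classifier C U t)"
definition Om where "Om = fst Om_true"
definition tru where "tru = snd Om_true"

lemma Om_classifier: "is_subobject_classifier C Om tru"
proof -
  have "\<exists>x. (case x of (U, t) \<Rightarrow> is_subobject_classifier C U t)"
    using classifier by simp
  from someI_ex[OF this] show ?thesis
    unfolding Om_def tru_def Om_true_def by (auto split: prod.splits)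
qed

lemma tru_simps [simp]:
  "Om \<in> Obj C" "tru \<in> Arr C" "Dom C tru = one C" "Cod C tru = Om"
  using Om_classifier by (auto simp: is_subobject_classifier_def Hom_iff)

text \<open>Replaces the pullback square of \<open>is_subobject_classifier\<close> by a condition on
  generalized elements, the form in which characteristic arrows are compared below.\<close>

definition classifies where
  "classifies chi m \<longleftrightarrow> (\<forall>a\<in>Arr C. Cod C a = Cod C m \<longrightarrow>
     (chi \<cdot> a = tru \<cdot> bang (Dom C a) \<longleftrightarrow> factors_through C a m))"

text \<open>One leg of the square ends in the terminal object and so carries no information; what
  remains of the square is a membership test.\<close>

lemma pullback_tru_iff:
  assumes "is_mono C m" "chi \<in> Arr C" "Dom C chi = Cod C m" "Cod C chi = Om"
  shows "(\<exists>b. is_pullback C chi tru (Dom C m) m b) \<longleftrightarrow> classifies chi m"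
proof
  note [simp] = mono_Arr[OF assms(1)] assms(2-4)
  assume "\<exists>b. is_pullback C chi tru (Dom C m) m b"
  then obtain b where b: "is_pullback C chi tru (Dom C m) m b" by blast
  then have b': "b \<in> Arr C" "Dom C b = Dom C m" "Cod C b = one C" "chi \<cdot> m = tru \<cdot> b"
    by (auto simp: is_pullback_def Hom_iff)
  show "classifies chi m" unfolding classifies_def
  proof (intro ballI impI iffI)
    fix a assume a: "a \<in> Arr C" "Cod C a = Cod C m"
    { assume "chi \<cdot> a = tru \<cdot> bang (Dom C a)"
      then have "\<exists>!h. h \<in> Hom C (Dom C a) (Dom C m) \<and> m \<cdot> h = a \<and> b \<cdot> h = bang (Dom C a)"
        using b a unfolding is_pullback_def by (simp add: Hom_iff)
      then show "factors_through C a m" unfolding factors_through_iff by (auto simp: Hom_iff) }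
    assume "factors_through C a m"
    then obtain k where k: "k \<in> Arr C" "Dom C k = Dom C a" "Cod C k = Dom C m" "m \<cdot> k = a"
      by (rule factors_throughE)
    then have "chi \<cdot> a = tru \<cdot> (b \<cdot> k)" using Comp_eq_extend[OF b'(4), of k] b' by simp
    also have "b \<cdot> k = bang (Dom C a)" using k b' by (intro one_unique[of "b \<cdot> k"]) auto
    finally show "chi \<cdot> a = tru \<cdot> bang (Dom C a)" .
  qed
next
  note [simp] = mono_Arr[OF assms(1)] assms(2-4)
  assume c: "classifies chi m"
  have "is_pullback C chi tru (Dom C m) m (bang (Dom C m))"
    unfolding is_pullback_def
  proof (intro conjI ballI impI)
    show "chi \<cdot> m = tru \<cdot> bang (Dom C m)"
      using c factors_through_refl[of m] unfolding classifies_def by simp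
    fix Z a b assume "Z \<in> Obj C" and a: "a \<in> Hom C Z (Dom C chi)" and b: "b \<in> Hom C Z (Dom C tru)"
      and e: "chi \<cdot> a = tru \<cdot> b"
    from b have "b = bang Z" using bang_eq by (auto simp: Hom_iff)
    with c a e have "factors_through C a m" by (auto simp: Hom_iff classifies_def)
    then obtain k where k: "k \<in> Arr C" "Dom C k = Dom C a" "Cod C k = Dom C m" "m \<cdot> k = a"
      by (rule factors_throughE)
    show "\<exists>!h. h \<in> Hom C Z (Dom C m) \<and> m \<cdot> h = a \<and> bang (Dom C m) \<cdot> h = b"
    proof (rule ex1I[of _ k])
      show "k \<in> Hom C Z (Dom C m) \<and> m \<cdot> k = a \<and> bang (Dom C m) \<cdot> k = b"
        using k a \<open>b = bang Z\<close> by (simp add: Hom_iff)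
      fix h assume h: "h \<in> Hom C Z (Dom C m) \<and> m \<cdot> h = a \<and> bang (Dom C m) \<cdot> h = b"
      then have "m \<cdot> h = m \<cdot> k" using k by simp
      from mono_cancel[OF assms(1) this] show "h = k" using h k a by (simp add: Hom_iff)
    qed
  qed (simp_all add: Hom_iff)
  then show "\<exists>b. is_pullback C chi tru (Dom C m) m b" by blast
qed

lemma classifies_ex1:
  assumes "is_mono C m"
  shows "\<exists>!chi. chi \<in> Hom C (Cod C m) Om \<and> classifies chi m"
proof -
  have "\<exists>!chi. chi \<in> Hom C (Cod C m) Om \<and> (\<exists>b. is_pullback C chi tru (Dom C m) m b)"
    using Om_classifier assms unfolding is_subobject_classifier_def by blast
  then show ?thesis using pullback_tru_iff[OF assms] by (auto simp: Hom_iff)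
qed

text \<open>Both arrows classify the subobject on which \<open>v\<close> is true, that is, the
  equalizer of \<open>v\<close> with the constant \<open>tru\<close>; characteristic arrows are
  unique.\<close>

lemma Om_ext:
  assumes "u \<in> Arr C" "v \<in> Arr C" "Dom C u = Dom C v" "Cod C u = Om" "Cod C v = Om"
    and "\<And>a. a \<in> Arr C \<Longrightarrow> Cod C a = Dom C v \<Longrightarrow>
      u \<cdot> a = tru \<cdot> bang (Dom C a) \<longleftrightarrow> v \<cdot> a = tru \<cdot> bang (Dom C a)"
  shows "u = v"
proof -
  obtain m where m: "is_mono C m" "Cod C m = Dom C v" and
    f: "\<And>a. a \<in> Arr C \<Longrightarrow> Cod C a = Dom C v \<Longrightarrow>
        factors_through C a m \<longleftrightarrow> v \<cdot> a = (tru \<cdot> bang (Dom C v)) \<cdot> a"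
    using equalizer_subobject[of v "tru \<cdot> bang (Dom C v)"] assms(1-5) by auto
  have "classifies v m" "classifies u m"
    using assms m f by (auto simp: classifies_def)
  then show ?thesis using classifies_ex1[OF m(1)] assms(1-5) m by (auto simp: Hom_iff)
qed

text \<open>This is \<open>{b. \<forall>a. f a = b \<longrightarrow> a \<in> s}\<close>, with
  \<open>w\<close> and \<open>a\<close> ranging over elements of the fibre at later stages. Over
  \<open>b\<close> the fibre of \<open>f\<close> and its part inside \<open>s\<close> are classified
  by \<open>c\<close> and \<open>d\<close>; the two coincide exactly when the fibre lies in
  \<open>s\<close>, so the subobject is the equalizer of the transposes
  \<open>B -> Om^A\<close>.\<close>

lemma forall_subobject:
  assumes "f \<in> Arr C" "is_mono C s" "Cod C s = Dom C f"
  obtains k where "is_mono C k" "Cod C k = Cod C f"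
    and "\<And>b. b \<in> Arr C \<Longrightarrow> Cod C b = Cod C f \<Longrightarrow> factors_through C b k \<longleftrightarrow>
      (\<forall>w\<in>Arr C. \<forall>a\<in>Arr C. Cod C w = Dom C b \<and> Cod C a = Dom C f \<and> Dom C w = Dom C a \<and>
         b \<cdot> w = f \<cdot> a \<longrightarrow> factors_through C a s)"
proof -
  let ?A = "Dom C f" and ?B = "Cod C f"
  note [simp] = assms(1,3) mono_Arr[OF assms(2)]
  \<comment> \<open>The graph of \<open>f\<close> as a subobject of \<open>B \<times> A\<close>,
    codomain coordinate first; \<open>?g \<cdot> s\<close> is its restriction to
    \<open>s\<close>.\<close>
  let ?g = "pairing C f (Ide C ?A)"
  have g: "is_mono C ?g"
    by (rule split_mono[of _ "pr2 C ?B ?A"]) auto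
  have gs: "is_mono C (?g \<cdot> s)" by (rule mono_comp) (use g assms(2) in auto)
  obtain c where c: "c \<in> Arr C" "Dom C c = prod C ?B ?A" "Cod C c = Om" "classifies c ?g"
    using classifies_ex1[OF g] by (auto simp: Hom_iff)
  obtain d where d: "d \<in> Arr C" "Dom C d = prod C ?B ?A" "Cod C d = Om" "classifies d (?g \<cdot> s)"
    using classifies_ex1[OF gs] by (auto simp: Hom_iff)
  note [simp] = c(1-3) d(1-3)
  have gmem: "factors_through C (pairing C u a) ?g \<longleftrightarrow> u = f \<cdot> a"
    if "u \<in> Arr C" "a \<in> Arr C" "Dom C u = Dom C a" "Cod C u = ?B" "Cod C a = ?A" for u a
  proof
    assume "factors_through C (pairing C u a) ?g"
    then obtain k where k: "k \<in> Arr C" "Dom C k = Dom C (pairing C u a)" "Cod C k = Dom C ?g"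
      "?g \<cdot> k = pairing C u a"
      by (rule factors_throughE)
    from k(4) have "pairing C (f \<cdot> k) k = pairing C u a" using k(1-3) by simp
    then show "u = f \<cdot> a" using that k(1-3) by (subst (asm) pairing_eq_iff) auto
  next
    assume "u = f \<cdot> a"
    then show "factors_through C (pairing C u a) ?g"
      using that by (intro factors_throughI[of a]) auto
  qed
  have gsmem: "factors_through C (pairing C u a) (?g \<cdot> s) \<longleftrightarrow> u = f \<cdot> a \<and> factors_through C a s"
    if "u \<in> Arr C" "a \<in> Arr C" "Dom C u = Dom C a" "Cod C u = ?B" "Cod C a = ?A" for u a
  proof
    assume "factors_through C (pairing C u a) (?g \<cdot> s)"
    then obtain k where k: "k \<in> Arr C" "Dom C k = Dom C (pairing C u a)" "Cod C k = Dom C (?g \<cdot> s)"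
      "(?g \<cdot> s) \<cdot> k = pairing C u a"
      by (rule factors_throughE)
    from k(4) have "pairing C (f \<cdot> (s \<cdot> k)) (s \<cdot> k) = pairing C u a" using k(1-3) by simp
    then have "f \<cdot> (s \<cdot> k) = u" "s \<cdot> k = a" using that k(1-3) by (subst (asm) pairing_eq_iff; auto)+
    moreover have "Dom C k = Dom C a" using k(2) that by simp
    ultimately show "u = f \<cdot> a \<and> factors_through C a s"
      using k(1,3) factors_throughI[of k a s] by simp
  next
    assume a: "u = f \<cdot> a \<and> factors_through C a s"
    then obtain k where k: "k \<in> Arr C" "Dom C k = Dom C a" "Cod C k = Dom C s" "s \<cdot> k = a"
      by (auto elim: factors_throughE)
    then show "factors_through C (pairing C u a) (?g \<cdot> s)"
      using that a by (intro factors_throughI[of k]) auto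
  qed
  have ct: "c \<cdot> pairing C u a = tru \<cdot> bang (Dom C a) \<longleftrightarrow> u = f \<cdot> a"
      "d \<cdot> pairing C u a = tru \<cdot> bang (Dom C a) \<longleftrightarrow> u = f \<cdot> a \<and> factors_through C a s"
    if "u \<in> Arr C" "a \<in> Arr C" "Dom C u = Dom C a" "Cod C u = ?B" "Cod C a = ?A" for u a
  proof -
    have z: "pairing C u a \<in> Arr C" "Cod C (pairing C u a) = prod C ?B ?A" "Dom C (pairing C u a) = Dom C a"
      using that by auto
    show "c \<cdot> pairing C u a = tru \<cdot> bang (Dom C a) \<longleftrightarrow> u = f \<cdot> a"
      using c(4)[unfolded classifies_def, rule_format, of "pairing C u a"] gmem[OF that] z by simp
    show "d \<cdot> pairing C u a = tru \<cdot> bang (Dom C a) \<longleftrightarrow> u = f \<cdot> a \<and> factors_through C a s"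
      using d(4)[unfolded classifies_def, rule_format, of "pairing C u a"] gsmem[OF that] z by simp
  qed
  let ?T = "transpose C ?B ?A Om"
  obtain k where k: "is_mono C k" "Cod C k = ?B" and
    k': "\<And>b. b \<in> Arr C \<Longrightarrow> Cod C b = ?B \<Longrightarrow> factors_through C b k \<longleftrightarrow> ?T c \<cdot> b = ?T d \<cdot> b"
    using equalizer_subobject[of "?T c" "?T d"] by auto
  have "factors_through C b k \<longleftrightarrow>
      (\<forall>w\<in>Arr C. \<forall>a\<in>Arr C. Cod C w = Dom C b \<and> Cod C a = Dom C f \<and> Dom C w = Dom C a \<and>
         b \<cdot> w = f \<cdot> a \<longrightarrow> factors_through C a s)" (is "_ \<longleftrightarrow> ?R")
    if b[simp]: "b \<in> Arr C" "Cod C b = ?B" for b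
  proof -
    let ?W = "Dom C b"
    \<comment> \<open>Agreement of the two transposes at \<open>b\<close> is uncurried along
      \<open>?m\<close>, the arrow \<open>b \<times> id\<close>.\<close>
    let ?m = "pairing C (b \<cdot> pr1 C ?W ?A) (pr2 C ?W ?A)"
    have "?T c \<cdot> b = ?T d \<cdot> b \<longleftrightarrow> c \<cdot> ?m = d \<cdot> ?m"
    proof
      assume "?T c \<cdot> b = ?T d \<cdot> b"
      then have "eval C ?A Om \<cdot> pairing C (?T c \<cdot> b \<cdot> pr1 C ?W ?A) (pr2 C ?W ?A)
        = eval C ?A Om \<cdot> pairing C (?T d \<cdot> b \<cdot> pr1 C ?W ?A) (pr2 C ?W ?A)" by simp
      then show "c \<cdot> ?m = d \<cdot> ?m" by simp
    next
      assume "c \<cdot> ?m = d \<cdot> ?m"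
      then show "?T c \<cdot> b = ?T d \<cdot> b"
        by (intro expo_ext[of "?T c \<cdot> b" "?T d \<cdot> b" ?W ?A Om]) auto
    qed
    also have "\<dots> \<longleftrightarrow> ?R"
    proof
      assume e: "c \<cdot> ?m = d \<cdot> ?m"
      show ?R
      proof (intro ballI impI)
        fix w a assume wa: "w \<in> Arr C" "a \<in> Arr C"
          "Cod C w = Dom C b \<and> Cod C a = Dom C f \<and> Dom C w = Dom C a \<and> b \<cdot> w = f \<cdot> a"
        have "(c \<cdot> ?m) \<cdot> pairing C w a = (d \<cdot> ?m) \<cdot> pairing C w a" using e by simp
        then have "c \<cdot> pairing C (b \<cdot> w) a = d \<cdot> pairing C (b \<cdot> w) a" using wa by simp
        then show "factors_through C a s" using ct[of "b \<cdot> w" a] wa by simp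
      qed
    next
      assume R: ?R
      show "c \<cdot> ?m = d \<cdot> ?m"
      proof (rule Om_ext)
        fix z assume z: "z \<in> Arr C" "Cod C z = Dom C (d \<cdot> ?m)"
        \<comment> \<open>The coordinates of \<open>z\<close> serve as the stage \<open>w\<close>
          and the fibre element \<open>a\<close> of the quantified statement.\<close>
        let ?w = "pr1 C ?W ?A \<cdot> z" and ?a = "pr2 C ?W ?A \<cdot> z"
        have "(c \<cdot> ?m) \<cdot> z = c \<cdot> pairing C (b \<cdot> ?w) ?a" "(d \<cdot> ?m) \<cdot> z = d \<cdot> pairing C (b \<cdot> ?w) ?a"
          using z by auto
        then show "(c \<cdot> ?m) \<cdot> z = tru \<cdot> bang (Dom C z) \<longleftrightarrow> (d \<cdot> ?m) \<cdot> z = tru \<cdot> bang (Dom C z)"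
          using ct[of "b \<cdot> ?w" ?a] R[rule_format, of ?w ?a] z by auto
      qed auto
    qed
    finally show ?thesis using k' b by simp
  qed
  then show ?thesis using that k by blast
qed

text \<open>The join condition in \<^const>\<open>is_complement\<close> is pulled back along \<open>f\<close> with the right adjoint
  \<open>\<forall>\<^sub>f\<close> of the preimage map on subobjects.\<close>

lemma complement_covers_preimage:
  assumes c: "is_complement C m n" and f: "f \<in> Arr C" "Cod C f = Cod C m"
    and s: "is_mono C s" "Cod C s = Dom C f"
    and m: "\<And>a. a \<in> Arr C \<Longrightarrow> Cod C a = Dom C f \<Longrightarrow> factors_through C (f \<cdot> a) m \<Longrightarrow> factors_through C a s"
    and n: "\<And>a. a \<in> Arr C \<Longrightarrow> Cod C a = Dom C f \<Longrightarrow> factors_through C (f \<cdot> a) n \<Longrightarrow> factors_through C a s"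
  shows "is_iso C s"
proof -
  obtain k where k: "is_mono C k" "Cod C k = Cod C f"
    and k': "\<And>b. b \<in> Arr C \<Longrightarrow> Cod C b = Cod C f \<Longrightarrow> factors_through C b k \<longleftrightarrow>
      (\<forall>w\<in>Arr C. \<forall>a\<in>Arr C. Cod C w = Dom C b \<and> Cod C a = Dom C f \<and> Dom C w = Dom C a \<and>
         b \<cdot> w = f \<cdot> a \<longrightarrow> factors_through C a s)"
    using forall_subobject[OF f(1) s] by blast
  have mn: "m \<in> Arr C" "n \<in> Arr C" "Cod C n = Cod C m"
    using c by (auto simp: is_complement_def mono_Arr)
  have "factors_through C m k" using m f mn
    by (subst k') (auto intro!: m simp: factors_through_iff)
  moreover have "factors_through C n k" using n f mn
    by (subst k') (auto intro!: n simp: factors_through_iff)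
  ultimately have "is_iso C k" using c k f unfolding is_complement_def by simp
  then have "factors_through C f k" using factors_through_iso f k by simp
  then have "\<forall>w\<in>Arr C. \<forall>a\<in>Arr C. Cod C w = Dom C f \<and> Cod C a = Dom C f \<and> Dom C w = Dom C a \<and>
         f \<cdot> w = f \<cdot> a \<longrightarrow> factors_through C a s" using k'[of f] f by blast
  from this[rule_format, of "Ide C (Dom C f)" "Ide C (Dom C f)"]
  have "factors_through C (Ide C (Dom C f)) s" using f by simp
  then show ?thesis using s iso_if_Ide_factors by simp
qed

section \<open>Complements and decidable objects\<close>

text \<open>An element of both subobjects factors through their initial intersection, and initial
  objects are strict.\<close>

lemma complement_disjoint:
  assumes "is_complement C m n" "factors_through C a m" "factors_through C a n"
  shows "is_initial C (Dom C a)"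
proof -
  obtain P u v where P: "is_pullback C m n P u v" "is_initial C P"
    using assms(1) by (auto simp: is_complement_def)
  obtain h k where h: "h \<in> Arr C" "Dom C h = Dom C a" "Cod C h = Dom C m" "m \<cdot> h = a"
    and k: "k \<in> Arr C" "Dom C k = Dom C a" "Cod C k = Dom C n" "n \<cdot> k = a"
    using assms(2,3) by (meson factors_throughE)
  have "Dom C h \<in> Obj C" using h(1) by simp
  then have "\<exists>!l. l \<in> Hom C (Dom C a) P \<and> u \<cdot> l = h \<and> v \<cdot> l = k"
    using P(1) h k unfolding is_pullback_def by (simp add: Hom_iff)
  then obtain l where "l \<in> Hom C (Dom C a) P" by blast
  then show ?thesis using strict_initial[OF P(2), of l] by (auto simp: Hom_iff)
qed

text \<open>The preimage of \<open>n\<close> along \<open>m\<close> serves as the intersection: its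
  inclusion yields an element of both subobjects, so the assumed disjointness makes its domain
  initial.\<close>

lemma complementI:
  assumes m: "is_mono C m" and n: "is_mono C n" and mn: "Cod C m = Cod C n"
    and disj: "\<And>a. a \<in> Arr C \<Longrightarrow> factors_through C a m \<Longrightarrow> factors_through C a n \<Longrightarrow> is_initial C (Dom C a)"
    and cover: "\<And>s. is_mono C s \<Longrightarrow> Cod C s = Cod C m \<Longrightarrow> factors_through C m s \<Longrightarrow>
      factors_through C n s \<Longrightarrow> is_iso C s"
  shows "is_complement C m n"
proof -
  note [simp] = mono_Arr[OF m] mono_Arr[OF n] mn
  obtain k where k: "is_mono C k" "Cod C k = Dom C m"
    and k': "\<And>a. a \<in> Arr C \<Longrightarrow> Cod C a = Dom C m \<Longrightarrow> factors_through C a k \<longleftrightarrow> factors_through C (m \<cdot> a) n"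
    using preimage_subobject[of m n] n by auto
  note [simp] = mono_Arr[OF k(1)] k(2)
  have mk: "factors_through C (m \<cdot> k) n" using k'[of k] factors_through_refl[of k] by simp
  then obtain v where v: "v \<in> Arr C" "Dom C v = Dom C (m \<cdot> k)" "Cod C v = Dom C n" "n \<cdot> v = m \<cdot> k"
    by (rule factors_throughE)
  have v2: "Dom C v = Dom C k" using v by simp
  have "factors_through C (m \<cdot> k) m" by (rule factors_throughI[of k]) auto
  then have "is_initial C (Dom C k)" using disj[of "m \<cdot> k"] mk by simp
  moreover have "is_pullback C m n (Dom C k) k v"
    unfolding is_pullback_def
  proof (intro conjI ballI impI)
    fix Z a b assume "Z \<in> Obj C" and a: "a \<in> Hom C Z (Dom C m)" and b: "b \<in> Hom C Z (Dom C n)"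
      and e: "m \<cdot> a = n \<cdot> b"
    have "factors_through C (m \<cdot> a) n"
      by (rule factors_throughI[of b]) (use a b e in \<open>auto simp: Hom_iff\<close>)
    then have "factors_through C a k" using k' a by (simp add: Hom_iff)
    then obtain h where h: "h \<in> Arr C" "Dom C h = Dom C a" "Cod C h = Dom C k" "k \<cdot> h = a"
      by (rule factors_throughE)
    have "n \<cdot> (v \<cdot> h) = n \<cdot> b" using Comp_eq_extend[OF v(4), of h] v v2 h e by simp
    from mono_cancel[OF n this] have "v \<cdot> h = b" using v v2 h a b by (simp add: Hom_iff)
    show "\<exists>!h. h \<in> Hom C Z (Dom C k) \<and> k \<cdot> h = a \<and> v \<cdot> h = b"
    proof (rule ex1I[of _ h])
      show "h \<in> Hom C Z (Dom C k) \<and> k \<cdot> h = a \<and> v \<cdot> h = b"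
        using h a \<open>v \<cdot> h = b\<close> by (simp add: Hom_iff)
      fix j assume j: "j \<in> Hom C Z (Dom C k) \<and> k \<cdot> j = a \<and> v \<cdot> j = b"
      then have "k \<cdot> j = k \<cdot> h" using h by simp
      from mono_cancel[OF k(1) this] show "j = h" using h a j by (simp add: Hom_iff)
    qed
  qed (use v v2 in \<open>simp_all add: Hom_iff\<close>)
  ultimately show ?thesis unfolding is_complement_def using m n cover by auto
qed

lemma diagonal_mono:
  assumes "X \<in> Obj C"
  shows "is_mono C (diagonal C X)"
  unfolding diagonal_def by (rule split_mono[of _ "pr1 C X X"]) (use assms in auto)

lemma diagonal_simps [simp]:
  assumes "X \<in> Obj C"
  shows "diagonal C X \<in> Arr C" "Dom C (diagonal C X) = X" "Cod C (diagonal C X) = prod C X X"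
  using assms by (auto simp: diagonal_def)

lemma factors_through_diagonal:
  assumes "u \<in> Arr C" "v \<in> Arr C" "Dom C u = Dom C v" "Cod C u = X" "Cod C v = X"
  shows "factors_through C (pairing C u v) (diagonal C X) \<longleftrightarrow> u = v"
proof
  have X: "X \<in> Obj C" using assms by auto
  { assume "factors_through C (pairing C u v) (diagonal C X)"
    then obtain k where k: "k \<in> Arr C" "Dom C k = Dom C (pairing C u v)" "Cod C k = Dom C (diagonal C X)"
      "diagonal C X \<cdot> k = pairing C u v" by (rule factors_throughE)
    from k(4) have "pairing C k k = pairing C u v" using k(1-3) X by (simp add: diagonal_def)
    then have "k = u" "k = v" using assms k(1-3) X by (subst (asm) pairing_eq_iff; auto)+
    then show "u = v" by simp }
  assume "u = v"
  then show "factors_through C (pairing C u v) (diagonal C X)"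
    using assms X by (intro factors_throughI[of u]) (auto simp: diagonal_def)
qed

lemma decidable_Obj: "decidable C X \<Longrightarrow> X \<in> Obj C"
  by (simp add: decidable_def)

lemma decidable_complement:
  assumes "decidable C X"
  obtains n where "is_complement C (diagonal C X) n" "is_mono C n" "n \<in> Arr C" "Cod C n = prod C X X"
proof -
  obtain n where "is_complement C (diagonal C X) n"
    using assms by (auto simp: decidable_def complemented_def)
  moreover from this have "is_mono C n" "Cod C n = prod C X X"
    using decidable_Obj[OF assms] by (auto simp: is_complement_def)
  ultimately show ?thesis using that mono_Arr by blast
qed

text \<open>The complement of the diagonal is pulled back along \<open>m \<times> m\<close>. Since
  \<open>m\<close> is monic, the diagonal of its codomain pulls back to the diagonal of its domain,
  and both complement conditions are inherited.\<close>

lemma decidable_subobject: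
  assumes m: "is_mono C m" and "decidable C (Cod C m)"
  shows "decidable C (Dom C m)"
proof -
  let ?A = "Dom C m" and ?D = "Cod C m"
  note [simp] = mono_Arr[OF m]
  obtain n where c: "is_complement C (diagonal C ?D) n" "is_mono C n" "n \<in> Arr C" "Cod C n = prod C ?D ?D"
    using decidable_complement[OF assms(2)] .
  let ?f = "pairing C (m \<cdot> pr1 C ?A ?A) (m \<cdot> pr2 C ?A ?A)"
  obtain k where k: "is_mono C k" "Cod C k = prod C ?A ?A" and k': "\<And>a. a \<in> Arr C \<Longrightarrow>
      Cod C a = prod C ?A ?A \<Longrightarrow> factors_through C a k \<longleftrightarrow> factors_through C (?f \<cdot> a) n"
    using preimage_subobject[of ?f n] c by auto
  have f_diag: "factors_through C (?f \<cdot> a) (diagonal C ?D) \<longleftrightarrow> factors_through C a (diagonal C ?A)"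
    if a: "a \<in> Arr C" "Cod C a = prod C ?A ?A" for a
  proof -
    let ?u = "pr1 C ?A ?A \<cdot> a" and ?v = "pr2 C ?A ?A \<cdot> a"
    have "factors_through C (?f \<cdot> a) (diagonal C ?D) \<longleftrightarrow> m \<cdot> ?u = m \<cdot> ?v"
      using a factors_through_diagonal[of "m \<cdot> ?u" "m \<cdot> ?v"] by simp
    also have "\<dots> \<longleftrightarrow> ?u = ?v" using mono_cancel[OF m, of ?u ?v] a by auto
    also have "\<dots> \<longleftrightarrow> factors_through C a (diagonal C ?A)"
      using a factors_through_diagonal[of ?u ?v ?A] by simp
    finally show ?thesis .
  qed
  have "is_complement C (diagonal C ?A) k"
  proof (rule complementI)
    show "is_mono C (diagonal C ?A)" by (simp add: diagonal_mono)
    show "is_mono C k" by fact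
    show "Cod C (diagonal C ?A) = Cod C k" using k by simp
  next
    fix a assume a: "a \<in> Arr C" "factors_through C a (diagonal C ?A)" "factors_through C a k"
    then have [simp]: "Cod C a = prod C ?A ?A" using k by (auto elim!: factors_throughE)
    have "factors_through C (?f \<cdot> a) (diagonal C ?D)" "factors_through C (?f \<cdot> a) n"
      using a f_diag k' by auto
    from complement_disjoint[OF c(1) this] show "is_initial C (Dom C a)" using a by simp
  next
    fix s assume s: "is_mono C s" "Cod C s = Cod C (diagonal C ?A)" "factors_through C (diagonal C ?A) s"
      "factors_through C k s"
    show "is_iso C s"
    proof (rule complement_covers_preimage[OF c(1), of ?f])
      fix a assume a: "a \<in> Arr C" "Cod C a = Dom C ?f"
      { assume "factors_through C (?f \<cdot> a) (diagonal C ?D)"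
        with a f_diag have "factors_through C a (diagonal C ?A)" by simp
        from factors_through_trans[OF this s(3)] show "factors_through C a s" using s by (simp add: mono_Arr) }
      assume "factors_through C (?f \<cdot> a) n"
      with a k' have "factors_through C a k" by simp
      from factors_through_trans[OF this s(4)] show "factors_through C a s" using s k by (simp add: mono_Arr)
    qed (use s in auto)
  qed
  then show ?thesis by (auto simp: decidable_def complemented_def)
qed

text \<open>The covering property of complements, pulled back along \<open>(u, v)\<close>, becomes
  case distinction on the equality of \<open>u\<close> and \<open>v\<close>, with \<open>n\<close>
  read as apartness.\<close>

lemma decidable_cover:
  assumes "decidable C D" "u \<in> Arr C" "v \<in> Arr C" "Dom C u = Dom C v" "Cod C u = D" "Cod C v = D"
    and n: "is_complement C (diagonal C D) n"
    and s: "is_mono C s" "Cod C s = Dom C v"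
    and "\<And>a. a \<in> Arr C \<Longrightarrow> Cod C a = Dom C v \<Longrightarrow> u \<cdot> a = v \<cdot> a \<Longrightarrow> factors_through C a s"
    and "\<And>a. a \<in> Arr C \<Longrightarrow> Cod C a = Dom C v \<Longrightarrow> factors_through C (pairing C (u \<cdot> a) (v \<cdot> a)) n \<Longrightarrow>
      factors_through C a s"
  shows "is_iso C s"
proof (rule complement_covers_preimage[OF n, of "pairing C u v"])
  fix a assume a: "a \<in> Arr C" "Cod C a = Dom C (pairing C u v)"
  have e: "pairing C u v \<cdot> a = pairing C (u \<cdot> a) (v \<cdot> a)" using assms(2-6) a by simp
  { assume "factors_through C (pairing C u v \<cdot> a) (diagonal C D)"
    then have "u \<cdot> a = v \<cdot> a"
      unfolding e using assms(2-6) a by (subst (asm) factors_through_diagonal) auto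
    then show "factors_through C a s" using assms a by simp }
  assume "factors_through C (pairing C u v \<cdot> a) n"
  then show "factors_through C a s" unfolding e using assms a by simp
qed (use assms decidable_Obj[OF assms(1)] in auto)

end

section \<open>Points under NS\<close>

locale nullstellensatz_topos = elementary_topos +
  assumes nullstellensatz: "NS C"
begin

lemma point_or_initial:
  assumes "X \<in> Obj C" "\<not> is_initial C X"
  obtains x where "x \<in> Arr C" "Dom C x = one C" "Cod C x = X"
  using nullstellensatz assms by (auto simp: NS_def Hom_iff)

lemma factors_through_if_initial:
  assumes "is_initial C (Dom C k)" "k \<in> Arr C" "s \<in> Arr C" "Cod C s = Cod C k"
  shows "factors_through C k s"
proof -
  obtain i where i: "i \<in> Arr C" "Dom C i = Dom C k" "Cod C i = Dom C s"
    using initial_arrow[OF assms(1), of "Dom C s"] assms by auto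
  moreover have "s \<cdot> i = k" by (rule initial_unique[OF assms(1)]) (use i assms in auto)
  ultimately show ?thesis using assms by (intro factors_throughI[of i]) auto
qed

text \<open>By cases on the equality of \<open>u\<close> and \<open>v\<close>: a stage at which they
  are apart has no point, because at points they agree; by NS it is initial and so lies vacuously in
  the equalizer.\<close>

lemma points_separate:
  assumes "decidable C D" "u \<in> Arr C" "v \<in> Arr C" "Dom C u = Dom C v" "Cod C u = D" "Cod C v = D"
    and eq: "\<And>z. z \<in> Arr C \<Longrightarrow> Dom C z = one C \<Longrightarrow> Cod C z = Dom C v \<Longrightarrow> u \<cdot> z = v \<cdot> z"
  shows "u = v"
proof -
  note [simp] = assms(2-6)
  obtain n where n: "is_complement C (diagonal C D) n" "is_mono C n" "n \<in> Arr C" "Cod C n = prod C D D"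
    using decidable_complement[OF assms(1)] .
  obtain s where s: "is_mono C s" "Cod C s = Dom C v"
    and s': "\<And>a. a \<in> Arr C \<Longrightarrow> Cod C a = Dom C v \<Longrightarrow> factors_through C a s \<longleftrightarrow> u \<cdot> a = v \<cdot> a"
    using equalizer_subobject[of u v] by auto
  note [simp] = mono_Arr[OF s(1)] s(2)
  have "is_iso C s"
  proof (rule decidable_cover[OF assms(1-6) n(1)])
    fix a assume a: "a \<in> Arr C" "Cod C a = Dom C v"
      and an: "factors_through C (pairing C (u \<cdot> a) (v \<cdot> a)) n"
    have "is_initial C (Dom C a)"
    proof (rule ccontr)
      assume "\<not> is_initial C (Dom C a)"
      then obtain x where x: "x \<in> Arr C" "Dom C x = one C" "Cod C x = Dom C a"
        using point_or_initial[of "Dom C a"] a by auto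
      have e: "u \<cdot> (a \<cdot> x) = v \<cdot> (a \<cdot> x)" using eq[of "a \<cdot> x"] a x by simp
      have "factors_through C (pairing C (u \<cdot> a) (v \<cdot> a) \<cdot> x) n"
        by (rule factors_through_comp[OF an]) (use n a x in auto)
      then have "factors_through C (pairing C (u \<cdot> (a \<cdot> x)) (v \<cdot> (a \<cdot> x))) n" using a x by simp
      moreover have "factors_through C (pairing C (u \<cdot> (a \<cdot> x)) (v \<cdot> (a \<cdot> x))) (diagonal C D)"
        by (subst factors_through_diagonal) (use a x e in auto)
      \<comment> \<open>A point in both the diagonal and its complement makes \<open>1\<close>
        initial, and then by strictness every object that maps to \<open>1\<close>, contrary to the
        choice of \<open>a\<close>.\<close>
      ultimately have "is_initial C (one C)"
        using complement_disjoint[OF n(1)] a x by fastforce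
      then have "is_initial C (Dom C (bang (Dom C a)))"
        by (rule strict_initial) (use a in auto)
      then show False using \<open>\<not> is_initial C (Dom C a)\<close> a by simp
    qed
    then show "factors_through C a s" using a by (intro factors_through_if_initial) auto
  qed (use s s' in auto)
  then have "factors_through C (Ide C (Dom C v)) s" by (intro factors_through_iso) auto
  then show ?thesis using s' by simp
qed

end

section \<open>The reflection on decidable objects\<close>

locale decidable_reflection = nullstellensatz_topos +
  fixes \<Pi> :: "('a, 'b, 'a, 'b) cfunctor" and p :: "'a \<Rightarrow> 'b"
  assumes reflection: "adjunction C (Dec C) \<Pi> inclusion p"
begin

lemma Dec_simps:
  "Obj (Dec C) = {X. decidable C X}"
  "decidable C X \<Longrightarrow> decidable C Y \<Longrightarrow> Hom (Dec C) X Y = Hom C X Y"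
  "f \<in> Hom (Dec C) X Y \<Longrightarrow> f \<in> Hom C X Y" "Comp (Dec C) = Comp C" "Ide (Dec C) = Ide C"
  by (auto simp: Dec_def full_subcategory_def Hom_def)

lemma decidable_\<Pi>: "X \<in> Obj C \<Longrightarrow> decidable C (OMap \<Pi> X)"
  using reflection by (auto simp: adjunction_def is_functor_def Dec_simps)

lemma \<Pi>_simps [simp]:
  "X \<in> Obj C \<Longrightarrow> OMap \<Pi> X \<in> Obj C"
  "f \<in> Arr C \<Longrightarrow> AMap \<Pi> f \<in> Arr C"
  "f \<in> Arr C \<Longrightarrow> Dom C (AMap \<Pi> f) = OMap \<Pi> (Dom C f)"
  "f \<in> Arr C \<Longrightarrow> Cod C (AMap \<Pi> f) = OMap \<Pi> (Cod C f)"
proof -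
  have "is_functor C (Dec C) \<Pi>" using reflection by (simp add: adjunction_def)
  then have "AMap \<Pi> f \<in> Hom (Dec C) (OMap \<Pi> (Dom C f)) (OMap \<Pi> (Cod C f))" if "f \<in> Arr C" for f
    using that unfolding is_functor_def by (auto simp: Hom_iff)
  from Dec_simps(3)[OF this] show "f \<in> Arr C \<Longrightarrow> AMap \<Pi> f \<in> Arr C"
    "f \<in> Arr C \<Longrightarrow> Dom C (AMap \<Pi> f) = OMap \<Pi> (Dom C f)"
    "f \<in> Arr C \<Longrightarrow> Cod C (AMap \<Pi> f) = OMap \<Pi> (Cod C f)"
    by (auto simp: Hom_iff)
qed (simp add: decidable_\<Pi> decidable_Obj)

lemma \<Pi>_functor [simp]:
  "X \<in> Obj C \<Longrightarrow> AMap \<Pi> (Ide C X) = Ide C (OMap \<Pi> X)"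
  "f \<in> Arr C \<Longrightarrow> g \<in> Arr C \<Longrightarrow> Dom C g = Cod C f \<Longrightarrow> AMap \<Pi> (g \<cdot> f) = AMap \<Pi> g \<cdot> AMap \<Pi> f"
proof -
  have "is_functor C (Dec C) \<Pi>" using reflection by (simp add: adjunction_def)
  then show "X \<in> Obj C \<Longrightarrow> AMap \<Pi> (Ide C X) = Ide C (OMap \<Pi> X)"
    and "f \<in> Arr C \<Longrightarrow> g \<in> Arr C \<Longrightarrow> Dom C g = Cod C f \<Longrightarrow> AMap \<Pi> (g \<cdot> f) = AMap \<Pi> g \<cdot> AMap \<Pi> f"
    by (auto simp: is_functor_def Dec_simps Hom_iff)
qed

lemma unit_natural_transformation: "natural_transformation C C id_functor (inclusion \<circ>\<^sub>F \<Pi>) p"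
  using reflection by (simp add: adjunction_def)

lemma unit_simps [simp]:
  assumes "X \<in> Obj C"
  shows "p X \<in> Arr C" "Dom C (p X) = X" "Cod C (p X) = OMap \<Pi> X"
  using unit_natural_transformation assms
  by (auto simp: natural_transformation_def Hom_iff id_functor_def comp_functor_def)

lemma unit_natural:
  assumes "f \<in> Arr C" "Dom C f = X" "Cod C f = Y"
  shows "AMap \<Pi> f \<cdot> p X = p Y \<cdot> f"
  using unit_natural_transformation assms
  by (auto simp: natural_transformation_def Hom_iff id_functor_def comp_functor_def)

lemma reflection_ex1:
  assumes "f \<in> Arr C" "Dom C f = X" "Cod C f = D" "decidable C D"
  shows "\<exists>!g. g \<in> Hom C (OMap \<Pi> X) D \<and> g \<cdot> p X = f"
proof -
  have "\<forall>X\<in>Obj C. \<forall>Y\<in>Obj (Dec C). \<forall>f\<in>Hom C X Y. \<exists>!g. g \<in> Hom (Dec C) (OMap \<Pi> X) Y \<and> g \<cdot> p X = f"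
    using reflection by (simp add: adjunction_def id_functor_def)
  moreover have "X \<in> Obj C" using assms by auto
  ultimately show ?thesis using assms decidable_\<Pi> by (simp add: Dec_simps Hom_iff)
qed

lemma reflection_exists:
  assumes "f \<in> Arr C" "decidable C (Cod C f)"
  obtains g where "g \<in> Arr C" "Dom C g = OMap \<Pi> (Dom C f)" "Cod C g = Cod C f" "g \<cdot> p (Dom C f) = f"
  using reflection_ex1[OF assms(1) refl refl assms(2)] by (auto simp: Hom_iff)

lemma reflection_unique:
  assumes "g \<in> Arr C" "g' \<in> Arr C" "Dom C g = OMap \<Pi> X" "Dom C g' = OMap \<Pi> X" "Cod C g = Cod C g'"
    "decidable C (Cod C g')" "X \<in> Obj C" "g \<cdot> p X = g' \<cdot> p X"
  shows "g = g'"
  using reflection_ex1[of "g' \<cdot> p X" X "Cod C g'"] assms by (auto simp: Hom_iff)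

section \<open>The unit as a cover that lifts points\<close>

text \<open>The factor of \<open>p X\<close> through \<open>s\<close> lands in a decidable object
  and extends along \<open>p X\<close> to an arrow \<open>g\<close>; uniqueness of extensions makes
  \<open>g\<close> a section of \<open>s\<close>.\<close>

lemma unit_cover:
  assumes "is_mono C s" "Cod C s = OMap \<Pi> X" "X \<in> Obj C" "factors_through C (p X) s"
  shows "is_iso C s"
proof -
  note [simp] = mono_Arr[OF assms(1)] assms(2,3)
  have d: "decidable C (Dom C s)" using decidable_subobject[OF assms(1)] decidable_\<Pi> by simp
  from assms(4) obtain k where k: "k \<in> Arr C" "Dom C k = Dom C (p X)" "Cod C k = Dom C s" "s \<cdot> k = p X"
    by (rule factors_throughE)
  obtain g where g: "g \<in> Arr C" "Dom C g = OMap \<Pi> X" "Cod C g = Dom C s" "g \<cdot> p X = k"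
    using reflection_exists[of k] k d by auto
  have "s \<cdot> g = Ide C (OMap \<Pi> X)"
    by (rule reflection_unique[of _ _ X]) (use g k decidable_\<Pi> in auto)
  then have "factors_through C (Ide C (Cod C s)) s"
    by (intro factors_throughI[of g]) (use g in auto)
  then show ?thesis using assms(1) by (rule iso_if_Ide_factors[rotated])
qed

text \<open>The equation makes \<open>p X\<close> a split mono into a decidable object.\<close>

lemma decidable_if_retraction:
  assumes "r \<in> Arr C" "Dom C r = OMap \<Pi> X" "X \<in> Obj C" "r \<cdot> p X = Ide C X"
  shows "decidable C X"
  using decidable_subobject[OF split_mono[of "p X" r]] assms decidable_\<Pi> by simp

text \<open>\<open>k\<close> is the fibre of \<open>p X\<close> over \<open>y\<close>. A fibre that
  is not initial has a point by NS. An initial one would confine \<open>p X\<close> to the elements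
  apart from \<open>y\<close>, a subobject that must then be everything and contain \<open>y\<close>
  itself; so \<open>1\<close> is initial and the claim becomes trivial.\<close>

lemma unit_points_surjective:
  assumes "y \<in> Arr C" "Dom C y = one C" "Cod C y = OMap \<Pi> X" "X \<in> Obj C"
  shows "\<exists>x\<in>Arr C. Dom C x = one C \<and> Cod C x = X \<and> p X \<cdot> x = y"
proof -
  note [simp] = assms
  let ?D = "OMap \<Pi> X"
  let ?y = "y \<cdot> bang X"
  obtain n where n: "is_complement C (diagonal C ?D) n" "is_mono C n" "n \<in> Arr C" "Cod C n = prod C ?D ?D"
    using decidable_complement[OF decidable_\<Pi>[OF assms(4)]] .
  obtain k where k: "is_mono C k" "Cod C k = X"
    and k': "\<And>a. a \<in> Arr C \<Longrightarrow> Cod C a = X \<Longrightarrow> factors_through C a k \<longleftrightarrow> p X \<cdot> a = ?y \<cdot> a"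
    using equalizer_subobject[of "p X" ?y] by auto
  note [simp] = mono_Arr[OF k(1)] k(2)
  have pk: "p X \<cdot> k = y \<cdot> bang (Dom C k)" using k'[of k] factors_through_refl[of k] by simp
  show ?thesis
  proof (cases "is_initial C (Dom C k)")
    case False
    then obtain x where x: "x \<in> Arr C" "Dom C x = one C" "Cod C x = Dom C k"
      using point_or_initial[of "Dom C k"] by auto
    have "p X \<cdot> (k \<cdot> x) = y \<cdot> (bang (Dom C k) \<cdot> x)" using Comp_eq_extend[OF pk, of x] x by simp
    also have "bang (Dom C k) \<cdot> x = Ide C (one C)" by (rule one_unique) (use x in auto)
    finally show ?thesis using x by (intro bexI[of _ "k \<cdot> x"]) auto
  next
    case True
    \<comment> \<open>As \<open>?q\<close> sends \<open>d\<close> to \<open>(d, y)\<close>, the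
      subobject \<open>m\<close> below consists of the elements of \<open>\<Pi> X\<close> apart from
      \<open>y\<close>; \<open>s\<close> is its preimage under \<open>p X\<close>.\<close>
    let ?q = "pairing C (Ide C ?D) (y \<cdot> bang ?D)"
    obtain m where m: "is_mono C m" "Cod C m = ?D" and m': "\<And>a. a \<in> Arr C \<Longrightarrow> Cod C a = ?D \<Longrightarrow>
        factors_through C a m \<longleftrightarrow> factors_through C (?q \<cdot> a) n"
      using preimage_subobject[of ?q n] n by auto
    obtain s where s: "is_mono C s" "Cod C s = X" and s': "\<And>a. a \<in> Arr C \<Longrightarrow> Cod C a = X \<Longrightarrow>
        factors_through C a s \<longleftrightarrow> factors_through C (p X \<cdot> a) m"
      using preimage_subobject[of "p X" m] m by auto
    note [simp] = mono_Arr[OF s(1)] s(2)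
    have "factors_through C k s"
      using True by (intro factors_through_if_initial) auto
    have "is_iso C s"
    proof (rule decidable_cover[OF decidable_\<Pi>[OF assms(4)], of "p X" ?y])
      fix a assume a: "a \<in> Arr C" "Cod C a = Dom C ?y"
      { assume "p X \<cdot> a = ?y \<cdot> a"
        then have "factors_through C a k" using k' a by simp
        then show "factors_through C a s"
          using \<open>factors_through C k s\<close> by (rule factors_through_trans) auto }
      assume "factors_through C (pairing C (p X \<cdot> a) (?y \<cdot> a)) n"
      then show "factors_through C a s" using a s' m' by simp
    qed (use n s in auto)
    then have "factors_through C (Ide C X) s" by (intro factors_through_iso) auto
    then have "factors_through C (p X) m" using s' by simp
    with m have "is_iso C m" by (intro unit_cover) auto
    then have "factors_through C y m" using m by (intro factors_through_iso) auto
    then have "factors_through C (?q \<cdot> y) n" using m' by simp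
    moreover have "bang (one C) = Ide C (one C)" by (rule one_unique) auto
    ultimately have "factors_through C (pairing C y y) n" by simp
    moreover have "factors_through C (pairing C y y) (diagonal C ?D)"
      by (subst factors_through_diagonal) auto
    ultimately have i: "is_initial C (one C)"
      using complement_disjoint[OF n(1)] by fastforce
    \<comment> \<open>With \<open>1\<close> initial, any arrow \<open>1 -> X\<close> is a preimage
      of \<open>y\<close>.\<close>
    obtain x where x: "x \<in> Arr C" "Dom C x = one C" "Cod C x = X"
      using initial_arrow[OF i assms(4)] .
    moreover have "p X \<cdot> x = y" by (rule initial_unique[OF i]) (use x in auto)
    ultimately show ?thesis by blast
  qed
qed

section \<open>Decidability of exponentials and products\<close>

lemma unit_kernel_expo:
  assumes t: "t \<in> Arr C" "Cod C t = expo C X D" and D: "decidable C D" and X: "X \<in> Obj C"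
    and v: "v1 \<in> Arr C" "v2 \<in> Arr C" "Dom C v1 = Dom C v2" "Cod C v1 = Dom C t" "Cod C v2 = Dom C t"
    and eq: "p (Dom C t) \<cdot> v1 = p (Dom C t) \<cdot> v2"
  shows "t \<cdot> v1 = t \<cdot> v2"
proof -
  let ?Y = "Dom C t" and ?V = "Dom C v2"
  note [simp] = t v X decidable_Obj[OF D]
  let ?h = "\<lambda>v. eval C X D \<cdot> pairing C (t \<cdot> (v \<cdot> pr1 C ?V X)) (pr2 C ?V X)"
  have "?h v1 = ?h v2"
  proof (rule points_separate[OF D])
    fix z assume z: "z \<in> Arr C" "Dom C z = one C" "Cod C z = Dom C (?h v2)"
    let ?a = "pr1 C ?V X \<cdot> z" and ?x = "pr2 C ?V X \<cdot> z"
    note [simp] = z(1,2)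
    have [simp]: "Cod C z = prod C ?V X" using z(3) by simp
    \<comment> \<open>With the point \<open>?x\<close> of \<open>X\<close> held fixed,
      \<open>t\<close> becomes an arrow from \<open>?Y\<close> to the decidable object
      \<open>D\<close>, and such arrows extend along the unit.\<close>
    let ?f = "eval C X D \<cdot> pairing C t (?x \<cdot> bang ?Y)"
    obtain g where g: "g \<in> Arr C" "Dom C g = OMap \<Pi> ?Y" "Cod C g = D" "g \<cdot> p ?Y = ?f"
      using reflection_exists[of ?f] D by auto
    have b: "bang (one C) = Ide C (one C)" by (rule one_unique) auto
    have f: "?f \<cdot> (v \<cdot> ?a) = ?h v \<cdot> z" if "v \<in> Arr C" "Cod C v = ?Y" "Dom C v = ?V" for v
      using that by (simp add: b)
    have "?f \<cdot> (v1 \<cdot> ?a) = g \<cdot> ((p ?Y \<cdot> v1) \<cdot> ?a)"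
      unfolding g(4)[symmetric] using g(1-3) by simp
    also have "\<dots> = g \<cdot> ((p ?Y \<cdot> v2) \<cdot> ?a)" unfolding eq ..
    also have "\<dots> = ?f \<cdot> (v2 \<cdot> ?a)"
      unfolding g(4)[symmetric] using g(1-3) by simp
    finally show "?h v1 \<cdot> z = ?h v2 \<cdot> z" using f[of v1] f[of v2] by simp
  qed simp_all
  then show ?thesis
    by (intro expo_ext[of "t \<cdot> v1" "t \<cdot> v2" ?V X D]) auto
qed

text \<open>The graph of the factorization is \<open>{(b, z). \<forall>y. p y = b \<longrightarrow> t y = z}\<close>. It contains the image
  of \<open>(p, t)\<close>, and its projection to \<open>\<Pi> Y\<close> is monic since \<open>p\<close> stays a cover after pullback;
  hence the projection is invertible.\<close>

lemma unit_factorization: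
  assumes t: "t \<in> Arr C" "Dom C t = Y" "Cod C t = Z"
    and ker: "\<And>v1 v2. v1 \<in> Arr C \<Longrightarrow> v2 \<in> Arr C \<Longrightarrow> Dom C v1 = Dom C v2 \<Longrightarrow> Cod C v1 = Y \<Longrightarrow>
       Cod C v2 = Y \<Longrightarrow> p Y \<cdot> v1 = p Y \<cdot> v2 \<Longrightarrow> t \<cdot> v1 = t \<cdot> v2"
  shows "\<exists>g\<in>Arr C. Dom C g = OMap \<Pi> Y \<and> Cod C g = Z \<and> g \<cdot> p Y = t"
proof -
  have [simp]: "Y \<in> Obj C" "Z \<in> Obj C" using t by auto
  note [simp] = t
  let ?B = "OMap \<Pi> Y"
  let ?f = "pairing C (p Y \<cdot> pr1 C Y Z) (pr2 C Y Z)" and ?g = "pairing C (Ide C Y) t"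
  have "is_mono C ?g" by (rule split_mono[of _ "pr1 C Y Z"]) auto
  \<comment> \<open>\<open>T\<close> arises by quantifying the graph \<open>?g\<close> of
    \<open>t\<close> along \<open>?f\<close>, the arrow \<open>p \<times> id\<close>.\<close>
  then obtain T where T: "is_mono C T" "Cod C T = prod C ?B Z"
    and T': "\<And>b. b \<in> Arr C \<Longrightarrow> Cod C b = prod C ?B Z \<Longrightarrow> factors_through C b T \<longleftrightarrow>
      (\<forall>w\<in>Arr C. \<forall>a\<in>Arr C. Cod C w = Dom C b \<and> Cod C a = prod C Y Z \<and> Dom C w = Dom C a \<and>
         b \<cdot> w = ?f \<cdot> a \<longrightarrow> factors_through C a ?g)"
    using forall_subobject[of ?f ?g] by auto
  note [simp] = mono_Arr[OF T(1)] T(2)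
  have mem_g: "factors_through C a ?g \<longleftrightarrow> t \<cdot> (pr1 C Y Z \<cdot> a) = pr2 C Y Z \<cdot> a"
    if a: "a \<in> Arr C" "Cod C a = prod C Y Z" for a
  proof
    assume "factors_through C a ?g"
    then obtain k where k: "k \<in> Arr C" "Dom C k = Dom C a" "Cod C k = Dom C ?g" "?g \<cdot> k = a"
      by (rule factors_throughE)
    have "t \<cdot> (pr1 C Y Z \<cdot> (?g \<cdot> k)) = pr2 C Y Z \<cdot> (?g \<cdot> k)" using k(1-3) by simp
    then show "t \<cdot> (pr1 C Y Z \<cdot> a) = pr2 C Y Z \<cdot> a" unfolding k(4) .
  next
    assume "t \<cdot> (pr1 C Y Z \<cdot> a) = pr2 C Y Z \<cdot> a"
    then show "factors_through C a ?g"
      using a by (intro factors_throughI[of "pr1 C Y Z \<cdot> a"]) auto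
  qed
  \<comment> \<open>At a stage \<open>w\<close> the element \<open>a\<close> of
    \<open>Y \<times> Z\<close> is determined by its first coordinate \<open>y\<close>, since its
    second coordinate must be that of \<open>b\<close>.\<close>
  have mem_T: "factors_through C b T \<longleftrightarrow>
      (\<forall>w\<in>Arr C. \<forall>y\<in>Arr C. Cod C w = Dom C b \<and> Cod C y = Y \<and> Dom C w = Dom C y \<and>
         pr1 C ?B Z \<cdot> (b \<cdot> w) = p Y \<cdot> y \<longrightarrow> t \<cdot> y = pr2 C ?B Z \<cdot> (b \<cdot> w))" (is "_ \<longleftrightarrow> ?R")
    if b: "b \<in> Arr C" "Cod C b = prod C ?B Z" for b
  proof
    assume "factors_through C b T"
    then have R: "\<forall>w\<in>Arr C. \<forall>a\<in>Arr C. Cod C w = Dom C b \<and> Cod C a = prod C Y Z \<and> Dom C w = Dom C a \<and>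
         b \<cdot> w = ?f \<cdot> a \<longrightarrow> factors_through C a ?g" using T'[OF b] by blast
    show ?R
    proof (intro ballI impI)
      fix w y assume wy: "w \<in> Arr C" "y \<in> Arr C" "Cod C w = Dom C b \<and> Cod C y = Y \<and>
        Dom C w = Dom C y \<and> pr1 C ?B Z \<cdot> (b \<cdot> w) = p Y \<cdot> y"
      let ?a = "pairing C y (pr2 C ?B Z \<cdot> (b \<cdot> w))"
      have "b \<cdot> w = ?f \<cdot> ?a" by (rule prod_ext[of _ _ ?B Z]) (use wy b in auto)
      then have "factors_through C ?a ?g" using R[rule_format, of w ?a] wy b by simp
      then show "t \<cdot> y = pr2 C ?B Z \<cdot> (b \<cdot> w)" using wy b mem_g[of ?a] by simp
    qed
  next
    assume R: ?R
    have "factors_through C a ?g" if wa: "w \<in> Arr C" "a \<in> Arr C" "Cod C w = Dom C b"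
      "Cod C a = prod C Y Z" "Dom C w = Dom C a" "b \<cdot> w = ?f \<cdot> a" for w a
      using R[rule_format, of w "pr1 C Y Z \<cdot> a"] wa b mem_g[of a] by simp
    then show "factors_through C b T" using T'[OF b] by blast
  qed
  let ?q1 = "pr1 C ?B Z \<cdot> T" and ?q2 = "pr2 C ?B Z \<cdot> T"
  have pt: "factors_through C (pairing C (p Y) t) T"
  proof (subst mem_T)
    show "\<forall>w\<in>Arr C. \<forall>y\<in>Arr C. Cod C w = Dom C (pairing C (p Y) t) \<and> Cod C y = Y \<and> Dom C w = Dom C y \<and>
         pr1 C ?B Z \<cdot> (pairing C (p Y) t \<cdot> w) = p Y \<cdot> y \<longrightarrow> t \<cdot> y = pr2 C ?B Z \<cdot> (pairing C (p Y) t \<cdot> w)"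
    proof (intro ballI impI)
      fix w y assume wy: "w \<in> Arr C" "y \<in> Arr C" "Cod C w = Dom C (pairing C (p Y) t) \<and> Cod C y = Y \<and>
         Dom C w = Dom C y \<and> pr1 C ?B Z \<cdot> (pairing C (p Y) t \<cdot> w) = p Y \<cdot> y"
      \<comment> \<open>The hypothesis that \<open>t\<close> identifies whatever \<open>p\<close>
        identifies is what puts \<open>(p, t)\<close> into \<open>T\<close>.\<close>
      then have "t \<cdot> y = t \<cdot> w" by (intro ker) auto
      then show "t \<cdot> y = pr2 C ?B Z \<cdot> (pairing C (p Y) t \<cdot> w)" using wy by simp
    qed
  qed auto
  then obtain k where k: "k \<in> Arr C" "Dom C k = Dom C (pairing C (p Y) t)" "Cod C k = Dom C T"
    "T \<cdot> k = pairing C (p Y) t" by (rule factors_throughE)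
  note [simp] = k(1,3)
  have [simp]: "Dom C k = Y" using k(2) by simp
  have q1k: "?q1 \<cdot> k = p Y" and q2k: "?q2 \<cdot> k = t" using k(4) by simp_all
  have "is_mono C ?q1"
  proof (rule monoI)
    fix c c' assume c: "c \<in> Arr C" "c' \<in> Arr C" "Cod C c = Dom C ?q1" "Cod C c' = Dom C ?q1"
      "Dom C c = Dom C c'" and e: "?q1 \<cdot> c = ?q1 \<cdot> c'"
    have [simp]: "Cod C c = Dom C T" "Cod C c' = Dom C T" using c by auto
    note [simp] = c(1,2,5)
    let ?b = "?q1 \<cdot> c'" and ?z = "?q2 \<cdot> c" and ?z' = "?q2 \<cdot> c'"
    obtain s where s: "is_mono C s" "Cod C s = Dom C c'"
      and s': "\<And>a. a \<in> Arr C \<Longrightarrow> Cod C a = Dom C c' \<Longrightarrow> factors_through C a s \<longleftrightarrow> ?z \<cdot> a = ?z' \<cdot> a"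
      using equalizer_subobject[of ?z ?z'] by auto
    \<comment> \<open>\<open>l\<close> collects the elements of \<open>\<Pi> Y\<close> over which
      the second coordinates of \<open>c\<close> and \<open>c'\<close> agree. The unit
      \<open>p Y\<close> lies in it, both coordinates being given by \<open>t\<close> there, and the
      cover property extends this to all of \<open>\<Pi> Y\<close>.\<close>
    obtain l where l: "is_mono C l" "Cod C l = ?B" and l': "\<And>b. b \<in> Arr C \<Longrightarrow> Cod C b = ?B \<Longrightarrow>
      factors_through C b l \<longleftrightarrow> (\<forall>w\<in>Arr C. \<forall>a\<in>Arr C. Cod C w = Dom C b \<and> Cod C a = Dom C c' \<and>
        Dom C w = Dom C a \<and> b \<cdot> w = ?b \<cdot> a \<longrightarrow> factors_through C a s)"
      using forall_subobject[of ?b s] s by auto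
    have "factors_through C (p Y) l"
    proof (subst l')
      show "\<forall>w\<in>Arr C. \<forall>a\<in>Arr C. Cod C w = Dom C (p Y) \<and> Cod C a = Dom C c' \<and>
        Dom C w = Dom C a \<and> p Y \<cdot> w = ?b \<cdot> a \<longrightarrow> factors_through C a s"
      proof (intro ballI impI)
        fix w a assume w: "w \<in> Arr C" "a \<in> Arr C" "Cod C w = Dom C (p Y) \<and> Cod C a = Dom C c' \<and>
          Dom C w = Dom C a \<and> p Y \<cdot> w = ?b \<cdot> a"
        have "t \<cdot> w = ?q2 \<cdot> (d \<cdot> a)" if d: "d \<in> Arr C" "Cod C d = Dom C T" "Dom C d = Dom C c'"
          "?q1 \<cdot> d = ?b" for d
        proof -
          have *: "factors_through C (T \<cdot> d) T" using d by (intro factors_throughI[of d]) auto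
          have "pr1 C ?B Z \<cdot> (T \<cdot> d \<cdot> a) = (?q1 \<cdot> d) \<cdot> a" using d(1-3) w by simp
          also have "\<dots> = p Y \<cdot> w" unfolding d(4) using w by simp
          finally have "pr1 C ?B Z \<cdot> (T \<cdot> d \<cdot> a) = p Y \<cdot> w" .
          with mem_T[of "T \<cdot> d"] * d have "t \<cdot> w = pr2 C ?B Z \<cdot> (T \<cdot> d \<cdot> a)" using w by auto
          then show ?thesis using d(1-3) w by simp
        qed
        from this[of c] this[of c'] have "?q2 \<cdot> (c \<cdot> a) = ?q2 \<cdot> (c' \<cdot> a)" using e by simp
        then show "factors_through C a s" using s' w by simp
      qed
    qed auto
    with l have "is_iso C l" by (intro unit_cover) auto
    then have "factors_through C (Ide C ?B) l" using l by (intro factors_through_iso) auto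
    then have "factors_through C (Ide C (Dom C c')) s"
      using l'[of "Ide C ?B", THEN iffD1, rule_format, of ?b "Ide C (Dom C c')"] by simp
    then have "?z = ?z'" using s' by simp
    then have "T \<cdot> c = T \<cdot> c'" using e by (intro prod_ext[of "T \<cdot> c" "T \<cdot> c'" ?B Z]) auto
    from mono_cancel[OF T(1) this] show "c = c'" by simp
  qed simp
  moreover have "factors_through C (p Y) ?q1" using q1k by (intro factors_throughI[of k]) auto
  ultimately have "is_iso C ?q1" by (intro unit_cover) auto
  then have "factors_through C (Ide C ?B) ?q1" by (intro factors_through_iso) auto
  then obtain i where i: "i \<in> Arr C" "Dom C i = Dom C (Ide C ?B)" "Cod C i = Dom C ?q1" "?q1 \<cdot> i = Ide C ?B"
    by (rule factors_throughE)
  note [simp] = i(1)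
  have [simp]: "Dom C i = ?B" "Cod C i = Dom C T" using i by simp_all
  have "?q1 \<cdot> k = ?q1 \<cdot> (i \<cdot> p Y)" using Comp_eq_extend[OF i(4), of "p Y"] q1k by simp
  from mono_cancel[OF \<open>is_mono C ?q1\<close> this] have "k = i \<cdot> p Y" by simp
  then have "?q2 \<cdot> i \<cdot> p Y = t" using q2k by simp
  then show ?thesis by (intro bexI[of _ "?q2 \<cdot> i"]) auto
qed

lemma decidable_expo:
  assumes D: "decidable C D" and X: "X \<in> Obj C"
  shows "decidable C (expo C X D)"
proof -
  let ?Z = "expo C X D"
  have [simp]: "?Z \<in> Obj C" using decidable_Obj[OF D] X by simp
  have "\<exists>g\<in>Arr C. Dom C g = OMap \<Pi> ?Z \<and> Cod C g = ?Z \<and> g \<cdot> p ?Z = Ide C ?Z"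
    by (rule unit_factorization, simp_all) (use unit_kernel_expo[of "Ide C ?Z" X D] D X in auto)
  then show ?thesis using decidable_if_retraction by auto
qed

text \<open>The projections extend along the unit of the product, and the pairing of the extensions
  is a retraction of that unit.\<close>

lemma decidable_prod:
  assumes "decidable C A" "decidable C B"
  shows "decidable C (prod C A B)"
proof -
  let ?Q = "prod C A B"
  note [simp] = assms[THEN decidable_Obj]
  obtain g1 where g1: "g1 \<in> Arr C" "Dom C g1 = OMap \<Pi> ?Q" "Cod C g1 = A" "g1 \<cdot> p ?Q = pr1 C A B"
    using reflection_exists[of "pr1 C A B"] assms by auto
  obtain g2 where g2: "g2 \<in> Arr C" "Dom C g2 = OMap \<Pi> ?Q" "Cod C g2 = B" "g2 \<cdot> p ?Q = pr2 C A B"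
    using reflection_exists[of "pr2 C A B"] assms by auto
  show ?thesis by (rule decidable_if_retraction[of "pairing C g1 g2"]) (use g1 g2 in auto)
qed

section \<open>Preservation of finite products by \<Pi>\<close>

text \<open>The arrow is extended one variable at a time: its transpose \<open>A -> D^B\<close> has
  a decidable codomain and extends to \<open>\<Pi> A\<close>; after an exchange of variables the
  transpose \<open>B -> D^(\<Pi> A)\<close> extends to \<open>\<Pi> B\<close>.\<close>

lemma unit_factorization_prod:
  assumes h: "h \<in> Arr C" "Dom C h = prod C A B" "Cod C h = D" and D: "decidable C D"
    and A: "A \<in> Obj C" and B: "B \<in> Obj C"
  obtains g where "g \<in> Arr C" "Dom C g = prod C (OMap \<Pi> A) (OMap \<Pi> B)" "Cod C g = D"
    and "\<And>a b. a \<in> Arr C \<Longrightarrow> b \<in> Arr C \<Longrightarrow> Cod C a = A \<Longrightarrow> Cod C b = B \<Longrightarrow> Dom C a = Dom C b \<Longrightarrow>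
       g \<cdot> pairing C (p A \<cdot> a) (p B \<cdot> b) = h \<cdot> pairing C a b"
proof -
  note [simp] = h A B decidable_Obj[OF D]
  let ?A = "OMap \<Pi> A" and ?B = "OMap \<Pi> B"
  obtain g1 where g1: "g1 \<in> Arr C" "Dom C g1 = ?A" "Cod C g1 = expo C B D" "g1 \<cdot> p A = transpose C A B D h"
    using reflection_exists[of "transpose C A B D h"] decidable_expo[OF D] by auto
  note [simp] = g1(1-3)
  let ?h = "eval C B D \<cdot> pairing C (g1 \<cdot> pr2 C B ?A) (pr1 C B ?A)"
  obtain g2 where g2: "g2 \<in> Arr C" "Dom C g2 = ?B" "Cod C g2 = expo C ?A D" "g2 \<cdot> p B = transpose C B ?A D ?h"
    using reflection_exists[of "transpose C B ?A D ?h"] decidable_expo[OF D] by auto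
  note [simp] = g2(1-3)
  let ?g = "eval C ?A D \<cdot> pairing C (g2 \<cdot> pr2 C ?A ?B) (pr1 C ?A ?B)"
  have "?g \<cdot> pairing C (p A \<cdot> a) (p B \<cdot> b) = h \<cdot> pairing C a b"
    if [simp]: "a \<in> Arr C" "b \<in> Arr C" "Cod C a = A" "Cod C b = B" "Dom C a = Dom C b" for a b
  proof -
    have "?g \<cdot> pairing C (p A \<cdot> a) (p B \<cdot> b) = eval C ?A D \<cdot> pairing C (g2 \<cdot> (p B \<cdot> b)) (p A \<cdot> a)" by simp
    also have "g2 \<cdot> (p B \<cdot> b) = transpose C B ?A D ?h \<cdot> b" by (rule Comp_eq_extend[OF g2(4)]) auto
    also have "eval C ?A D \<cdot> pairing C (transpose C B ?A D ?h \<cdot> b) (p A \<cdot> a)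
      = eval C B D \<cdot> pairing C (g1 \<cdot> (p A \<cdot> a)) b" by simp
    also have "g1 \<cdot> (p A \<cdot> a) = transpose C A B D h \<cdot> a" by (rule Comp_eq_extend[OF g1(4)]) auto
    finally show ?thesis by simp
  qed
  then show ?thesis by (intro that[of ?g]) auto
qed

text \<open>The comparison \<open>?t : \<Pi> P -> \<Pi> A \<times> \<Pi> B\<close> has as inverse
  the extension \<open>g\<close> of \<open>p P\<close> in both variables. The two composites are
  compared with identities on points, which lift along the units.\<close>

lemma \<Pi>_preserves_product:
  assumes P: "is_product C A B P a b"
  shows "is_product C (OMap \<Pi> A) (OMap \<Pi> B) (OMap \<Pi> P) (AMap \<Pi> a) (AMap \<Pi> b)"
proof -
  let ?A = "OMap \<Pi> A" and ?B = "OMap \<Pi> B" and ?P = "OMap \<Pi> P"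
  note [simp] = product_simps[OF P]
  have [simp]: "A \<in> Obj C" "B \<in> Obj C"
    using Arr_closed(2)[of a] Arr_closed(2)[of b] by simp_all
  let ?t = "pairing C (AMap \<Pi> a) (AMap \<Pi> b)"
  obtain c where c: "c \<in> Arr C" "Dom C c = prod C A B" "Cod C c = P" "a \<cdot> c = pr1 C A B" "b \<cdot> c = pr2 C A B"
    using product_exists[OF P, of "pr1 C A B" "pr2 C A B"] by auto
  note [simp] = c(1-3)
  obtain g where g: "g \<in> Arr C" "Dom C g = prod C ?A ?B" "Cod C g = ?P"
    and g': "\<And>x y. x \<in> Arr C \<Longrightarrow> y \<in> Arr C \<Longrightarrow> Cod C x = A \<Longrightarrow> Cod C y = B \<Longrightarrow> Dom C x = Dom C y \<Longrightarrow>
       g \<cdot> pairing C (p A \<cdot> x) (p B \<cdot> y) = (p P \<cdot> c) \<cdot> pairing C x y"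
    using unit_factorization_prod[of "p P \<cdot> c" A B ?P] decidable_\<Pi> by auto
  note [simp] = g
  have nat: "AMap \<Pi> a \<cdot> (p P \<cdot> z) = p A \<cdot> (a \<cdot> z)" "AMap \<Pi> b \<cdot> (p P \<cdot> z) = p B \<cdot> (b \<cdot> z)"
    if "z \<in> Arr C" "Cod C z = P" for z
    using Comp_eq_extend[OF unit_natural[of a P A], of z] Comp_eq_extend[OF unit_natural[of b P B], of z] that
    by auto
  have c': "a \<cdot> (c \<cdot> z) = pr1 C A B \<cdot> z" "b \<cdot> (c \<cdot> z) = pr2 C A B \<cdot> z"
    if "z \<in> Arr C" "Cod C z = prod C A B" for z
    using Comp_eq_extend[OF c(4), of z] Comp_eq_extend[OF c(5), of z] that by auto
  have gt: "g \<cdot> ?t = Ide C ?P"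
  proof (rule points_separate[of ?P])
    fix z assume z: "z \<in> Arr C" "Dom C z = one C" "Cod C z = Dom C (Ide C ?P)"
    obtain x where x: "x \<in> Arr C" "Dom C x = one C" "Cod C x = P" "p P \<cdot> x = z"
      using unit_points_surjective[of z P] z by auto
    have cx: "c \<cdot> pairing C (a \<cdot> x) (b \<cdot> x) = x"
      by (rule product_unique[OF P]) (use x c' in auto)
    have "(g \<cdot> ?t) \<cdot> (p P \<cdot> x) = p P \<cdot> x" using x(1-3) nat g' cx by simp
    then show "(g \<cdot> ?t) \<cdot> z = Ide C ?P \<cdot> z" using x(4) z by simp
  qed (auto simp: decidable_\<Pi>)
  have tg: "?t \<cdot> g = Ide C (prod C ?A ?B)"
  proof (rule points_separate[of "prod C ?A ?B"])
    fix z assume z: "z \<in> Arr C" "Dom C z = one C" "Cod C z = Dom C (Ide C (prod C ?A ?B))"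
    obtain x where x: "x \<in> Arr C" "Dom C x = one C" "Cod C x = A" "p A \<cdot> x = pr1 C ?A ?B \<cdot> z"
      using unit_points_surjective[of "pr1 C ?A ?B \<cdot> z" A] z by auto
    obtain y where y: "y \<in> Arr C" "Dom C y = one C" "Cod C y = B" "p B \<cdot> y = pr2 C ?A ?B \<cdot> z"
      using unit_points_surjective[of "pr2 C ?A ?B \<cdot> z" B] z by auto
    have zxy: "z = pairing C (p A \<cdot> x) (p B \<cdot> y)" using x(4) y(4) z by simp
    have "(?t \<cdot> g) \<cdot> pairing C (p A \<cdot> x) (p B \<cdot> y) = ?t \<cdot> (g \<cdot> pairing C (p A \<cdot> x) (p B \<cdot> y))"
      using x(1-3) y(1-3) by simp
    also have "\<dots> = pairing C (p A \<cdot> x) (p B \<cdot> y)"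
      by (subst g') (use x(1-3) y(1-3) nat c' in auto)
    finally show "(?t \<cdot> g) \<cdot> z = Ide C (prod C ?A ?B) \<cdot> z" using z by (simp add: zxy)
  qed (auto simp: decidable_\<Pi> decidable_prod)
  show ?thesis
  proof (rule productI)
    fix u v assume uv: "u \<in> Arr C" "v \<in> Arr C" "Cod C u = ?A" "Cod C v = ?B" "Dom C u = Dom C v"
    have "?t \<cdot> (g \<cdot> pairing C u v) = pairing C u v"
      using Comp_eq_extend[OF tg, of "pairing C u v"] uv by simp
    then have "pr1 C ?A ?B \<cdot> (?t \<cdot> (g \<cdot> pairing C u v)) = u" "pr2 C ?A ?B \<cdot> (?t \<cdot> (g \<cdot> pairing C u v)) = v"
      using uv by (auto simp del: pairing_comp)
    then show "\<exists>h\<in>Arr C. Dom C h = Dom C u \<and> Cod C h = ?P \<and> AMap \<Pi> a \<cdot> h = u \<and> AMap \<Pi> b \<cdot> h = v"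
      using uv by (intro bexI[of _ "g \<cdot> pairing C u v"]) auto
  next
    fix h h' assume h: "h \<in> Arr C" "h' \<in> Arr C" "Cod C h = ?P" "Cod C h' = ?P" "Dom C h = Dom C h'"
      "AMap \<Pi> a \<cdot> h = AMap \<Pi> a \<cdot> h'" "AMap \<Pi> b \<cdot> h = AMap \<Pi> b \<cdot> h'"
    have "?t \<cdot> h = ?t \<cdot> h'" using h by simp
    then have "g \<cdot> (?t \<cdot> h) = g \<cdot> (?t \<cdot> h')" by simp
    then show "h = h'" using Comp_eq_extend[OF gt, of h] Comp_eq_extend[OF gt, of h'] h by simp
  qed (auto simp: Hom_iff)
qed

text \<open>Points of \<open>\<Pi> T\<close> lift to points of \<open>T\<close>, of which there is
  only one; so parallel arrows into the decidable object \<open>\<Pi> T\<close> agree on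
  points.\<close>

lemma \<Pi>_preserves_terminal:
  assumes T: "is_terminal C T"
  shows "is_terminal C (OMap \<Pi> T)"
  unfolding is_terminal_def
proof (intro conjI ballI)
  have [simp]: "T \<in> Obj C" using T by (simp add: is_terminal_def)
  show "OMap \<Pi> T \<in> Obj C" by simp
  fix X assume X: "X \<in> Obj C"
  with T obtain f where f: "f \<in> Arr C" "Dom C f = X" "Cod C f = T"
    unfolding is_terminal_def by (auto simp: Hom_iff)
  show "\<exists>!f. f \<in> Hom C X (OMap \<Pi> T)"
  proof (rule ex1I[of _ "p T \<cdot> f"])
    show "p T \<cdot> f \<in> Hom C X (OMap \<Pi> T)" using f by (simp add: Hom_iff)
    fix g assume g: "g \<in> Hom C X (OMap \<Pi> T)"
    show "g = p T \<cdot> f"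
    proof (rule points_separate[of "OMap \<Pi> T"])
      fix z assume z: "z \<in> Arr C" "Dom C z = one C" "Cod C z = Dom C (p T \<cdot> f)"
      obtain x where x: "x \<in> Arr C" "Dom C x = one C" "Cod C x = T" "p T \<cdot> x = g \<cdot> z"
        using unit_points_surjective[of "g \<cdot> z" T] z f g by (auto simp: Hom_iff)
      have "x = f \<cdot> z" by (rule terminal_unique[OF T]) (use x z f in auto)
      then show "g \<cdot> z = (p T \<cdot> f) \<cdot> z" using x z f by simp
    qed (use f g in \<open>auto simp: Hom_iff decidable_\<Pi>\<close>)
  qed
qed

lemma unit_homotopy_theory: "homotopy_theory C (inclusion \<circ>\<^sub>F \<Pi>) p"
  unfolding homotopy_theory_def preserves_finite_products_def
proof (intro conjI allI ballI impI)
  show "cartesian_closed C"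
    unfolding cartesian_closed_def using category_axioms finite_products exponentials by blast
  show "natural_transformation C C id_functor (inclusion \<circ>\<^sub>F \<Pi>) p" by (rule unit_natural_transformation)
  fix X y assume "X \<in> Obj C" "y \<in> Hom C (one C) (OMap (inclusion \<circ>\<^sub>F \<Pi>) X)"
  then show "\<exists>x\<in>Hom C (one C) X. p X \<cdot> x = y"
    using unit_points_surjective[of y X]
    by (auto simp: comp_functor_def id_functor_def Hom_def)
qed (auto simp: comp_functor_def id_functor_def \<Pi>_preserves_terminal \<Pi>_preserves_product)

end

section \<open>The homotopy category\<close>

text \<open>Congruence and cartesian closure of the quotient hold for every homotopy theory and are
  developed apart from decidable objects.\<close>

locale homotopy = cartesian_closed_category +
  fixes P :: "('a, 'b, 'a, 'b) cfunctor" and p :: "'a \<Rightarrow> 'b"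
  assumes homotopy_theory: "homotopy_theory C P p"
begin

lemma natural: "natural_transformation C C id_functor P p"
  using homotopy_theory by (simp add: homotopy_theory_def)

lemma P_simps [simp]:
  "X \<in> Obj C \<Longrightarrow> OMap P X \<in> Obj C"
  "f \<in> Arr C \<Longrightarrow> AMap P f \<in> Arr C"
  "f \<in> Arr C \<Longrightarrow> Dom C (AMap P f) = OMap P (Dom C f)"
  "f \<in> Arr C \<Longrightarrow> Cod C (AMap P f) = OMap P (Cod C f)"
  "X \<in> Obj C \<Longrightarrow> AMap P (Ide C X) = Ide C (OMap P X)"
  "f \<in> Arr C \<Longrightarrow> g \<in> Arr C \<Longrightarrow> Dom C g = Cod C f \<Longrightarrow> AMap P (g \<cdot> f) = AMap P g \<cdot> AMap P f"
proof -
  have F: "is_functor C C P" using natural by (simp add: natural_transformation_def)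
  have "AMap P f \<in> Hom C (OMap P (Dom C f)) (OMap P (Cod C f))" if "f \<in> Arr C" for f
    using F that unfolding is_functor_def by (auto simp: Hom_iff)
  then show "f \<in> Arr C \<Longrightarrow> AMap P f \<in> Arr C" "f \<in> Arr C \<Longrightarrow> Dom C (AMap P f) = OMap P (Dom C f)"
    "f \<in> Arr C \<Longrightarrow> Cod C (AMap P f) = OMap P (Cod C f)" by (auto simp: Hom_iff)
  show "X \<in> Obj C \<Longrightarrow> OMap P X \<in> Obj C" "X \<in> Obj C \<Longrightarrow> AMap P (Ide C X) = Ide C (OMap P X)"
    using F by (auto simp: is_functor_def)
  show "f \<in> Arr C \<Longrightarrow> g \<in> Arr C \<Longrightarrow> Dom C g = Cod C f \<Longrightarrow> AMap P (g \<cdot> f) = AMap P g \<cdot> AMap P f"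
    using F by (auto simp: is_functor_def Hom_iff)
qed

lemma p_simps [simp]:
  assumes "X \<in> Obj C"
  shows "p X \<in> Arr C" "Dom C (p X) = X" "Cod C (p X) = OMap P X"
  using natural assms by (auto simp: natural_transformation_def Hom_iff id_functor_def)

lemma p_natural:
  assumes "f \<in> Arr C" "Dom C f = X" "Cod C f = Y"
  shows "AMap P f \<cdot> p X = p Y \<cdot> f"
  using natural assms by (auto simp: natural_transformation_def Hom_iff id_functor_def)

lemma P_product: "is_product C A B Q a b \<Longrightarrow> is_product C (OMap P A) (OMap P B) (OMap P Q) (AMap P a) (AMap P b)"
  using homotopy_theory Arr_closed(2)[of a] Arr_closed(2)[of b] product_simps[of A B Q a b]
  unfolding homotopy_theory_def preserves_finite_products_def by auto

section \<open>Names of arrows and the homotopy relation\<close>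

lemma name_simps [simp]:
  assumes "f \<in> Arr C"
  shows "name_of C f \<in> Arr C" "Dom C (name_of C f) = one C"
    "Cod C (name_of C f) = expo C (Dom C f) (Cod C f)"
  using assms by (auto simp: name_of_def)

lemma eval_name [simp]:
  assumes "f \<in> Arr C" "Dom C f = X" "Cod C f = Y" "a \<in> Arr C" "x \<in> Arr C" "Dom C a = Dom C x"
    "Cod C a = one C" "Cod C x = X"
  shows "eval C X Y \<cdot> pairing C (name_of C f \<cdot> a) x = f \<cdot> x"
proof -
  have "X \<in> Obj C" using assms by auto
  then show ?thesis using assms by (simp add: name_of_def)
qed

lemma homotopicI:
  assumes "f \<in> Arr C" "g \<in> Arr C" "Dom C f = X" "Dom C g = X" "Cod C f = Y" "Cod C g = Y"
    "p (expo C X Y) \<cdot> name_of C f = p (expo C X Y) \<cdot> name_of C g"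
  shows "homotopic C p f g"
  using assms by (simp add: homotopic_def)

lemma homotopicD:
  assumes "homotopic C p f g"
  shows "f \<in> Arr C" "g \<in> Arr C" "Dom C f = Dom C g" "Cod C f = Cod C g"
    "p (expo C (Dom C g) (Cod C g)) \<cdot> name_of C f = p (expo C (Dom C g) (Cod C g)) \<cdot> name_of C g"
  using assms unfolding homotopic_def by metis+

lemma homotopic_refl: "f \<in> Arr C \<Longrightarrow> homotopic C p f f"
  by (simp add: homotopic_def)

lemma homotopic_sym: "homotopic C p f g \<Longrightarrow> homotopic C p g f"
  unfolding homotopic_def by metis

lemma homotopic_trans: "homotopic C p f g \<Longrightarrow> homotopic C p g h \<Longrightarrow> homotopic C p f h"
  unfolding homotopic_def by metis

text \<open>Naturality of \<open>p\<close> at \<open>t\<close> carries the equation between the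
  images of the names from one exponential to the other. Closure of homotopy under an operation is
  thereby reduced to an arrow \<open>t\<close> that performs the operation on names.\<close>

lemma homotopic_transfer:
  assumes h: "homotopic C p f g"
    and t: "t \<in> Arr C" "Dom C t = expo C (Dom C f) (Cod C f)" "Cod C t = expo C X Y"
    and f: "f' \<in> Arr C" "Dom C f' = X" "Cod C f' = Y" "t \<cdot> name_of C f = name_of C f'"
    and g: "g' \<in> Arr C" "Dom C g' = X" "Cod C g' = Y" "t \<cdot> name_of C g = name_of C g'"
  shows "homotopic C p f' g'"
proof -
  let ?E = "expo C (Dom C g) (Cod C g)"
  have [simp]: "X \<in> Obj C" "Y \<in> Obj C" using f by auto
  note [simp] = homotopicD(1-4)[OF h] t
  have "p (expo C X Y) \<cdot> (t \<cdot> z) = AMap P t \<cdot> (p ?E \<cdot> z)" if "z \<in> Arr C" "Cod C z = ?E" for z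
    using Comp_eq_extend[OF p_natural[OF t], of z] that by simp
  from this[of "name_of C f"] this[of "name_of C g"]
  have "p (expo C X Y) \<cdot> name_of C f' = p (expo C X Y) \<cdot> name_of C g'"
    using homotopicD(5)[OF h] f(4) g(4) by simp
  then show ?thesis using f g by (intro homotopicI) auto
qed

lemma name_eqI:
  assumes "k \<in> Arr C" "Dom C k = one C" "Cod C k = expo C X Y" "f \<in> Arr C" "Dom C f = X" "Cod C f = Y"
    "eval C X Y \<cdot> pairing C (k \<cdot> pr1 C (one C) X) (pr2 C (one C) X) = f \<cdot> pr2 C (one C) X"
  shows "k = name_of C f"
proof -
  have "X \<in> Obj C" "Y \<in> Obj C" using assms by auto
  then show ?thesis using assms by (intro expo_ext[of k "name_of C f" "one C" X Y]) auto
qed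

text \<open>Composition with \<open>u\<close> made internal: the arrow \<open>u^X\<close> between
  exponentials.\<close>

definition postcomp where
  "postcomp X u = transpose C (expo C X (Dom C u)) X (Cod C u) (u \<cdot> eval C X (Dom C u))"

lemma postcomp_simps [simp]:
  assumes "u \<in> Arr C" "X \<in> Obj C"
  shows "postcomp X u \<in> Arr C" "Dom C (postcomp X u) = expo C X (Dom C u)"
    "Cod C (postcomp X u) = expo C X (Cod C u)"
  using assms by (auto simp: postcomp_def)

lemma eval_postcomp [simp]:
  assumes "u \<in> Arr C" "X \<in> Obj C" "Cod C u = Z" "a \<in> Arr C" "x \<in> Arr C" "Dom C a = Dom C x"
    "Cod C a = expo C X (Dom C u)" "Cod C x = X"
  shows "eval C X Z \<cdot> pairing C (postcomp X u \<cdot> a) x = u \<cdot> (eval C X (Dom C u) \<cdot> pairing C a x)"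
proof -
  have "Z \<in> Obj C" using assms by auto
  then show ?thesis using assms by (simp add: postcomp_def)
qed

lemma postcomp_name:
  assumes "u \<in> Arr C" "f \<in> Arr C" "Cod C f = Dom C u" "Dom C f = X"
  shows "postcomp X u \<cdot> name_of C f = name_of C (u \<cdot> f)"
proof -
  have "X \<in> Obj C" using assms by auto
  then show ?thesis using assms by (intro name_eqI) auto
qed

lemma homotopic_postcomp:
  assumes "homotopic C p f g" "u \<in> Arr C" "Dom C u = Cod C g"
  shows "homotopic C p (u \<cdot> f) (u \<cdot> g)"
  by (rule homotopic_transfer[OF assms(1), of "postcomp (Dom C f) u"])
    (use assms homotopicD[OF assms(1)] in \<open>auto simp: postcomp_name\<close>)

lemma homotopic_precomp:
  assumes h: "homotopic C p f g" and v: "v \<in> Arr C" "Cod C v = Dom C g"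
  shows "homotopic C p (f \<cdot> v) (g \<cdot> v)"
proof -
  let ?X = "Dom C g" and ?Y = "Cod C g" and ?W = "Dom C v"
  note [simp] = homotopicD(1-4)[OF h] v
  \<comment> \<open>Precomposition with \<open>v\<close> made internal: the arrow
    \<open>Y^v : Y^X -> Y^W\<close>.\<close>
  let ?t = "transpose C (expo C ?X ?Y) ?W ?Y (eval C ?X ?Y \<cdot>
    pairing C (pr1 C (expo C ?X ?Y) ?W) (v \<cdot> pr2 C (expo C ?X ?Y) ?W))"
  have "?t \<cdot> name_of C f' = name_of C (f' \<cdot> v)" if "f' \<in> Arr C" "Dom C f' = ?X" "Cod C f' = ?Y" for f'
    using that by (intro name_eqI[of _ ?W ?Y]) auto
  then show ?thesis by (intro homotopic_transfer[OF h, of ?t ?W ?Y]) auto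
qed

lemma homotopic_comp:
  assumes f: "homotopic C p f f'" and g: "homotopic C p g g'" and "Dom C g = Cod C f"
  shows "homotopic C p (g \<cdot> f) (g' \<cdot> f')"
  by (rule homotopic_trans[OF homotopic_postcomp[OF f] homotopic_precomp[OF g]])
    (use assms(3) homotopicD[OF f] homotopicD[OF g] in auto)

section \<open>Compatibility of homotopy with products and exponentials\<close>

text \<open>The functor \<open>(-)^X\<close> is a right adjoint and keeps products. The projections
  are expressed by \<open>postcomp\<close>, whose effect on names is known.\<close>

lemma expo_prod_is_product:
  assumes [simp]: "X \<in> Obj C" "A \<in> Obj C" "B \<in> Obj C"
  shows "is_product C (expo C X A) (expo C X B) (expo C X (prod C A B))
    (postcomp X (pr1 C A B)) (postcomp X (pr2 C A B))"
proof (rule productI)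
  fix f g assume fg [simp]: "f \<in> Arr C" "g \<in> Arr C" "Cod C f = expo C X A" "Cod C g = expo C X B"
    "Dom C f = Dom C g"
  let ?V = "Dom C g"
  let ?u = "\<lambda>f Y. eval C X Y \<cdot> pairing C (f \<cdot> pr1 C ?V X) (pr2 C ?V X)"
  \<comment> \<open>The transpose of the pointwise pair of \<open>f\<close> and
    \<open>g\<close>.\<close>
  let ?h = "transpose C ?V X (prod C A B) (pairing C (?u f A) (?u g B))"
  have "postcomp X (pr1 C A B) \<cdot> ?h = f" by (rule expo_ext[of _ _ ?V X A]) auto
  moreover have "postcomp X (pr2 C A B) \<cdot> ?h = g" by (rule expo_ext[of _ _ ?V X B]) auto
  ultimately show "\<exists>h\<in>Arr C. Dom C h = Dom C f \<and> Cod C h = expo C X (prod C A B) \<and>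
    postcomp X (pr1 C A B) \<cdot> h = f \<and> postcomp X (pr2 C A B) \<cdot> h = g"
    by (intro bexI[of _ ?h]) auto
next
  fix h h' assume h [simp]: "h \<in> Arr C" "h' \<in> Arr C" "Cod C h = expo C X (prod C A B)"
    "Cod C h' = expo C X (prod C A B)" "Dom C h = Dom C h'"
    and e: "postcomp X (pr1 C A B) \<cdot> h = postcomp X (pr1 C A B) \<cdot> h'"
    "postcomp X (pr2 C A B) \<cdot> h = postcomp X (pr2 C A B) \<cdot> h'"
  let ?V = "Dom C h'"
  let ?u = "\<lambda>h. eval C X (prod C A B) \<cdot> pairing C (h \<cdot> pr1 C ?V X) (pr2 C ?V X)"
  have u: "pr1 C A B \<cdot> ?u k = eval C X A \<cdot> pairing C ((postcomp X (pr1 C A B) \<cdot> k) \<cdot> pr1 C ?V X) (pr2 C ?V X)"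
    "pr2 C A B \<cdot> ?u k = eval C X B \<cdot> pairing C ((postcomp X (pr2 C A B) \<cdot> k) \<cdot> pr1 C ?V X) (pr2 C ?V X)"
    if "k \<in> Arr C" "Dom C k = ?V" "Cod C k = expo C X (prod C A B)" for k
    using that by simp_all
  have "pr1 C A B \<cdot> ?u h = pr1 C A B \<cdot> ?u h'" "pr2 C A B \<cdot> ?u h = pr2 C A B \<cdot> ?u h'"
    using u[of h] u[of h'] e by (simp_all del: eval_postcomp)
  then have "?u h = ?u h'" by (intro prod_ext[of "?u h" "?u h'" A B]) auto
  then show "h = h'" by (intro expo_ext[of h h' ?V X "prod C A B"]) auto
qed (auto simp: Hom_iff)

text \<open>\<open>P\<close> turns the product cone of exponentials into a product, so the image
  under \<open>p\<close> of the name of an arrow into \<open>A \<times> B\<close> is determined by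
  its two projections; by naturality these are the images of the names of the components.\<close>

lemma homotopic_prod_ext:
  assumes h: "h \<in> Arr C" "h' \<in> Arr C" "Cod C h = prod C A B" "Cod C h' = prod C A B" "Dom C h = Dom C h'"
    and AB: "A \<in> Obj C" "B \<in> Obj C"
    and 1: "homotopic C p (pr1 C A B \<cdot> h) (pr1 C A B \<cdot> h')"
    and 2: "homotopic C p (pr2 C A B \<cdot> h) (pr2 C A B \<cdot> h')"
  shows "homotopic C p h h'"
proof -
  note [simp] = h AB
  let ?X = "Dom C h'" and ?Q = "prod C A B"
  have n: "AMap P (postcomp ?X u) \<cdot> (p (expo C ?X ?Q) \<cdot> name_of C k) = p (expo C ?X (Cod C u)) \<cdot> name_of C (u \<cdot> k)"
    if "u \<in> Arr C" "Dom C u = ?Q" "k \<in> Arr C" "Cod C k = ?Q" "Dom C k = ?X" for u k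
    using Comp_eq_extend[OF p_natural[of "postcomp ?X u"], of "expo C ?X ?Q" "expo C ?X (Cod C u)" "name_of C k"]
      postcomp_name[of u k ?X] that by simp
  have "p (expo C ?X ?Q) \<cdot> name_of C h = p (expo C ?X ?Q) \<cdot> name_of C h'"
    by (rule product_unique[OF P_product[OF expo_prod_is_product[of ?X A B]]])
      (use homotopicD(5)[OF 1] homotopicD(5)[OF 2] in \<open>simp_all add: n\<close>)
  then show ?thesis by (intro homotopicI) auto
qed

lemma homotopic_pairing:
  assumes f: "homotopic C p f f'" and g: "homotopic C p g g'" and "Dom C f = Dom C g"
  shows "homotopic C p (pairing C f g) (pairing C f' g')"
  by (rule homotopic_prod_ext[of _ _ "Cod C f" "Cod C g"])
    (use assms homotopicD[OF f] homotopicD[OF g] in auto)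

lemma homotopic_transpose:
  assumes h: "homotopic C p f g" and d: "Dom C f = prod C A X" "Cod C f = Y" "A \<in> Obj C" "X \<in> Obj C"
  shows "homotopic C p (transpose C A X Y f) (transpose C A X Y g)"
proof -
  note [simp] = d(3,4) homotopicD(1,2)[OF h]
  have [simp]: "Dom C f = prod C A X" "Cod C f = Y" "Dom C g = prod C A X" "Cod C g = Y"
    using d homotopicD(3,4)[OF h] by auto
  have [simp]: "Y \<in> Obj C" using Arr_closed(2)[of f] by simp
  let ?E = "expo C (prod C A X) Y"
  let ?EA = "prod C ?E A"
  \<comment> \<open>\<open>?t\<close> is the currying arrow
    \<open>Y^(A \<times> X) -> (Y^X)^A\<close>, obtained by transposing the evaluation twice; it
    takes the name of \<open>k\<close> to the name of its transpose.\<close>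
  let ?s = "transpose C ?EA X Y (eval C (prod C A X) Y \<cdot> pairing C (pr1 C ?E A \<cdot> pr1 C ?EA X)
      (pairing C (pr2 C ?E A \<cdot> pr1 C ?EA X) (pr2 C ?EA X)))"
  let ?t = "transpose C ?E A (expo C X Y) ?s"
  have "?t \<cdot> name_of C k = name_of C (transpose C A X Y k)"
    if [simp]: "k \<in> Arr C" "Dom C k = prod C A X" "Cod C k = Y" for k
  proof (rule name_eqI)
    let ?k = "transpose C A X Y k"
    show "eval C A (expo C X Y) \<cdot> pairing C ((?t \<cdot> name_of C k) \<cdot> pr1 C (one C) A) (pr2 C (one C) A)
       = ?k \<cdot> pr2 C (one C) A"
      by (rule expo_ext[of _ _ "prod C (one C) A" X Y]) auto
  qed auto
  then show ?thesis by (intro homotopic_transfer[OF h, of ?t A "expo C X Y"]) auto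
qed

lemma P_homotopic:
  assumes h: "homotopic C p f g"
  shows "AMap P f = AMap P g"
proof -
  let ?X = "Dom C g" and ?Y = "Cod C g"
  let ?E = "expo C ?X ?Y"
  note [simp] = homotopicD(1-4)[OF h]
  have T: "is_terminal C (OMap P (one C))"
    using homotopy_theory one_terminal by (simp add: homotopy_theory_def preserves_finite_products_def)
  \<comment> \<open>As \<open>P 1\<close> is terminal, its arrow to \<open>1\<close> is a section of
    \<open>p\<close> at \<open>1\<close>. Naturality then expresses \<open>P\<close> of a name
    through \<open>p\<close> applied to that name, which is exactly what homotopy controls.\<close>
  have s: "p (one C) \<cdot> bang (OMap P (one C)) = Ide C (OMap P (one C))"
    by (rule terminal_unique[OF T]) auto
  have n: "AMap P (name_of C k) = (p ?E \<cdot> name_of C k) \<cdot> bang (OMap P (one C))"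
    if "k \<in> Arr C" "Dom C k = ?X" "Cod C k = ?Y" for k
  proof -
    have "AMap P (name_of C k) = AMap P (name_of C k) \<cdot> (p (one C) \<cdot> bang (OMap P (one C)))"
      using that by (simp add: s)
    then show ?thesis
      using Comp_eq_extend[OF p_natural[of "name_of C k" "one C" ?E], of "bang (OMap P (one C))"] that by simp
  qed
  have N: "AMap P (name_of C f) = AMap P (name_of C g)"
    using n[of f] n[of g] homotopicD(5)[OF h] by simp
  \<comment> \<open>\<open>k\<close> is evaluation after \<open>?m k\<close>, and \<open>P\<close>
    of \<open>?m k\<close> is determined by its projections because \<open>P\<close> keeps the
    product of the exponential with the domain.\<close>
  let ?m = "\<lambda>k. pairing C (name_of C k \<cdot> bang ?X) (Ide C ?X)"
  have m: "AMap P (pr1 C ?E ?X) \<cdot> AMap P (?m k) = AMap P (name_of C k) \<cdot> AMap P (bang ?X)"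
    "AMap P (pr2 C ?E ?X) \<cdot> AMap P (?m k) = Ide C (OMap P ?X)" "?m k \<in> Arr C" "Dom C (?m k) = ?X"
    "Cod C (?m k) = prod C ?E ?X" "AMap P k = AMap P (eval C ?X ?Y) \<cdot> AMap P (?m k)"
    if k: "k \<in> Arr C" "Dom C k = ?X" "Cod C k = ?Y" for k
  proof -
    show a: "?m k \<in> Arr C" "Dom C (?m k) = ?X" "Cod C (?m k) = prod C ?E ?X" using k by simp_all
    have "AMap P (pr1 C ?E ?X) \<cdot> AMap P (?m k) = AMap P (pr1 C ?E ?X \<cdot> ?m k)"
      using a by (subst P_simps(6)) auto
    then show "AMap P (pr1 C ?E ?X) \<cdot> AMap P (?m k) = AMap P (name_of C k) \<cdot> AMap P (bang ?X)"
      using k by simp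
    have "AMap P (pr2 C ?E ?X) \<cdot> AMap P (?m k) = AMap P (pr2 C ?E ?X \<cdot> ?m k)"
      using a by (subst P_simps(6)) auto
    then show "AMap P (pr2 C ?E ?X) \<cdot> AMap P (?m k) = Ide C (OMap P ?X)" using k by simp
    have "AMap P (eval C ?X ?Y) \<cdot> AMap P (?m k) = AMap P (eval C ?X ?Y \<cdot> ?m k)"
      using a by (subst P_simps(6)) auto
    then show "AMap P k = AMap P (eval C ?X ?Y) \<cdot> AMap P (?m k)" using k by simp
  qed
  have "AMap P (?m f) = AMap P (?m g)"
    by (rule product_unique[OF P_product[OF prod_is_product[of ?E ?X]]])
      (use m[of f] m[of g] N in simp_all)
  then show ?thesis using m(6)[of f] m(6)[of g] by simp
qed

section \<open>The homotopy category is cartesian closed\<close>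

abbreviation H where "H \<equiv> homotopy_category C p"
abbreviation cls where "cls \<equiv> hclass C p"

lemma cls_eq_iff: "f \<in> Arr C \<Longrightarrow> cls f = cls g \<longleftrightarrow> homotopic C p f g"
  unfolding hclass_def by (auto intro: homotopic_refl homotopic_sym homotopic_trans)

lemma some_cls:
  assumes "f \<in> Arr C"
  shows "homotopic C p f (SOME g. g \<in> cls f)"
proof -
  have "f \<in> cls f" using assms by (simp add: hclass_def homotopic_refl)
  from someI[of "\<lambda>g. g \<in> cls f", OF this] show ?thesis by (simp add: hclass_def)
qed

lemma H_simps [simp]:
  "Obj H = Obj C"
  "f \<in> Arr C \<Longrightarrow> cls f \<in> Arr H"
  "f \<in> Arr C \<Longrightarrow> Dom H (cls f) = Dom C f"
  "f \<in> Arr C \<Longrightarrow> Cod H (cls f) = Cod C f"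
  "Ide H X = cls (Ide C X)"
  using homotopicD(3,4)[OF some_cls, of f] by (simp_all add: homotopy_category_def)

lemma H_ArrE:
  assumes "F \<in> Arr H"
  obtains f where "f \<in> Arr C" "F = cls f"
  using assms by (auto simp: homotopy_category_def)

text \<open>By congruence all the classes in the union that defines composition coincide, and the
  index sets are nonempty, so the union collapses to one class.\<close>

lemma H_Comp [simp]:
  assumes "f \<in> Arr C" "g \<in> Arr C" "Dom C g = Cod C f"
  shows "cls g \<cdot>\<^bsub>H\<^esub> cls f = cls (g \<cdot> f)"
proof -
  have *: "cls (g' \<cdot> f') = cls (g \<cdot> f)" if "f' \<in> cls f" "g' \<in> cls g" for f' g'
  proof -
    have "homotopic C p (g \<cdot> f) (g' \<cdot> f')"
      using that assms by (intro homotopic_comp) (auto simp: hclass_def)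
    then show ?thesis using assms by (subst (asm) cls_eq_iff[symmetric]) auto
  qed
  have "f \<in> cls f" "g \<in> cls g" using assms by (simp_all add: hclass_def homotopic_refl)
  have "cls g \<cdot>\<^bsub>H\<^esub> cls f = (\<Union>g'\<in>cls g. \<Union>f'\<in>cls f. cls (g' \<cdot> f'))"
    by (simp add: homotopy_category_def)
  also have "\<dots> = (\<Union>g'\<in>cls g. \<Union>f'\<in>cls f. cls (g \<cdot> f))"
    by (intro SUP_cong refl *)
  also have "\<dots> = cls (g \<cdot> f)" using \<open>f \<in> cls f\<close> \<open>g \<in> cls g\<close> by blast
  finally show ?thesis .
qed

lemma H_Hom: "Hom H X Y = cls ` Hom C X Y"
proof (intro equalityI subsetI)
  fix F assume F: "F \<in> Hom H X Y"
  then have "F \<in> Arr H" by (simp add: Hom_def)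
  then obtain f where f: "f \<in> Arr C" "F = cls f" by (rule H_ArrE)
  then have "f \<in> Hom C X Y" using F H_simps(3,4)[OF f(1)] by (simp add: Hom_def)
  then show "F \<in> cls ` Hom C X Y" using f(2) by blast
qed (auto simp: Hom_def)

lemma H_HomE:
  assumes "F \<in> Hom H X Y"
  obtains f where "f \<in> Arr C" "Dom C f = X" "Cod C f = Y" "F = cls f"
  using assms by (auto simp: H_Hom Hom_iff)

lemma H_category: "category H"
proof
  show "F \<in> Arr H \<Longrightarrow> Dom H F \<in> Obj H" "F \<in> Arr H \<Longrightarrow> Cod H F \<in> Obj H" for F
    by (auto elim!: H_ArrE)
  show "X \<in> Obj H \<Longrightarrow> Ide H X \<in> Hom H X X" for X
    by (simp add: H_Hom Ide_in_Hom)
  show "G \<cdot>\<^bsub>H\<^esub> F \<in> Hom H X Z" if "F \<in> Hom H X Y" "G \<in> Hom H Y Z" for F G X Y Z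
    using that by (elim H_HomE) (simp add: Hom_def)
  show "F \<cdot>\<^bsub>H\<^esub> Ide H X = F" "Ide H Y \<cdot>\<^bsub>H\<^esub> F = F" if "F \<in> Hom H X Y" for F X Y
    using that by (auto elim!: H_HomE)
  show "K \<cdot>\<^bsub>H\<^esub> (G \<cdot>\<^bsub>H\<^esub> F) = (K \<cdot>\<^bsub>H\<^esub> G) \<cdot>\<^bsub>H\<^esub> F"
    if "F \<in> Hom H W X" "G \<in> Hom H X Y" "K \<in> Hom H Y Z" for F G K W X Y Z
    using that by (elim H_HomE) simp
qed

lemma H_terminal: "is_terminal H (one C)"
  unfolding is_terminal_def
proof (intro conjI ballI)
  fix X assume "X \<in> Obj H"
  then have [simp]: "X \<in> Obj C" by simp
  show "\<exists>!F. F \<in> Hom H X (one C)"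
  proof (rule ex1I[of _ "cls (bang X)"])
    show "cls (bang X) \<in> Hom H X (one C)" by (simp add: Hom_def)
    fix F assume "F \<in> Hom H X (one C)"
    then show "F = cls (bang X)" using bang_eq by (elim H_HomE) auto
  qed
qed simp

lemma H_product:
  assumes [simp]: "A \<in> Obj C" "B \<in> Obj C"
  shows "is_product H A B (prod C A B) (cls (pr1 C A B)) (cls (pr2 C A B))"
proof (rule category.productI[OF H_category])
  fix F G assume FG: "F \<in> Arr H" "G \<in> Arr H" "Cod H F = A" "Cod H G = B" "Dom H F = Dom H G"
  obtain f g where f: "f \<in> Arr C" "F = cls f" and g: "g \<in> Arr C" "G = cls g"
    using FG by (meson H_ArrE)
  show "\<exists>K\<in>Arr H. Dom H K = Dom H F \<and> Cod H K = prod C A B \<and>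
     cls (pr1 C A B) \<cdot>\<^bsub>H\<^esub> K = F \<and> cls (pr2 C A B) \<cdot>\<^bsub>H\<^esub> K = G"
    using FG f g by (intro bexI[of _ "cls (pairing C f g)"]) auto
next
  fix F G assume FG: "F \<in> Arr H" "G \<in> Arr H" "Cod H F = prod C A B" "Cod H G = prod C A B"
    "Dom H F = Dom H G" "cls (pr1 C A B) \<cdot>\<^bsub>H\<^esub> F = cls (pr1 C A B) \<cdot>\<^bsub>H\<^esub> G"
    "cls (pr2 C A B) \<cdot>\<^bsub>H\<^esub> F = cls (pr2 C A B) \<cdot>\<^bsub>H\<^esub> G"
  obtain f g where f: "f \<in> Arr C" "F = cls f" and g: "g \<in> Arr C" "G = cls g"
    using FG by (meson H_ArrE)
  have "homotopic C p f g"
    by (rule homotopic_prod_ext[of _ _ A B]) (use FG f g in \<open>auto simp: cls_eq_iff\<close>)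
  then show "F = G" using f g by (simp add: cls_eq_iff)
qed (auto simp: Hom_def)

lemma H_finite_product_category: "finite_product_category H"
proof (intro finite_product_category.intro finite_product_category_axioms.intro H_category)
  show "has_finite_products H"
    unfolding has_finite_products_def using H_terminal H_product H_simps(1) by metis
qed

text \<open>Existence transposes a representative. For uniqueness, \<open>m\<close> is homotopic to
  \<open>k \<times> id\<close> because their projections are, and homotopic arrows have homotopic
  transposes.\<close>

lemma H_exponential:
  assumes [simp]: "X \<in> Obj C" "Y \<in> Obj C"
  shows "\<exists>e. is_exponential H X Y (expo C X Y) e"
proof (rule finite_product_category.exponential_from_product[OF H_finite_product_category])
  let ?Z = "expo C X Y"
  show "is_product H ?Z X (prod C ?Z X) (cls (pr1 C ?Z X)) (cls (pr2 C ?Z X))" by (simp add: H_product)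
  show "cls (eval C X Y) \<in> Hom H (prod C ?Z X) Y" by (simp add: Hom_def)
  fix A assume "A \<in> Obj H"
  then have [simp]: "A \<in> Obj C" by simp
  let ?Q = "prod C A X" and ?c = "pr1 C A X" and ?d = "pr2 C A X"
  have "\<exists>!K. K \<in> Hom H A ?Z \<and> (\<exists>M\<in>Hom H ?Q (prod C ?Z X). cls (pr1 C ?Z X) \<cdot>\<^bsub>H\<^esub> M = K \<cdot>\<^bsub>H\<^esub> cls ?c \<and>
        cls (pr2 C ?Z X) \<cdot>\<^bsub>H\<^esub> M = cls ?d \<and> cls (eval C X Y) \<cdot>\<^bsub>H\<^esub> M = F)"
    if F: "F \<in> Hom H ?Q Y" for F
  proof -
    obtain f where f: "f \<in> Arr C" "Dom C f = ?Q" "Cod C f = Y" "F = cls f"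
      using F by (rule H_HomE)
    let ?k = "transpose C A X Y f"
    show ?thesis
    proof (rule ex1I[of _ "cls ?k"], intro conjI bexI[of _ "cls (pairing C (?k \<cdot> ?c) ?d)"])
      fix K assume K: "K \<in> Hom H A ?Z \<and> (\<exists>M\<in>Hom H ?Q (prod C ?Z X). cls (pr1 C ?Z X) \<cdot>\<^bsub>H\<^esub> M = K \<cdot>\<^bsub>H\<^esub> cls ?c \<and>
        cls (pr2 C ?Z X) \<cdot>\<^bsub>H\<^esub> M = cls ?d \<and> cls (eval C X Y) \<cdot>\<^bsub>H\<^esub> M = F)"
      then obtain k where k: "k \<in> Arr C" "Dom C k = A" "Cod C k = ?Z" "K = cls k"
        by (meson H_HomE)
      obtain M where M: "M \<in> Hom H ?Q (prod C ?Z X)" "cls (pr1 C ?Z X) \<cdot>\<^bsub>H\<^esub> M = K \<cdot>\<^bsub>H\<^esub> cls ?c"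
        "cls (pr2 C ?Z X) \<cdot>\<^bsub>H\<^esub> M = cls ?d" "cls (eval C X Y) \<cdot>\<^bsub>H\<^esub> M = F" using K by blast
      obtain m where m: "m \<in> Arr C" "Dom C m = ?Q" "Cod C m = prod C ?Z X" "M = cls m"
        using M(1) by (rule H_HomE)
      let ?m = "pairing C (k \<cdot> ?c) ?d"
      have "homotopic C p m ?m"
        by (rule homotopic_prod_ext[of _ _ ?Z X]) (use M(2,3) m k in \<open>auto simp: cls_eq_iff\<close>)
      then have "homotopic C p (eval C X Y \<cdot> m) (eval C X Y \<cdot> ?m)"
        using k by (intro homotopic_postcomp) auto
      moreover have "homotopic C p (eval C X Y \<cdot> m) f" using M(4) m f by (simp add: cls_eq_iff)
      ultimately have "homotopic C p f (eval C X Y \<cdot> ?m)"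
        by (blast intro: homotopic_sym homotopic_trans)
      then have "homotopic C p ?k (transpose C A X Y (eval C X Y \<cdot> ?m))"
        using f by (intro homotopic_transpose) auto
      also have "transpose C A X Y (eval C X Y \<cdot> ?m) = k"
        by (rule expo_ext[of _ _ A X Y]) (use k in auto)
      finally show "K = cls ?k" using k f by (simp add: cls_eq_iff homotopic_sym)
    qed (use f in \<open>auto simp: Hom_def\<close>)
  qed
  then show "\<exists>Q c d. is_product H A X Q c d \<and> (\<forall>F\<in>Hom H Q Y. \<exists>!K. K \<in> Hom H A ?Z \<and>
     (\<exists>M\<in>Hom H Q (prod C ?Z X). cls (pr1 C ?Z X) \<cdot>\<^bsub>H\<^esub> M = K \<cdot>\<^bsub>H\<^esub> c \<and>
        cls (pr2 C ?Z X) \<cdot>\<^bsub>H\<^esub> M = d \<and> cls (eval C X Y) \<cdot>\<^bsub>H\<^esub> M = F))"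
    using H_product[of A X] by (intro exI[of _ ?Q] exI[of _ ?c] exI[of _ "cls ?c"] exI[of _ "cls ?d"]) auto
qed simp_all

lemma H_cartesian_closed: "cartesian_closed H"
  unfolding cartesian_closed_def
  using H_category finite_product_category.finite_products[OF H_finite_product_category] H_exponential
  by (metis H_simps(1))

text \<open>\<open>expo H\<close> is an arbitrary choice, tied to the base exponential only by
  uniqueness up to isomorphism.\<close>

lemma H_expo_isomorphic:
  assumes [simp]: "X \<in> Obj C" "Y \<in> Obj C"
  shows "isomorphic H (expo H X Y) (expo C X Y)"
proof -
  interpret H: cartesian_closed_category H
    by (intro cartesian_closed_category.intro cartesian_closed_category_axioms.intro H_finite_product_category)
      (metis H_exponential H_simps(1))
  obtain e where "is_exponential H X Y (expo C X Y) e" using H_exponential[OF assms] by blast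
  then show ?thesis using H.exponential_unique[OF H.expo_is_exponential] by simp
qed

text \<open>\<open>preserves_finite_products\<close> ranges over all product cones of
  \<open>H\<close>. Such a cone is compared with the chosen product of the base by representatives
  \<open>pairing C f g\<close> and \<open>t\<close>, mutually inverse up to homotopy.\<close>

lemma H_product_iso:
  assumes Q: "is_product H A B Q F G"
  obtains f g t where "f \<in> Arr C" "g \<in> Arr C" "Cod C f = A" "Cod C g = B" "Dom C f = Q" "Dom C g = Q"
    "F = cls f" "G = cls g" "t \<in> Arr C" "Dom C t = prod C A B" "Cod C t = Q"
    "cls (pairing C f g \<cdot> t) = cls (Ide C (prod C A B))" "cls (t \<cdot> pairing C f g) = cls (Ide C Q)"
proof -
  obtain f g where f: "f \<in> Arr C" "F = cls f" and g: "g \<in> Arr C" "G = cls g"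
    using category.product_simps(1,2)[OF H_category Q] by (elim H_ArrE)
  note FG = category.product_simps[OF H_category Q, unfolded f(2) g(2)]
  have [simp]: "Dom C f = Q" "Dom C g = Q" "Cod C f = A" "Cod C g = B"
    using FG(3-6) f(1) g(1) by simp_all
  have [simp]: "A \<in> Obj C" "B \<in> Obj C" "Q \<in> Obj C"
    using Arr_closed[of f] Arr_closed[of g] f(1) g(1) by auto
  obtain T where T: "T \<in> Arr H" "Dom H T = prod C A B" "Cod H T = Q"
    "F \<cdot>\<^bsub>H\<^esub> T = cls (pr1 C A B)" "G \<cdot>\<^bsub>H\<^esub> T = cls (pr2 C A B)"
    by (rule category.product_exists[OF H_category Q, of "cls (pr1 C A B)" "cls (pr2 C A B)"]) auto
  obtain t where t: "t \<in> Arr C" "T = cls t" using T(1) by (rule H_ArrE)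
  have [simp]: "Dom C t = prod C A B" "Cod C t = Q" using T(2,3) t(1) unfolding t(2) by simp_all
  have ft: "homotopic C p (f \<cdot> t) (pr1 C A B)" "homotopic C p (g \<cdot> t) (pr2 C A B)"
    using T(4,5) f(1) g(1) t(1) unfolding f(2) g(2) t(2) by (simp_all add: cls_eq_iff)
  have "homotopic C p (pairing C f g \<cdot> t) (pairing C (pr1 C A B) (pr2 C A B))"
    using homotopic_pairing[OF ft] f(1) g(1) t(1) by simp
  then have 1: "cls (pairing C f g \<cdot> t) = cls (Ide C (prod C A B))"
    using f(1) g(1) t(1) by (simp add: cls_eq_iff)
  have fg: "homotopic C p (f \<cdot> t \<cdot> pairing C f g) f" "homotopic C p (g \<cdot> t \<cdot> pairing C f g) g"
    using homotopic_precomp[OF ft(1), of "pairing C f g"] homotopic_precomp[OF ft(2), of "pairing C f g"] f(1) g(1) t(1)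
    by simp_all
  have "cls (t \<cdot> pairing C f g) = cls (Ide C Q)"
    by (rule category.product_unique[OF H_category Q]) (use f(1) g(1) t(1) fg in \<open>simp_all add: cls_eq_iff f(2) g(2)\<close>)
  with 1 show ?thesis using that[of f g t] f g t(1) by simp
qed

end

section \<open>The adjunction\<close>

context decidable_reflection
begin

sublocale homotopy C "inclusion \<circ>\<^sub>F \<Pi>" p
  by unfold_locales (rule unit_homotopy_theory)

lemma \<Pi>_homotopic: "homotopic C p f g \<Longrightarrow> AMap \<Pi> f = AMap \<Pi> g"
  using P_homotopic by (simp add: comp_functor_def id_functor_def)

section \<open>Homotopy of arrows into decidable objects\<close>

text \<open>The identity of a decidable object extends along its unit, which is therefore
  split.\<close>

lemma unit_mono:
  assumes "decidable C Y"
  shows "is_mono C (p Y)"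
proof -
  note [simp] = decidable_Obj[OF assms]
  obtain r where "r \<in> Arr C" "Dom C r = OMap \<Pi> Y" "Cod C r = Y" "r \<cdot> p Y = Ide C Y"
    using reflection_exists[of "Ide C Y"] assms by auto
  then show ?thesis by (intro split_mono[of _ r]) auto
qed

text \<open>Homotopic arrows have the same image under \<Pi>; by naturality they agree after the
  unit of the codomain, which is monic.\<close>

lemma homotopic_decidable_eq:
  assumes h: "homotopic C p f g" and Y: "decidable C (Cod C g)"
  shows "f = g"
proof -
  note fg = homotopicD(1-4)[OF h]
  have "p (Cod C g) \<cdot> f = p (Cod C g) \<cdot> g"
    using unit_natural[of f "Dom C g" "Cod C g"] unit_natural[of g "Dom C g" "Cod C g"]
      \<Pi>_homotopic[OF h] fg by simp
  from mono_cancel[OF unit_mono[OF Y] this] show ?thesis using fg by simp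
qed

lemma Dec_Hom_iff:
  "f \<in> Hom (Dec C) X Y \<longleftrightarrow> decidable C X \<and> decidable C Y \<and> f \<in> Hom C X Y"
  by (auto simp: Dec_def full_subcategory_def Hom_def)

lemma Dec_category: "category (Dec C)"
proof
  show "f \<in> Arr (Dec C) \<Longrightarrow> Dom (Dec C) f \<in> Obj (Dec C)" "f \<in> Arr (Dec C) \<Longrightarrow> Cod (Dec C) f \<in> Obj (Dec C)"
    for f by (auto simp: Dec_def full_subcategory_def)
  show "X \<in> Obj (Dec C) \<Longrightarrow> Ide (Dec C) X \<in> Hom (Dec C) X X" for X
    by (simp add: Dec_Hom_iff Dec_simps decidable_Obj Ide_in_Hom)
qed (auto simp: Dec_Hom_iff Dec_simps Hom_iff)

lemma Dec_product:
  assumes P: "is_product C A B P a b" and "decidable C A" "decidable C B" "decidable C P"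
  shows "is_product (Dec C) A B P a b"
  using assms unfolding is_product_def
  by (simp add: Dec_Hom_iff Dec_simps decidable_Obj)

lemma Dec_terminal:
  assumes "is_terminal C T" "decidable C T"
  shows "is_terminal (Dec C) T"
  using assms unfolding is_terminal_def
  by (simp add: Dec_Hom_iff Dec_simps decidable_Obj)

section \<open>The adjoint functors between the homotopy category and \<open>Dec\<close>\<close>

text \<open>The value on a class is read off a chosen member; \<open>\<Pi>_homotopic\<close> makes
  the choice immaterial.\<close>

definition q_shriek :: "('a, 'b set, 'a, 'b) cfunctor" where
  "q_shriek = \<lparr>OMap = OMap \<Pi>, AMap = (\<lambda>F. AMap \<Pi> (SOME f. f \<in> F))\<rparr>"

lemma q_shriek_simps [simp]:
  "OMap q_shriek X = OMap \<Pi> X"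
  "f \<in> Arr C \<Longrightarrow> AMap q_shriek (cls f) = AMap \<Pi> f"
  using \<Pi>_homotopic[OF some_cls, of f] by (simp_all add: q_shriek_def)

lemma quotient_functor_simps [simp]:
  "OMap (quotient_functor C p) X = X" "AMap (quotient_functor C p) f = cls f"
  by (simp_all add: quotient_functor_def)

lemma q_shriek_is_functor: "is_functor H (Dec C) q_shriek"
  unfolding is_functor_def
proof (intro conjI ballI allI)
  show "AMap q_shriek F \<in> Hom (Dec C) (OMap q_shriek X) (OMap q_shriek Y)" if "F \<in> Hom H X Y" for X Y F
    using that
  proof (rule H_HomE)
    fix f assume f: "f \<in> Arr C" "Dom C f = X" "Cod C f = Y" "F = cls f"
    then have "X \<in> Obj C" "Y \<in> Obj C" by auto
    then show ?thesis using f by (simp add: Dec_Hom_iff decidable_\<Pi> Hom_iff)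
  qed
  show "AMap q_shriek (G \<cdot>\<^bsub>H\<^esub> F) = AMap q_shriek G \<cdot>\<^bsub>Dec C\<^esub> AMap q_shriek F"
    if "F \<in> Hom H X Y" "G \<in> Hom H Y Z" for X Y Z F G
    using that by (elim H_HomE) (simp add: Dec_simps)
qed (auto simp: H_category Dec_category Dec_simps decidable_\<Pi>)

text \<open>The quotient functor itself serves as \<open>q_star\<close>: \<open>inclusion\<close> is
  the identity on objects and arrows, so only the source category changes.\<close>

lemma q_star_is_functor: "is_functor (Dec C) H (quotient_functor C p)"
  unfolding is_functor_def
  using H_category Dec_category
  by (auto simp: Dec_Hom_iff Dec_simps Hom_iff H_Hom decidable_Obj)

text \<open>A class is lifted by extending a representative along \<open>p\<close>; the extension is
  unique because homotopic arrows into a decidable object are equal.\<close>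

lemma q_adjunction: "adjunction H (Dec C) q_shriek (quotient_functor C p) (\<lambda>X. cls (p X))"
  unfolding adjunction_def natural_transformation_def
proof (intro conjI ballI allI)
  show "is_functor H H id_functor"
    using H_category by (auto simp: is_functor_def id_functor_def category.Ide_in_Hom)
  show "is_functor H H (quotient_functor C p \<circ>\<^sub>F q_shriek)"
    unfolding is_functor_def
  proof (intro conjI ballI allI)
    show "AMap (quotient_functor C p \<circ>\<^sub>F q_shriek) F
        \<in> Hom H (OMap (quotient_functor C p \<circ>\<^sub>F q_shriek) X) (OMap (quotient_functor C p \<circ>\<^sub>F q_shriek) Y)"
      if "F \<in> Hom H X Y" for X Y F
      using that by (elim H_HomE) (auto simp: comp_functor_def H_Hom Hom_iff)
    show "AMap (quotient_functor C p \<circ>\<^sub>F q_shriek) (G \<cdot>\<^bsub>H\<^esub> F)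
        = AMap (quotient_functor C p \<circ>\<^sub>F q_shriek) G \<cdot>\<^bsub>H\<^esub> AMap (quotient_functor C p \<circ>\<^sub>F q_shriek) F"
      if "F \<in> Hom H X Y" "G \<in> Hom H Y Z" for X Y Z F G
      using that by (elim H_HomE) (simp add: comp_functor_def)
  qed (auto simp: H_category comp_functor_def)
  show "cls (p X) \<in> Hom H (OMap id_functor X) (OMap (quotient_functor C p \<circ>\<^sub>F q_shriek) X)"
    if "X \<in> Obj H" for X
    using that by (simp add: id_functor_def comp_functor_def Hom_def)
  show "AMap (quotient_functor C p \<circ>\<^sub>F q_shriek) F \<cdot>\<^bsub>H\<^esub> cls (p X) = cls (p Y) \<cdot>\<^bsub>H\<^esub> AMap id_functor F"
    if "F \<in> Hom H X Y" for X Y F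
    using that
  proof (rule H_HomE)
    fix f assume f: "f \<in> Arr C" "Dom C f = X" "Cod C f = Y" "F = cls f"
    then have "X \<in> Obj C" "Y \<in> Obj C" by auto
    then show ?thesis using f unit_natural[of f X Y] by (simp add: comp_functor_def id_functor_def)
  qed
  fix X Y F assume "X \<in> Obj H" and Y: "Y \<in> Obj (Dec C)"
    and F: "F \<in> Hom H X (OMap (quotient_functor C p) Y)"
  then have [simp]: "X \<in> Obj C" and DY: "decidable C Y" by (auto simp: Dec_simps)
  obtain f where f: "f \<in> Arr C" "Dom C f = X" "Cod C f = Y" "F = cls f"
    using F by (auto elim: H_HomE)
  obtain g where g: "g \<in> Arr C" "Dom C g = OMap \<Pi> X" "Cod C g = Y" "g \<cdot> p X = f"
    using reflection_exists[of f] f DY by auto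
  show "\<exists>!g. g \<in> Hom (Dec C) (OMap q_shriek X) Y \<and> AMap (quotient_functor C p) g \<cdot>\<^bsub>H\<^esub> cls (p X) = F"
  proof (rule ex1I[of _ g])
    show "g \<in> Hom (Dec C) (OMap q_shriek X) Y \<and> AMap (quotient_functor C p) g \<cdot>\<^bsub>H\<^esub> cls (p X) = F"
      using f g DY by (simp add: Dec_Hom_iff Hom_iff decidable_\<Pi>)
    fix k assume k: "k \<in> Hom (Dec C) (OMap q_shriek X) Y \<and> AMap (quotient_functor C p) k \<cdot>\<^bsub>H\<^esub> cls (p X) = F"
    then have k': "k \<in> Arr C" "Dom C k = OMap \<Pi> X" "Cod C k = Y" by (auto simp: Dec_Hom_iff Hom_iff)
    then have "homotopic C p (k \<cdot> p X) f" using k f by (simp add: cls_eq_iff)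
    then have "k \<cdot> p X = f" using homotopic_decidable_eq f DY by blast
    then show "k = g" using k' g DY by (intro reflection_unique[of k g X]) auto
  qed
qed (auto intro: q_shriek_is_functor q_star_is_functor)

text \<open>Full because every class has a representative, faithful because homotopic arrows into a
  decidable object are equal.\<close>

lemma q_star_fully_faithful: "fully_faithful (Dec C) H (quotient_functor C p)"
  unfolding fully_faithful_def
proof (intro conjI ballI q_star_is_functor)
  fix X Y assume "X \<in> Obj (Dec C)" "Y \<in> Obj (Dec C)"
  then have XY: "decidable C X" "decidable C Y" by (simp_all add: Dec_simps)
  have "f = g" if "f \<in> Hom C X Y" "g \<in> Hom C X Y" "cls f = cls g" for f g
    using homotopic_decidable_eq[of f g] that XY by (simp add: Hom_iff cls_eq_iff)
  then show "bij_betw (AMap (quotient_functor C p)) (Hom (Dec C) X Y)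
      (Hom H (OMap (quotient_functor C p) X) (OMap (quotient_functor C p) Y))"
    using XY by (auto simp: bij_betw_def inj_on_def H_Hom Dec_Hom_iff)
qed

text \<open>The decidable object \<open>W\<close> is the exponential of the base, to which the
  exponential chosen in \<open>H\<close> is isomorphic.\<close>

lemma q_star_exponential_ideal: "exponential_ideal (Dec C) H (quotient_functor C p)"
  unfolding exponential_ideal_def
proof (intro conjI ballI H_cartesian_closed q_star_fully_faithful)
  fix X Y assume "X \<in> Obj H" "Y \<in> Obj (Dec C)"
  then show "\<exists>W\<in>Obj (Dec C). isomorphic H (expo H X (OMap (quotient_functor C p) Y)) (OMap (quotient_functor C p) W)"
    using H_expo_isomorphic[of X Y] decidable_expo[of Y X] decidable_Obj
    by (intro bexI[of _ "expo C X Y"]) (auto simp: Dec_simps)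
qed

text \<open>Terminal objects and products of \<open>H\<close> are determined only up to homotopy
  equivalence, and \<Pi> turns homotopy equivalences into isomorphisms; preservation in the base is
  transported along these.\<close>

lemma q_shriek_preserves_finite_products: "preserves_finite_products H (Dec C) q_shriek"
  unfolding preserves_finite_products_def
proof (intro conjI allI ballI impI)
  fix T assume T: "is_terminal H T"
  then have [simp]: "T \<in> Obj C" by (simp add: is_terminal_def)
  have "one C \<in> Obj H" by simp
  then obtain F where "F \<in> Hom H (one C) T" using T unfolding is_terminal_def by blast
  then obtain t where t: "t \<in> Arr C" "Dom C t = one C" "Cod C t = T" by (rule H_HomE)
  \<comment> \<open>Both classes end in a terminal object of \<open>H\<close>. Consequently
    \<open>\<Pi> T\<close> is a retract of the terminal object \<open>\<Pi> 1\<close>.\<close>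
  have "cls (t \<cdot> bang T) = cls (Ide C T)"
    by (rule category.terminal_unique[OF H_category T]) (use t in auto)
  then have "homotopic C p (t \<cdot> bang T) (Ide C T)" using t by (simp add: cls_eq_iff)
  from \<Pi>_homotopic[OF this] have e: "AMap \<Pi> t \<cdot> AMap \<Pi> (bang T) = Ide C (OMap \<Pi> T)" using t by simp
  have "is_terminal C (OMap \<Pi> T)"
    unfolding is_terminal_def
  proof (intro conjI ballI)
    fix X assume X: "X \<in> Obj C"
    have T1: "is_terminal C (OMap \<Pi> (one C))" using \<Pi>_preserves_terminal one_terminal by blast
    then obtain f where f: "f \<in> Hom C X (OMap \<Pi> (one C))" using X unfolding is_terminal_def by blast
    show "\<exists>!f. f \<in> Hom C X (OMap \<Pi> T)"
    proof (rule ex1I[of _ "AMap \<Pi> t \<cdot> f"])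
      show "AMap \<Pi> t \<cdot> f \<in> Hom C X (OMap \<Pi> T)" using f t by (simp add: Hom_iff)
      fix g assume g: "g \<in> Hom C X (OMap \<Pi> T)"
      have "AMap \<Pi> (bang T) \<cdot> g = f"
        by (rule terminal_unique[OF T1]) (use f g in \<open>auto simp: Hom_iff\<close>)
      then show "g = AMap \<Pi> t \<cdot> f"
        using Comp_eq_extend[OF e, of g] g t by (simp add: Hom_iff)
    qed
  qed simp
  then show "is_terminal (Dec C) (OMap q_shriek T)" by (simp add: Dec_terminal decidable_\<Pi>)
next
  fix A B Q F G assume "A \<in> Obj H" "B \<in> Obj H" and Q: "is_product H A B Q F G"
  then have [simp]: "A \<in> Obj C" "B \<in> Obj C" by simp_all
  obtain f g t where f: "f \<in> Arr C" "g \<in> Arr C" "Cod C f = A" "Cod C g = B" "Dom C f = Q" "Dom C g = Q"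
    "F = cls f" "G = cls g" and t: "t \<in> Arr C" "Dom C t = prod C A B" "Cod C t = Q"
    "cls (pairing C f g \<cdot> t) = cls (Ide C (prod C A B))" "cls (t \<cdot> pairing C f g) = cls (Ide C Q)"
    using H_product_iso[OF Q] .
  have Qo: "Q \<in> Obj C" using f by auto
  let ?i = "pairing C f g"
  have 1: "AMap \<Pi> ?i \<cdot> AMap \<Pi> t = Ide C (OMap \<Pi> (prod C A B))"
    using \<Pi>_homotopic[of "?i \<cdot> t" "Ide C (prod C A B)"] t f
    by (simp add: cls_eq_iff del: pairing_comp)
  have 2: "AMap \<Pi> t \<cdot> AMap \<Pi> ?i = Ide C (OMap \<Pi> Q)"
    using \<Pi>_homotopic[of "t \<cdot> ?i" "Ide C Q"] t f Qo by (simp add: cls_eq_iff)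
  have "is_product C (OMap \<Pi> A) (OMap \<Pi> B) (OMap \<Pi> Q)
    (AMap \<Pi> (pr1 C A B) \<cdot> AMap \<Pi> ?i) (AMap \<Pi> (pr2 C A B) \<cdot> AMap \<Pi> ?i)"
    by (rule product_transport[OF \<Pi>_preserves_product[OF prod_is_product] _ _ 2 1])
      (use f t in \<open>auto simp: Hom_iff\<close>)
  moreover have "AMap \<Pi> (pr1 C A B) \<cdot> AMap \<Pi> ?i = AMap \<Pi> f" "AMap \<Pi> (pr2 C A B) \<cdot> AMap \<Pi> ?i = AMap \<Pi> g"
    using f \<Pi>_functor(2)[of ?i "pr1 C A B"] \<Pi>_functor(2)[of ?i "pr2 C A B"] by simp_all
  ultimately show "is_product (Dec C) (OMap q_shriek A) (OMap q_shriek B) (OMap q_shriek Q)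
      (AMap q_shriek F) (AMap q_shriek G)"
    using f Qo by (simp add: Dec_product decidable_\<Pi>)
qed

end

text \<open>The exponential ideal claim appears in its two usual forms: closure of the embedded
  category under exponentials, and preservation of finite products by the left adjoint.\<close>

theorem theoremB:
  fixes E :: "('o, 'a) category"
    and \<Pi> :: "('o, 'a, 'o, 'a) cfunctor"
    and p :: "'o \<Rightarrow> 'a"
  assumes "topos E" and "NS E" and "WDQO E"
    and "adjunction E (Dec E) \<Pi> inclusion p"
  shows "homotopy_theory E (inclusion \<circ>\<^sub>F \<Pi>) p \<and>
    (\<exists>(q_shriek :: ('o, 'a set, 'o, 'a) cfunctor)
       (q_star :: ('o, 'a, 'o, 'a set) cfunctor) (u :: 'o \<Rightarrow> 'a set).
       adjunction (homotopy_category E p) (Dec E) q_shriek q_star u \<and>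
       functor_eq E (q_shriek \<circ>\<^sub>F quotient_functor E p) \<Pi> \<and>
       functor_eq (Dec E) q_star (quotient_functor E p \<circ>\<^sub>F inclusion) \<and>
       exponential_ideal (Dec E) (homotopy_category E p) q_star \<and>
       preserves_finite_products (homotopy_category E p) (Dec E) q_shriek)"
proof -
  have ccc: "category E" "has_finite_products E"
    "\<And>X Y. X \<in> Obj E \<Longrightarrow> Y \<in> Obj E \<Longrightarrow> \<exists>Z e. is_exponential E X Y Z e"
    and lim: "\<And>X Y f g. X \<in> Obj E \<Longrightarrow> Y \<in> Obj E \<Longrightarrow> f \<in> Hom E X Y \<Longrightarrow> g \<in> Hom E X Y \<Longrightarrow>
      \<exists>K k. is_equalizer E f g K k"
    and cl: "\<exists>Om t. is_subobject_classifier E Om t"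
    using \<open>topos E\<close> by (auto simp: topos_def cartesian_closed_def has_finite_limits_def)
  interpret decidable_reflection E \<Pi> p
    by (intro decidable_reflection.intro nullstellensatz_topos.intro elementary_topos.intro
        cartesian_closed_category.intro finite_product_category.intro ccc(1) finite_product_category_axioms.intro ccc(2)
        cartesian_closed_category_axioms.intro ccc(3) elementary_topos_axioms.intro lim cl
        nullstellensatz_topos_axioms.intro decidable_reflection_axioms.intro assms)
  \<comment> \<open>As \<open>inclusion\<close> is the identity, the second equation is
    definitional; the first is the value of \<open>q_shriek\<close> on classes.\<close>
  have "functor_eq E (q_shriek \<circ>\<^sub>F quotient_functor E p) \<Pi>"
    "functor_eq (Dec E) (quotient_functor E p) (quotient_functor E p \<circ>\<^sub>F inclusion)"
    by (simp_all add: functor_eq_def comp_functor_def id_functor_def)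
  then show ?thesis
    using unit_homotopy_theory q_adjunction q_star_exponential_ideal q_shriek_preserves_finite_products
    by blast
qed

end
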